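(* Consider the forward complete differential inclusion $\dot x(t)\in F(x(t))$ on $\mathbb{R}^n$, where $F$ is a locally Lipschitz set-valued map with nonempty compact values, with locally Lipschitz output map $h:\mathbb{R}^n\to\mathbb{R}^{p_y}$ and continuous proper map $\omega:\mathbb{R}^n\to\mathbb{R}_{\ge 0}$. Let $D\subset\mathbb{R}^n$ be a closed set and let $E=\mathbb{R}^n\setminus D$. The following are equivalent. (1) The system is relatively error stable with respect to $D$. (2) The system admits a lower semicontinuous RES-Lyapunov function on $E$. (3) The system admits a lower semicontinuous exponential decay RES-Lyapunov function on $E$.
   Context: Setting. $F$ maps points of $\mathbb{R}^n$ to nonempty compact subsets of $\mathbb{R}^n$. $F$ is locally Lipschitz: every $\xi\in\mathbb{R}^n$ has a neighbourhood $U$ and $L>0$ with $F(\eta)\subseteq F(\zeta)+L|\eta-\zeta|\mathcal{B}$ for all $\eta,\zeta\in U$, where $\mathcal{B}$ is the closed Euclidean unit ball and $|\cdot|$ is the Euclidean norm. A solution of $\dot x\in F(x)$ on $[0,T)$, $0<T\le\infty$, is a function $x:[0,T)\to\mathbb{R}^n$, absolutely continuous on compact subintervals, with $\dot x(t)\in F(x(t))$ for almost every $t$. It is maximal if it has no extension to a solution on $[0,T_+)$ with $T_+>T$. Forward completeness means that every maximal solution is defined for all $t\ge0$. $\mathbf{S}$ is the set of all maximal solutions. Write $|\xi|_\omega:=\omega(\xi)$ and $y(t):=h(x(t))$. Comparison functions. $\gamma:\mathbb{R}_{\ge0}\to\mathbb{R}_{\ge0}$ is of class $\mathcal{K}$ if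 it is continuous, strictly increasing, zero at $0$ and positive elsewhere; it is of class $\mathcal{K}_\infty$ if in addition it is unbounded. $\beta:\mathbb{R}_{\ge0}\times\mathbb{R}_{\ge0}\to\mathbb{R}_{\ge0}$ is of class $\mathcal{KL}$ if $\beta(\cdot,t)\in\mathcal{K}$ for each fixed $t\ge 0$ and, for each fixed $s\ge 0$, $\beta(s,t)$ decreases (is nonincreasing) to $0$ as $t\to\infty$. Relative error stability (RES) with respect to a closed set $D$: there exists $\beta\in\mathcal{KL}$ such that for every $x(\cdot)\in\mathbf{S}$ and every $t_1>0$ with $x(t)\notin D$ for all $t\in[0,t_1]$, one has $|y(t)|\le\beta(|x(0)|_\omega,t)$ for all $t\in[0,t_1]$. Viscosity subdifferential: $\zeta\in\partial_D V(\xi)$ for $V:\mathbb{R}^n\to\mathbb{R}$ iff there are a function $r:\mathbb{R}^n\to\mathbb{R}$ with $\lim_{k\to0} r(k)/|k|=0$ and a neighbourhood $\mathcal{O}$ of the origin such that $V(\xi+k)-V(\xi)-\zeta\cdot k\ge r(k)$ for all $k\in\mathcal{O}$. (This set may be empty.) Lower semicontinuous RES-Lyapunov function on the open set $E$: a lower semicontinuous $V:\mathbb{R}^n\to\mathbb{R}_{\ge0}$ such that (i) there exist $\alpha_1,\alpha_2\in\mathcal{K}_\infty$ with $\alpha_1(|h(\xi)|)\le V(\xi)\le\alpha_2(|\xi|_\omega)$ for all $\xi\in E$; (ii) there exists a continuous positive definite $\alpha_3:\mathbb{R}_{\ge0}\to\mathbb{R}_{\ge0}$ (zero at $0$, positive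 elsewhere) such that for each $\xi\in E$, $\zeta\cdot v\le-\alpha_3(V(\xi))$ for all $\zeta\in\partial_D V(\xi)$ and all $v\in F(\xi)$. It is an exponential decay RES-Lyapunov function on $E$ if in addition (ii) holds with $\alpha_3(r)=r$. *)

theory Defs
  imports "HOL-Analysis.Analysis"
begin

section \<open>Regularity notions\<close>

text \<open>Finite families of non-overlapping compact subintervals \<open>[Inf k, Sup k]\<close> of \<open>S\<close> are
  rendered by divisions (of their own union).\<close>

definition absolutely_continuous_on :: "real set \<Rightarrow> (real \<Rightarrow> 'a::real_normed_vector) \<Rightarrow> bool" where
  "absolutely_continuous_on S f \<longleftrightarrow>
     (\<forall>\<epsilon>>0. \<exists>\<delta>>0. \<forall>d. d division_of \<Union>d \<and> \<Union>d \<subseteq> S \<and> (\<Sum>k\<in>d. Sup k - Inf k) < \<delta> \<longrightarrow>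
        (\<Sum>k\<in>d. norm (f (Sup k) - f (Inf k))) < \<epsilon>)"

definition locally_Lipschitz :: "('a::metric_space \<Rightarrow> 'b::metric_space) \<Rightarrow> bool" where
  "locally_Lipschitz f \<longleftrightarrow> (\<forall>\<xi>. \<exists>U L. open U \<and> \<xi> \<in> U \<and> L-lipschitz_on U f)"

definition locally_Lipschitz_set_map :: "(real^'n \<Rightarrow> (real^'n) set) \<Rightarrow> bool" where
  "locally_Lipschitz_set_map F \<longleftrightarrow>
     (\<forall>\<xi>. \<exists>U L. open U \<and> \<xi> \<in> U \<and> L > 0 \<and>
        (\<forall>\<eta>\<in>U. \<forall>\<zeta>\<in>U.
           F \<eta> \<subseteq> {a + (L * norm (\<eta> - \<zeta>)) *\<^sub>R b | a b. a \<in> F \<zeta> \<and> b \<in> cball 0 1}))"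

definition lower_semicontinuous :: "('a::topological_space \<Rightarrow> real) \<Rightarrow> bool" where
  "lower_semicontinuous V \<longleftrightarrow> (\<forall>\<xi>. \<forall>a < V \<xi>. \<forall>\<^sub>F \<eta> in nhds \<xi>. a < V \<eta>)"

section \<open>Solutions\<close>

text \<open>A function on \<open>[0,T)\<close> is represented by a function on all reals whose values outside
  \<open>[0,T)\<close> play no role. At \<open>t = 0\<close> the two-sided derivative does look at values outside,
  but a single point is negligible.\<close>

definition is_solution :: "(real^'n \<Rightarrow> (real^'n) set) \<Rightarrow> (real \<Rightarrow> real^'n) \<Rightarrow> ereal \<Rightarrow> bool" where
  "is_solution F x T \<longleftrightarrow>
     0 < T \<and>
     (\<forall>a b. 0 \<le> a \<and> a \<le> b \<and> ereal b < T \<longrightarrow> absolutely_continuous_on {a..b} x) \<and>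
     (AE t in lebesgue. 0 \<le> t \<and> ereal t < T \<longrightarrow>
        (\<exists>v \<in> F (x t). (x has_vector_derivative v) (at t)))"

definition is_maximal_solution :: "(real^'n \<Rightarrow> (real^'n) set) \<Rightarrow> (real \<Rightarrow> real^'n) \<Rightarrow> ereal \<Rightarrow> bool" where
  "is_maximal_solution F x T \<longleftrightarrow>
     is_solution F x T \<and>
     \<not> (\<exists>z T'. T < T' \<and> is_solution F z T' \<and> (\<forall>t. 0 \<le> t \<and> ereal t < T \<longrightarrow> z t = x t))"

definition forward_complete :: "(real^'n \<Rightarrow> (real^'n) set) \<Rightarrow> bool" where
  "forward_complete F \<longleftrightarrow> (\<forall>x T. is_maximal_solution F x T \<longrightarrow> T = \<infinity>)"

section \<open>Comparison functions\<close>

text \<open>Functions on \<open>[0,\<infinity>)\<close> are represented by functions on all reals, constrained only on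
  nonnegative arguments.\<close>

definition class_K :: "(real \<Rightarrow> real) \<Rightarrow> bool" where
  "class_K \<gamma> \<longleftrightarrow>
     continuous_on {0..} \<gamma> \<and> strict_mono_on {0..} \<gamma> \<and> \<gamma> 0 = 0 \<and> (\<forall>s>0. \<gamma> s > 0)"

definition class_K_inf :: "(real \<Rightarrow> real) \<Rightarrow> bool" where
  "class_K_inf \<gamma> \<longleftrightarrow> class_K \<gamma> \<and> \<not> bounded (\<gamma> ` {0..})"

definition class_KL :: "(real \<Rightarrow> real \<Rightarrow> real) \<Rightarrow> bool" where
  "class_KL \<beta> \<longleftrightarrow>
     (\<forall>t\<ge>0. class_K (\<lambda>s. \<beta> s t)) \<and>
     (\<forall>s\<ge>0. antimono_on {0..} (\<beta> s) \<and> (\<beta> s \<longlongrightarrow> 0) at_top)"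

definition continuous_positive_definite :: "(real \<Rightarrow> real) \<Rightarrow> bool" where
  "continuous_positive_definite \<alpha> \<longleftrightarrow>
     continuous_on {0..} \<alpha> \<and> \<alpha> 0 = 0 \<and> (\<forall>s>0. \<alpha> s > 0)"

section \<open>Relative error stability and Lyapunov functions\<close>

definition relatively_error_stable ::
  "(real^'n \<Rightarrow> (real^'n) set) \<Rightarrow> (real^'n \<Rightarrow> real^'p) \<Rightarrow> (real^'n \<Rightarrow> real) \<Rightarrow> (real^'n) set \<Rightarrow> bool" where
  "relatively_error_stable F h \<omega> D \<longleftrightarrow>
     (\<exists>\<beta>. class_KL \<beta> \<and>
        (\<forall>x T. is_maximal_solution F x T \<longrightarrow>
           (\<forall>t1. 0 < t1 \<and> ereal t1 < T \<and> (\<forall>t\<in>{0..t1}. x t \<notin> D) \<longrightarrow>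
              (\<forall>t\<in>{0..t1}. norm (h (x t)) \<le> \<beta> (\<omega> (x 0)) t))))"

definition viscosity_subdifferential :: "(real^'n \<Rightarrow> real) \<Rightarrow> real^'n \<Rightarrow> (real^'n) set" where
  "viscosity_subdifferential V \<xi> =
     {\<zeta>. \<exists>r :: real^'n \<Rightarrow> real. ((\<lambda>k. r k / norm k) \<longlongrightarrow> 0) (at 0) \<and>
          (\<exists>N. open N \<and> 0 \<in> N \<and> (\<forall>k\<in>N. V (\<xi> + k) - V \<xi> - \<zeta> \<bullet> k \<ge> r k))}"

definition decays_with_rate ::
  "(real^'n \<Rightarrow> (real^'n) set) \<Rightarrow> (real^'n) set \<Rightarrow> (real^'n \<Rightarrow> real) \<Rightarrow> (real \<Rightarrow> real) \<Rightarrow> bool" where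
  "decays_with_rate F E V \<alpha> \<longleftrightarrow>
     (\<forall>\<xi>\<in>E. \<forall>\<zeta>\<in>viscosity_subdifferential V \<xi>. \<forall>v\<in>F \<xi>. \<zeta> \<bullet> v \<le> - \<alpha> (V \<xi>))"

definition lsc_RES_Lyapunov_function ::
  "(real^'n \<Rightarrow> (real^'n) set) \<Rightarrow> (real^'n \<Rightarrow> real^'p) \<Rightarrow> (real^'n \<Rightarrow> real) \<Rightarrow> (real^'n) set \<Rightarrow>
   (real^'n \<Rightarrow> real) \<Rightarrow> bool" where
  "lsc_RES_Lyapunov_function F h \<omega> E V \<longleftrightarrow>
     (\<forall>\<xi>. 0 \<le> V \<xi>) \<and>
     lower_semicontinuous V \<and>
     (\<exists>\<alpha>1 \<alpha>2. class_K_inf \<alpha>1 \<and> class_K_inf \<alpha>2 \<and>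
        (\<forall>\<xi>\<in>E. \<alpha>1 (norm (h \<xi>)) \<le> V \<xi> \<and> V \<xi> \<le> \<alpha>2 (\<omega> \<xi>))) \<and>
     (\<exists>\<alpha>3. continuous_positive_definite \<alpha>3 \<and> decays_with_rate F E V \<alpha>3)"

definition lsc_exp_decay_RES_Lyapunov_function ::
  "(real^'n \<Rightarrow> (real^'n) set) \<Rightarrow> (real^'n \<Rightarrow> real^'p) \<Rightarrow> (real^'n \<Rightarrow> real) \<Rightarrow> (real^'n) set \<Rightarrow>
   (real^'n \<Rightarrow> real) \<Rightarrow> bool" where
  "lsc_exp_decay_RES_Lyapunov_function F h \<omega> E V \<longleftrightarrow>
     lsc_RES_Lyapunov_function F h \<omega> E V \<and> decays_with_rate F E V (\<lambda>r. r)"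

end

theory Submission
  imports Defs
begin

text \<open>A Lyapunov function with rate \<open>\<alpha>\<close> becomes one with exponential decay after composition with a solution
  \<open>\<rho>\<close> of \<open>\<rho>' * \<alpha> \<ge> \<rho>\<close>. Its inf-convolutions are Lipschitz along any solution \<open>x\<close>, and their
  proximal subgradients together with the Lipschitz property of \<open>F\<close> give an integral decay estimate whose
  error vanishes in the limit; hence \<open>exp t * V (x t) \<le> V (x 0)\<close>, which is a \<open>\<K>\<L>\<close> bound on the output.

  Conversely, after rescaling, a \<open>\<K>\<L>\<close> bound decays exponentially, and \<open>V \<xi>\<close> is the supremum of
  \<open>exp t * p (norm (h (x t)))\<close> over solutions from \<open>\<xi>\<close> until they leave \<open>E\<close>. Concatenation gives
  its decay along solutions. Filippov's theorem, needed because \<open>F\<close> is not convex-valued, gives lower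
  semicontinuity (solutions depend continuously on the initial point) and turns decay along
  solutions into the subdifferential inequality (every \<open>v \<in> F \<xi>\<close> is an initial velocity).\<close>

section \<open>Comparison functions\<close>

text \<open>In one direction the difficulty is that \<open>V\<close> is only lower semicontinuous:
  it need not be continuous along a solution, and its subdifferential may be empty at every point
  that the solution visits. The error of moving there is a multiple of the difference of the
  inf-convolutions with penalties \<open>p\<close> and \<open>p/2\<close>. This difference is
  bounded and tends to 0 pointwise, so dominated convergence removes it. In the other direction the
  bound concerns maximal solutions, whereas Filippov's theorem yields solutions on bounded
  intervals; each of these is part of a maximal solution, so the bound carries over. The solutions
  are sought among curves whose velocity is a uniform limit of dyadic step functions. This class is
  stable under the Picard limit in Filippov's theorem and under concatenation at times
  \<open>1/2^j\<close>, and such times suffice to test a subgradient inequality, since they tend to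
  0.\<close>

lemma class_K_nonneg: "class_K g \<Longrightarrow> 0 \<le> s \<Longrightarrow> 0 \<le> g s"
  unfolding class_K_def by (cases "s = 0") (auto intro: less_imp_le)

lemma class_K_less: "class_K g \<Longrightarrow> 0 \<le> s \<Longrightarrow> s < t \<Longrightarrow> g s < g t"
  unfolding class_K_def by (auto intro: strict_mono_onD)

lemma class_K_le: "class_K g \<Longrightarrow> 0 \<le> s \<Longrightarrow> s \<le> t \<Longrightarrow> g s \<le> g t"
  using class_K_less[of g s t] by (cases "s = t") auto

lemma class_KI:
  assumes "continuous_on {0..} g" "g 0 = 0" "\<And>s t. 0 \<le> s \<Longrightarrow> s < t \<Longrightarrow> g s < g t"
  shows "class_K g"
  unfolding class_K_def using assms by (auto intro!: strict_mono_onI) (metis order_refl)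

lemma class_K_inf_unbounded:
  assumes "class_K_inf g" shows "\<exists>s>0. B < g s"
proof (rule ccontr)
  assume *: "\<not> (\<exists>s>0. B < g s)"
  have K: "class_K g" using assms by (simp add: class_K_inf_def)
  have "norm (g s) \<le> max B 0" if "0 \<le> s" for s
  proof (cases "s = 0")
    case False
    then have "\<not> B < g s" using * that by auto
    then show ?thesis using class_K_nonneg[OF K that] by simp
  qed (use K in \<open>simp add: class_K_def\<close>)
  then have "bounded (g ` {0..})" by (auto simp: bounded_iff)
  with assms show False by (simp add: class_K_inf_def)
qed

lemma class_K_infI:
  assumes "class_K g" "\<And>B. \<exists>s\<ge>0. B < g s"
  shows "class_K_inf g"
  unfolding class_K_inf_def
proof (intro conjI notI)
  assume "bounded (g ` {0..})"
  then obtain B where B: "\<And>s. 0 \<le> s \<Longrightarrow> norm (g s) \<le> B" by (auto simp: bounded_iff)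
  obtain s where "0 \<le> s" "B < g s" using assms(2) by blast
  with B[of s] show False by simp
qed (use assms in auto)

lemma class_K_inf_compose:
  assumes f: "class_K_inf f" and g: "class_K_inf g"
  shows "class_K_inf (\<lambda>s. f (g s))"
proof (rule class_K_infI)
  have fK: "class_K f" and gK: "class_K g" using f g by (simp_all add: class_K_inf_def)
  show "class_K (\<lambda>s. f (g s))"
  proof (rule class_KI)
    show "continuous_on {0..} (\<lambda>s. f (g s))"
      by (rule continuous_on_compose2[of "{0..}" f]) (use fK gK class_K_nonneg in \<open>auto simp: class_K_def\<close>)
    show "f (g 0) = 0" using fK gK by (simp add: class_K_def)
    show "f (g s) < f (g t)" if "0 \<le> s" "s < t" for s t
      using that class_K_less[OF fK] class_K_less[OF gK] class_K_nonneg[OF gK] by blast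
  qed
  show "\<exists>s\<ge>0. B < f (g s)" for B
  proof -
    obtain r where r: "0 < r" "B < f r" using class_K_inf_unbounded[OF f] by blast
    obtain s where s: "0 < s" "r < g s" using class_K_inf_unbounded[OF g] by blast
    then show ?thesis using r class_K_less[OF fK, of r "g s"] by (intro exI[of _ s]) auto
  qed
qed

lemma class_K_inf_inverse:
  assumes g: "class_K_inf g"
  obtains q where "class_K_inf q" "\<And>s. 0 \<le> s \<Longrightarrow> q (g s) = s" "\<And>r. 0 \<le> r \<Longrightarrow> g (q r) = r"
proof -
  have K: "class_K g" using g by (simp add: class_K_inf_def)
  have g0: "g 0 = 0" and cont: "continuous_on {0..} g" using K by (simp_all add: class_K_def)
  have surj: "\<exists>s\<ge>0. g s = r" if r: "0 \<le> r" for r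
  proof -
    obtain b where b: "0 < b" "r < g b" using class_K_inf_unbounded[OF g] by blast
    have "\<exists>s\<ge>0. s \<le> b \<and> g s = r"
      by (rule IVT') (use r b g0 in \<open>auto intro: continuous_on_subset[OF cont]\<close>)
    then show ?thesis by blast
  qed
  define q where "q r = (SOME s. 0 \<le> s \<and> g s = r)" for r
  have q: "0 \<le> q r" "g (q r) = r" if "0 \<le> r" for r
    using someI_ex[of "\<lambda>s. 0 \<le> s \<and> g s = r"] surj[OF that] unfolding q_def by auto
  have inj: "s = t" if "0 \<le> s" "0 \<le> t" "g s = g t" for s t
    using class_K_less[OF K, of s t] class_K_less[OF K, of t s] that by (cases s t rule: linorder_cases) auto
  have qg: "q (g s) = s" if "0 \<le> s" for s
    using inj q[of "g s"] class_K_nonneg[OF K that] that by blast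
  have qless: "q r < q r'" if "0 \<le> r" "r < r'" for r r'
    using class_K_le[OF K, of "q r'" "q r"] q[of r] q[of r'] that by (cases "q r < q r'") auto
  have "class_K q"
  proof (rule class_KI)
    show "q 0 = 0" using qg[of 0] g0 by simp
    show "q s < q t" if "0 \<le> s" "s < t" for s t using qless that .
    \<comment> \<open>In the order topology it suffices that \<open>a < q r\<close> amounts to
      \<open>g a < r\<close>, and dually.\<close>
    show "continuous_on {0..} q"
      unfolding continuous_on_def
    proof (intro ballI order_tendstoI)
      fix r a :: real assume r: "r \<in> {0..}" and a: "a < q r"
      show "\<forall>\<^sub>F x in at r within {0..}. a < q x"
      proof (cases "a < 0")
        case True
        have "a < q x" if "x \<in> {0..}" for x using q(1)[of x] that True by simp
        then show ?thesis by (simp add: eventually_at_filter)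
      next
        case False
        then have "g a < r" using a r q(2)[of r] class_K_less[OF K, of a "q r"] by auto
        then have "\<forall>\<^sub>F x in at r within {0..}. g a < x"
          by (intro order_tendstoD(1)[OF tendsto_ident_at])
        moreover have "\<forall>\<^sub>F x in at r within {0..}. x \<in> {0..}" by (auto simp: eventually_at_filter)
        ultimately show ?thesis
        proof eventually_elim
          case (elim x)
          then show ?case using qless[of "g a" x] qg[of a] False class_K_nonneg[OF K, of a] by simp
        qed
      qed
    next
      fix r a :: real assume r: "r \<in> {0..}" and a: "q r < a"
      then have a0: "0 \<le> a" using q(1)[of r] by auto
      have "r < g a" using a r q[of r] class_K_less[OF K, of "q r" a] by auto
      then have "\<forall>\<^sub>F x in at r within {0..}. x < g a"
        by (intro order_tendstoD(2)[OF tendsto_ident_at])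
      moreover have "\<forall>\<^sub>F x in at r within {0..}. x \<in> {0..}" by (auto simp: eventually_at_filter)
      ultimately show "\<forall>\<^sub>F x in at r within {0..}. q x < a"
      proof eventually_elim
        case (elim x)
        then show ?case using qless[of x "g a"] qg[of a] a0 by auto
      qed
    qed
  qed
  moreover have "\<exists>s\<ge>0. B < q s" for B
    using qg[of "max 0 B + 1"] class_K_nonneg[OF K, of "max 0 B + 1"]
    by (intro exI[of _ "g (max 0 B + 1)"]) auto
  ultimately have "class_K_inf q" by (rule class_K_infI)
  with that qg q show thesis by blast
qed

text \<open>\<open>m\<close> may jump and may be constant on intervals. Its 1-Lipschitz lower
  envelope \<open>n\<close> repairs continuity, and the factor \<open>r / (1 + r)\<close> adds
  strict growth and the value 0 at 0. The envelope stays positive and unbounded, because a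
  competitor \<open>s\<close> either is at least \<open>r/2\<close>, so that it pays
  \<open>m (r/2)\<close>, or is at distance at least \<open>r/2\<close>.\<close>

lemma class_K_inf_minorant:
  fixes m :: "real \<Rightarrow> real"
  assumes mono: "\<And>r s. 0 < r \<Longrightarrow> r \<le> s \<Longrightarrow> m r \<le> m s"
    and pos: "\<And>r. 0 < r \<Longrightarrow> 0 < m r"
    and unb: "\<And>B. \<exists>r>0. B < m r"
  obtains p where "class_K_inf p" "\<And>r. 0 < r \<Longrightarrow> p r \<le> m r"
proof -
  define n where "n r = (INF s\<in>{0<..}. m s + \<bar>r - s\<bar>)" for r
  have bdd: "bdd_below ((\<lambda>s. m s + \<bar>r - s\<bar>) ` {0<..})" for r
    by (intro bdd_belowI2[of _ 0]) (metis abs_ge_zero add_increasing2 greaterThan_iff less_imp_le pos)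
  have nlow: "n r \<le> m s + \<bar>r - s\<bar>" if "0 < s" for r s
    unfolding n_def using that by (intro cINF_lower[OF bdd]) auto
  have nge: "a \<le> n r" if "\<And>s. 0 < s \<Longrightarrow> a \<le> m s + \<bar>r - s\<bar>" for a r
    unfolding n_def using that by (intro cINF_greatest) auto
  have n_half: "min (m (r/2)) (r/2) \<le> n r" if "0 < r" for r
  proof (rule nge)
    fix s :: real assume "0 < s"
    then show "min (m (r/2)) (r/2) \<le> m s + \<bar>r - s\<bar>"
      using mono[of "r/2" s] pos[of s] that by (cases "s \<ge> r/2") linarith+
  qed
  have npos: "0 < n r" if "0 < r" for r
    using n_half[OF that] pos[of "r/2"] that by (auto simp: min_def split: if_splits)
  have nnn: "0 \<le> n r" for r
    by (rule nge) (metis abs_ge_zero add_increasing2 less_imp_le pos)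
  have nmono: "n r \<le> n r'" if "0 < r" "r \<le> r'" for r r'
  proof (rule nge)
    fix s :: real assume s: "0 < s"
    show "n r \<le> m s + \<bar>r' - s\<bar>"
    proof (cases "s \<ge> r")
      case True
      then show ?thesis using nlow[of r r] mono[of r s] that by linarith
    next
      case False
      then show ?thesis using nlow[of s r] s that by linarith
    qed
  qed
  have nlip: "n r \<le> n r' + \<bar>r - r'\<bar>" for r r'
  proof -
    have "n r - \<bar>r - r'\<bar> \<le> n r'"
    proof (rule nge)
      fix s :: real assume "0 < s"
      then show "n r - \<bar>r - r'\<bar> \<le> m s + \<bar>r' - s\<bar>" using nlow[of s r] by linarith
    qed
    then show ?thesis by simp
  qed
  have ncont: "continuous_on A n" for A
  proof (rule lipschitz_on_continuous_on[of 1], rule lipschitz_onI)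
    show "dist (n x) (n y) \<le> 1 * dist x y" for x y
      using nlip[of x y] nlip[of y x] by (simp add: dist_real_def)
  qed simp
  define p where "p r = r / (1 + r) * n r" for r
  have "class_K p"
  proof (rule class_KI)
    show "continuous_on {0..} p" unfolding p_def
      by (intro continuous_intros ncont) auto
    show "p 0 = 0" by (simp add: p_def)
    fix s t :: real assume st: "0 \<le> s" "s < t"
    then have "s / (1 + s) < t / (1 + t)" by (simp add: divide_simps algebra_simps)
    then have "s / (1 + s) * n t < t / (1 + t) * n t"
      using npos[of t] st by (intro mult_strict_right_mono) auto
    moreover have "s / (1 + s) * n s \<le> s / (1 + s) * n t"
      using nmono[of s t] st by (cases "s = 0") (simp, intro mult_left_mono, auto)
    ultimately show "p s < p t" by (simp add: p_def)
  qed
  moreover have "\<exists>s\<ge>0. B < p s" for B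
  proof -
    obtain r where r: "0 < r" "2 * \<bar>B\<bar> < m r" using unb by blast
    \<comment> \<open>Both \<open>m (s/2)\<close> and \<open>s/2\<close> exceed
      \<open>2 * \<bar>B\<bar>\<close>, so \<open>n_half\<close> applies; the 2 is lost again to
      \<open>s / (1 + s) \<ge> 1/2\<close>.\<close>
    define s where "s = max (2 * r) (max 1 (4 * \<bar>B\<bar> + 1))"
    have s: "1 \<le> s" "2 * r \<le> s" "4 * \<bar>B\<bar> < s" by (auto simp: s_def)
    then have "2 * \<bar>B\<bar> < n s" using n_half[of s] mono[of r "s/2"] r by (auto simp: min_def split: if_splits)
    moreover have "1/2 \<le> s / (1 + s)" using s by (simp add: divide_simps)
    then have "1/2 * n s \<le> s / (1 + s) * n s" using nnn by (intro mult_right_mono) auto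
    ultimately have "B < s / (1 + s) * n s" by linarith
    then have "B < p s" by (simp only: p_def)
    then show ?thesis using s by (intro exI[of _ s]) auto
  qed
  ultimately have "class_K_inf p" by (rule class_K_infI)
  moreover have "p r \<le> m r" if "0 < r" for r
  proof -
    have "p r \<le> 1 * n r" unfolding p_def using that nnn by (intro mult_right_mono) auto
    then show ?thesis using nlow[of r r] that by auto
  qed
  ultimately show thesis using that by blast
qed

text \<open>By duality with the minorant: \<open>m\<close> is a generalized inverse of
  \<open>M s + s\<close>, and the inverse of a minorant of \<open>m\<close> lies above
  \<open>M\<close>. The added \<open>s\<close> makes every \<open>S r\<close> nonempty even if
  \<open>M\<close> is bounded; the limit at 0 makes \<open>m\<close> positive.\<close>

lemma class_K_inf_majorant:
  fixes M :: "real \<Rightarrow> real"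
  assumes mono: "\<And>r s. 0 \<le> r \<Longrightarrow> r \<le> s \<Longrightarrow> M r \<le> M s"
    and M0: "M 0 = 0" and lim: "(M \<longlongrightarrow> 0) (at_right 0)"
  obtains p where "class_K_inf p" "\<And>r. 0 \<le> r \<Longrightarrow> M r \<le> p r"
proof -
  define S where "S r = {s. 0 \<le> s \<and> r < M s + s}" for r
  have Mnn: "0 \<le> M s" if "0 \<le> s" for s using mono[of 0 s] M0 that by simp
  have ne: "S r \<noteq> {}" for r
    using Mnn[of "\<bar>r\<bar> + 1"] unfolding S_def by (auto intro!: exI[of _ "\<bar>r\<bar> + 1"])
  have bdd: "bdd_below (S r)" for r by (auto simp: S_def)
  define m where "m r = Inf (S r)" for r
  obtain p where p: "class_K_inf p" and pm: "\<And>r. 0 < r \<Longrightarrow> p r \<le> m r"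
  proof (rule class_K_inf_minorant[of m])
    show "m r \<le> m s" if "r \<le> s" for r s
      unfolding m_def by (rule cInf_superset_mono) (use ne bdd that in \<open>auto simp: S_def\<close>)
    show "0 < m r" if r: "0 < r" for r
    proof -
      have "\<forall>\<^sub>F s in at_right 0. M s < r/2" using order_tendstoD(2)[OF lim, of "r/2"] r by simp
      then obtain b where b: "0 < b" "\<And>s. 0 < s \<Longrightarrow> s < b \<Longrightarrow> M s < r/2"
        by (auto simp: eventually_at_right_field)
      have "min (b/2) (r/2) \<le> m r" unfolding m_def
      proof (rule cInf_greatest[OF ne])
        fix s assume "s \<in> S r"
        then have "0 \<le> s" "r < M s + s" by (auto simp: S_def)
        then show "min (b/2) (r/2) \<le> s" using b(1) b(2)[of s] M0 r
          by (cases "s = 0"; cases "s < b") auto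
      qed
      then show ?thesis using b r by auto
    qed
    show "\<exists>r>0. B < m r" for B
    proof (intro exI conjI)
      define s where "s = \<bar>B\<bar> + 1"
      show "0 < M s + s" using Mnn[of s] by (auto simp: s_def)
      have "s \<le> m (M s + s)" unfolding m_def
      proof (rule cInf_greatest[OF ne])
        fix u assume "u \<in> S (M s + s)"
        then have "0 \<le> u" "M s + s < M u + u" by (auto simp: S_def)
        then show "s \<le> u" using mono[of u s] by (cases "s \<le> u") auto
      qed
      then show "B < m (M s + s)" by (auto simp: s_def)
    qed
  qed auto
  obtain q where q: "class_K_inf q" "\<And>s. 0 \<le> s \<Longrightarrow> q (p s) = s" "\<And>r. 0 \<le> r \<Longrightarrow> p (q r) = r"
    using class_K_inf_inverse[OF p] by blast
  have "M s \<le> q s" if s: "0 \<le> s" for s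
  proof (cases "s = 0")
    case True then show ?thesis using q(1) M0 by (simp add: class_K_inf_def class_K_def)
  next
    case False
    show ?thesis
    proof (cases "M s = 0")
      case True then show ?thesis using q(1) class_K_nonneg s by (auto simp: class_K_inf_def)
    next
      case M: False
      then have M: "0 < M s" using Mnn[OF s] by simp
      have "m (M s) \<le> s" unfolding m_def by (rule cInf_lower[OF _ bdd]) (use s False in \<open>auto simp: S_def\<close>)
      then have "p (M s) \<le> s" using pm[OF M] by simp
      moreover have "class_K p" "class_K q" using p q(1) by (simp_all add: class_K_inf_def)
      ultimately have "q (p (M s)) \<le> q s" using class_K_nonneg[of p "M s"] M
        by (intro class_K_le[of q]) simp_all
      then show ?thesis using q(2) M by simp
    qed
  qed
  with q(1) that show thesis by blast
qed

text \<open>The rate of a \<open>\<K>\<L>\<close> bound can be made exponential by rescaling. For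
  \<open>r = \<beta> s t\<close> with \<open>s \<le> 1/r\<close> the time \<open>t\<close> is at most \<open>\<tau> r\<close>, so any
  rescaling below \<open>r * exp (- \<tau> r)\<close> absorbs \<open>exp t\<close>; if \<open>s > 1/r\<close>, then
  \<open>\<beta> s t > 1/s\<close> bounds \<open>t\<close> in terms of \<open>s\<close> alone.\<close>

lemma class_KL_exponential:
  assumes "class_KL \<beta>"
  obtains p1 p2 where "class_K_inf p1" "class_K_inf p2"
    "\<And>s t. 0 \<le> s \<Longrightarrow> 0 \<le> t \<Longrightarrow> exp t * p1 (\<beta> s t) \<le> p2 s"
proof -
  have K: "class_K (\<lambda>s. \<beta> s t)" if "0 \<le> t" for t using assms that by (auto simp: class_KL_def)
  have \<beta>0: "\<beta> 0 t = 0" if "0 \<le> t" for t using K[OF that] by (simp add: class_K_def)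
  have anti: "\<beta> s t' \<le> \<beta> s t" if "0 \<le> s" "0 \<le> t" "t \<le> t'" for s t t'
    using assms that unfolding class_KL_def monotone_on_def by auto
  have lim: "(\<beta> s \<longlongrightarrow> 0) at_top" if "0 \<le> s" for s using assms that by (auto simp: class_KL_def)
  have nn: "0 \<le> \<beta> s t" if "0 \<le> s" "0 \<le> t" for s t using class_K_nonneg[OF K] that by blast
  have le: "\<beta> s t \<le> \<beta> s' t" if "0 \<le> s" "s \<le> s'" "0 \<le> t" for s s' t using class_K_le[OF K] that by blast
  have ex: "\<exists>t\<ge>0. \<beta> s t < r" if "0 \<le> s" "0 < r" for s r
  proof -
    have "\<forall>\<^sub>F t in at_top. \<beta> s t < r" using order_tendstoD(2)[OF lim] that by auto
    then have "\<forall>\<^sub>F t in at_top. \<beta> s t < r \<and> 0 \<le> t" using eventually_ge_at_top by (rule eventually_conj)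
    then have "\<exists>t. \<beta> s t < r \<and> 0 \<le> t" using eventually_happens'[OF trivial_limit_at_top_linorder] by blast
    then show ?thesis by blast
  qed
  define \<tau> where "\<tau> r = Inf {t. 0 \<le> t \<and> \<beta> (1/r) t < r}" for r
  have ne: "{t. 0 \<le> t \<and> \<beta> (1/r) t < r} \<noteq> {}" if "0 < r" for r using ex[of "1/r" r] that by auto
  have bdd: "bdd_below {t. 0 \<le> t \<and> \<beta> (1/r) t < r}" for r by auto
  have \<tau>: "t \<le> \<tau> r" if "0 < r" "0 \<le> t" "r \<le> \<beta> (1/r) t" for r t
    unfolding \<tau>_def
  proof (rule cInf_greatest[OF ne])
    fix u assume "u \<in> {t. 0 \<le> t \<and> \<beta> (1/r) t < r}"
    then show "t \<le> u" using anti[of "1/r" u t] that by (auto simp: not_le[symmetric]) (meson linear)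
  qed (use that in auto)
  have \<tau>mono: "\<tau> s \<le> \<tau> r" if "0 < r" "r \<le> s" for r s
    unfolding \<tau>_def
  proof (rule cInf_superset_mono[OF ne bdd])
    show "{t. 0 \<le> t \<and> \<beta> (1/r) t < r} \<subseteq> {t. 0 \<le> t \<and> \<beta> (1/s) t < s}"
    proof
      fix t assume "t \<in> {t. 0 \<le> t \<and> \<beta> (1/r) t < r}"
      then have t: "0 \<le> t" "\<beta> (1/r) t < r" by auto
      have "1/s \<le> 1/r" using that by (simp add: frac_le)
      then show "t \<in> {t. 0 \<le> t \<and> \<beta> (1/s) t < s}" using le[of "1/s" "1/r" t] t that by auto
    qed
  qed fact
  define m where "m r = r * exp (- \<tau> r)" for r
  obtain p1 where p1: "class_K_inf p1" and p1m: "\<And>r. 0 < r \<Longrightarrow> p1 r \<le> m r"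
  proof (rule class_K_inf_minorant[of m])
    show "m r \<le> m s" if "0 < r" "r \<le> s" for r s
      unfolding m_def using \<tau>mono that by (intro mult_mono) auto
    show "0 < m r" if "0 < r" for r using that by (simp add: m_def)
    show "\<exists>r>0. B < m r" for B
    proof (intro exI conjI)
      \<comment> \<open>\<open>\<tau>\<close> is nonincreasing, so
        \<open>exp (- \<tau> r) \<ge> exp (- \<tau> 1)\<close> for \<open>r \<ge> 1\<close>; the
        factor \<open>exp (\<tau> 1)\<close> compensates this bound.\<close>
      define r where "r = max 1 ((\<bar>B\<bar> + 1) * exp (\<tau> 1))"
      show "0 < r" by (auto simp: r_def)
      have "B < (\<bar>B\<bar> + 1) * exp (\<tau> 1) * exp (- \<tau> 1)" by (simp add: mult.assoc flip: exp_add)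
      also have "\<dots> \<le> r * exp (- \<tau> r)" using \<tau>mono[of 1 r] by (intro mult_mono) (auto simp: r_def)
      finally show "B < m r" by (simp add: m_def)
    qed
  qed auto
  have p1K: "class_K p1" using p1 by (simp add: class_K_inf_def)
  have p1_0: "p1 0 = 0" using p1K by (simp add: class_K_def)
  have small: "exp t * p1 (\<beta> s t) \<le> \<beta> s 0" if s: "0 \<le> s" and t: "0 \<le> t" and sb: "s * \<beta> s t \<le> 1" for s t
  proof (cases "\<beta> s t = 0")
    case True then show ?thesis using p1_0 nn s by auto
  next
    case False
    define r where "r = \<beta> s t"
    have r: "0 < r" using False nn[OF s t] by (auto simp: r_def)
    have "s \<le> 1/r" using sb r by (simp add: r_def[symmetric] divide_simps)
    then have "r \<le> \<beta> (1/r) t" using le[of s "1/r" t] s t by (simp add: r_def)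
    then have "t \<le> \<tau> r" using \<tau> r t by blast
    then have "exp t * p1 r \<le> exp (\<tau> r) * m r" using p1m[OF r] r class_K_nonneg[OF p1K, of r]
      by (intro mult_mono) auto
    also have "\<dots> = r" by (simp add: m_def exp_minus field_simps)
    also have "\<dots> \<le> \<beta> s 0" unfolding r_def using anti[of s 0 t] s t by simp
    finally show ?thesis by (simp add: r_def)
  qed
  define M where "M s = (SUP t\<in>{0..}. exp t * p1 (\<beta> s t))" for s
  have bddM: "bdd_above ((\<lambda>t. exp t * p1 (\<beta> s t)) ` {0..})" if s: "0 \<le> s" for s
  proof (cases "s = 0")
    case True
    with True show ?thesis using p1_0 \<beta>0 by (intro bdd_aboveI[of _ 0]) auto
  next
    case False
    then obtain t0 where t0: "0 \<le> t0" "\<beta> s t0 < 1/s" using ex[of s "1/s"] s by auto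
    show ?thesis
    proof (rule bdd_aboveI2)
      fix t :: real assume "t \<in> {0..}" then have t: "0 \<le> t" by simp
      show "exp t * p1 (\<beta> s t) \<le> max (\<beta> s 0) (exp t0 * p1 (\<beta> s 0))"
      proof (cases "t \<le> t0")
        case True
        then have "exp t * p1 (\<beta> s t) \<le> exp t0 * p1 (\<beta> s 0)"
          using anti[of s 0 t] s t nn
          by (intro mult_mono class_K_le[OF p1K] class_K_nonneg[OF p1K]) auto
        then show ?thesis by simp
      next
        case F: False
        then have "\<beta> s t \<le> 1/s" using anti[of s t0 t] t0 s by auto
        then have "s * \<beta> s t \<le> 1" using False s by (simp add: field_simps)
        then show ?thesis using small[OF s t] by auto
      qed
    qed
  qed
  have Mle: "exp t * p1 (\<beta> s t) \<le> M s" if "0 \<le> s" "0 \<le> t" for s t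
    unfolding M_def using that by (intro cSUP_upper bddM) auto
  have M0: "M 0 = 0"
  proof -
    have "M 0 = (SUP t\<in>{0::real..}. 0)" unfolding M_def using p1_0 \<beta>0 by (intro SUP_cong) auto
    then show ?thesis by simp
  qed
  have Mmono: "M r \<le> M s" if "0 \<le> r" "r \<le> s" for r s
    unfolding M_def[of r]
  proof (rule cSUP_least)
    fix t :: real assume "t \<in> {0..}"
    then have t: "0 \<le> t" by simp
    have "exp t * p1 (\<beta> r t) \<le> exp t * p1 (\<beta> s t)"
      using that t by (intro mult_left_mono class_K_le[OF p1K] le nn) auto
    also have "\<dots> \<le> M s" using Mle that t by auto
    finally show "exp t * p1 (\<beta> r t) \<le> M s" .
  qed auto
  have "(M \<longlongrightarrow> 0) (at_right 0)"
  \<comment> \<open>Near 0 the product \<open>s * \<beta> s 0\<close> is below 1, so only the case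
    \<open>small\<close> occurs and \<open>M s\<close> is squeezed below
    \<open>\<beta> s 0\<close>.\<close>
  proof (rule tendsto_sandwich[of "\<lambda>_. 0" _ _ "\<lambda>s. \<beta> s 0"])
    have "continuous_on {0..} (\<lambda>s. \<beta> s 0)" "\<beta> 0 0 = 0" using K[of 0] by (auto simp: class_K_def)
    then have "((\<lambda>s. \<beta> s 0) \<longlongrightarrow> 0) (at 0 within {0..})" by (force simp: continuous_on_def)
    then show b: "((\<lambda>s. \<beta> s 0) \<longlongrightarrow> 0) (at_right 0)" by (rule tendsto_within_subset) auto
    have pos: "\<forall>\<^sub>F s in at_right (0::real). 0 < s" by (auto simp: eventually_at_right_field intro: exI[of _ 1])
    show "\<forall>\<^sub>F s in at_right 0. 0 \<le> M s" using pos
      by eventually_elim (use Mmono[of 0] M0 in auto)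
    have "((\<lambda>s. s * \<beta> s 0) \<longlongrightarrow> 0 * 0) (at_right 0)" by (intro tendsto_intros b)
    then have "\<forall>\<^sub>F s in at_right 0. s * \<beta> s 0 < 1" by (intro order_tendstoD(2)) auto
    then show "\<forall>\<^sub>F s in at_right 0. M s \<le> \<beta> s 0" using pos
    proof eventually_elim
      case (elim s)
      show ?case unfolding M_def
      proof (rule cSUP_least)
        fix t :: real assume "t \<in> {0..}"
        then have t: "0 \<le> t" by simp
        have "s * \<beta> s t \<le> s * \<beta> s 0" using anti[of s 0 t] elim t by (intro mult_left_mono) auto
        with elim have "s * \<beta> s t \<le> 1" by linarith
        then show "exp t * p1 (\<beta> s t) \<le> \<beta> s 0" using small[of s t] elim t by simp
      qed auto
    qed
  qed simp
  then obtain p2 where "class_K_inf p2" "\<And>r. 0 \<le> r \<Longrightarrow> M r \<le> p2 r"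
    using class_K_inf_majorant[of M] Mmono M0 by blast
  with Mle p1 that show thesis by (meson order_trans)
qed

text \<open>\<open>\<rho>\<close> solves \<open>\<rho>' = f * \<rho>\<close> with
  \<open>\<rho> 1 = 1\<close>. In \<open>f\<close> the minimum with \<open>\<alpha> s\<close> gives
  the rate. The minimum with \<open>s\<close> makes \<open>A - ln\<close> nondecreasing:
  \<open>\<rho>\<close> lies above the identity beyond 1, hence is unbounded, and below it on
  \<open>[0,1]\<close>, which gives continuity at 0 and is used again at zeros of
  \<open>V\<close>.\<close>

lemma exponential_rate_rescaling:
  assumes "continuous_positive_definite \<alpha>"
  obtains \<rho> \<rho>' where "class_K_inf \<rho>" "\<And>r. 0 < r \<Longrightarrow> (\<rho> has_real_derivative \<rho>' r) (at r)"
    "\<And>r. 0 < r \<Longrightarrow> 0 < \<rho>' r" "\<And>r. 0 < r \<Longrightarrow> \<rho> r \<le> \<rho>' r * \<alpha> r" "\<And>r. 0 \<le> r \<Longrightarrow> r \<le> 1 \<Longrightarrow> \<rho> r \<le> r"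
proof -
  have cont: "continuous_on {0..} \<alpha>" and pos: "\<And>r. 0 < r \<Longrightarrow> 0 < \<alpha> r"
    using assms by (auto simp: continuous_positive_definite_def)
  define f where "f s = 1 / min (\<alpha> s) s" for s
  have fge: "1/s \<le> f s" if "0 < s" for s unfolding f_def using that pos[of s] by (intro divide_left_mono) auto
  have fpos: "0 < f s" if "0 < s" for s unfolding f_def using that pos[of s] by auto
  have "\<exists>A. \<forall>x. 0 < ereal x \<longrightarrow> ereal x < \<infinity> \<longrightarrow> (A has_vector_derivative f x) (at x)"
  proof (rule einterval_antiderivative)
    fix x assume "0 < ereal x"
    then have x: "0 < x" by simp
    have "continuous_on {0<..} \<alpha>" using cont by (rule continuous_on_subset) auto
    then have "isCont \<alpha> x" using x by (simp add: continuous_on_eq_continuous_at)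
    then show "isCont f x" unfolding f_def using pos[OF x] x by (intro continuous_intros) auto
  qed auto
  then obtain A where A: "\<And>x. 0 < x \<Longrightarrow> (A has_real_derivative f x) (at x)"
    by (auto simp: has_real_derivative_iff_has_vector_derivative)
  have Amono: "A s - ln s \<le> A t - ln t" if "0 < s" "s \<le> t" for s t
  proof (rule DERIV_nonneg_imp_nondecreasing[OF that(2)])
    fix x assume "s \<le> x" "x \<le> t"
    then have x: "0 < x" using that by simp
    show "\<exists>y. ((\<lambda>x. A x - ln x) has_real_derivative y) (at x) \<and> 0 \<le> y"
      using fge[OF x] x by (intro exI[of _ "f x - 1/x"] conjI) (auto intro!: derivative_eq_intros A simp: divide_simps)
  qed
  have lnA: "A s < A t" if "0 < s" "s < t" for s t
    using Amono[of s t] that by (smt (verit) ln_less_cancel_iff)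
  define \<rho> where "\<rho> r = (if r \<le> 0 then 0 else exp (A r - A 1))" for r :: real
  define \<rho>' where "\<rho>' r = f r * \<rho> r" for r
  have \<rho>pos: "0 < \<rho> r" if "0 < r" for r using that by (simp add: \<rho>_def)
  have der: "(\<rho> has_real_derivative \<rho>' r) (at r)" if r: "0 < r" for r
  proof (rule has_field_derivative_transform_within_open)
    show "((\<lambda>r. exp (A r - A 1)) has_real_derivative \<rho>' r) (at r)"
      using r by (auto intro!: derivative_eq_intros A simp: \<rho>'_def \<rho>_def)
  qed (use r in \<open>auto simp: \<rho>_def intro: open_greaterThan[of 0]\<close>)
  have le: "\<rho> r \<le> r" if "0 \<le> r" "r \<le> 1" for r
  proof (cases "r = 0")
    case False
    then have "A r - A 1 \<le> ln r" using Amono[of r 1] that by simp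
    then have "exp (A r - A 1) \<le> exp (ln r)" by (simp only: exp_le_cancel_iff)
    then show ?thesis using False that by (simp add: \<rho>_def)
  qed (simp add: \<rho>_def)
  have ge: "r \<le> \<rho> r" if "1 \<le> r" for r
  proof -
    have "ln r \<le> A r - A 1" using Amono[of 1 r] that by simp
    then have "exp (ln r) \<le> exp (A r - A 1)" by (simp only: exp_le_cancel_iff)
    then show ?thesis using that by (simp add: \<rho>_def)
  qed
  have "class_K \<rho>"
  proof (rule class_KI)
    show "continuous_on {0..} \<rho>" unfolding continuous_on_def
    proof
      fix r :: real assume r: "r \<in> {0..}"
      show "(\<rho> \<longlongrightarrow> \<rho> r) (at r within {0..})"
      proof (cases "r = 0")
        case True
        have "((\<lambda>x. x) \<longlongrightarrow> 0) (at 0 within {0::real..})" by (rule tendsto_ident_at)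
        moreover have "\<forall>\<^sub>F x in at 0 within {0::real..}. \<rho> x \<le> x"
          using le by (auto simp: eventually_at intro!: exI[of _ 1])
        moreover have "\<forall>\<^sub>F x in at 0 within {0::real..}. 0 \<le> \<rho> x"
          by (auto simp: \<rho>_def)
        ultimately have "(\<rho> \<longlongrightarrow> 0) (at 0 within {0..})"
          using tendsto_sandwich[of "\<lambda>_. 0" \<rho> "at 0 within {0..}" "\<lambda>x. x" 0] by auto
        then show ?thesis using True by (simp add: \<rho>_def)
      next
        case False
        then have "isCont \<rho> r" using der[of r] r DERIV_isCont by auto
        then show ?thesis by (auto simp: isCont_def intro: tendsto_within_subset)
      qed
    qed
    show "\<rho> s < \<rho> t" if "0 \<le> s" "s < t" for s t
      using that lnA[of s t] by (cases "s = 0") (auto simp: \<rho>_def)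
  qed (simp add: \<rho>_def)
  then have 1: "class_K_inf \<rho>"
  proof (rule class_K_infI)
    show "\<exists>s\<ge>0. B < \<rho> s" for B using ge[of "\<bar>B\<bar> + 1"] by (intro exI[of _ "\<bar>B\<bar> + 1"]) auto
  qed
  have 2: "0 < \<rho>' r" if "0 < r" for r using fpos \<rho>pos that by (simp add: \<rho>'_def)
  have 3: "\<rho> r \<le> \<rho>' r * \<alpha> r" if "0 < r" for r
  proof -
    have "1 \<le> f r * \<alpha> r" using pos[OF that] that by (simp add: f_def)
    then have "\<rho> r * 1 \<le> \<rho> r * (f r * \<alpha> r)" using \<rho>pos[OF that] by (intro mult_left_mono) auto
    then show ?thesis by (simp add: \<rho>'_def algebra_simps)
  qed
  show thesis using that 1 der 2 3 le by blast
qed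

section \<open>Absolutely continuous functions\<close>

lemma division_interval:
  fixes d :: "real set set"
  assumes "d division_of \<Union>d" "\<Union>d \<subseteq> S" "k \<in> d"
  shows "k = {Inf k..Sup k}" "Inf k \<le> Sup k" "Inf k \<in> S" "Sup k \<in> S" "k \<subseteq> S"
proof -
  obtain u v where k: "k = {u..v}" "u \<le> v" "k \<subseteq> S"
    using division_ofD(3,4)[OF assms(1,3)] assms(2,3) by (metis Union_upper atLeastatMost_empty_iff2 box_real(2) subset_trans)
  then show "k = {Inf k..Sup k}" "Inf k \<le> Sup k" "Inf k \<in> S" "Sup k \<in> S" "k \<subseteq> S" by auto
qed

lemma absolutely_continuous_onD:
  assumes "absolutely_continuous_on S f" "0 < e"
  shows "\<exists>\<delta>>0. \<forall>d. d division_of \<Union>d \<longrightarrow> \<Union>d \<subseteq> S \<longrightarrow> (\<Sum>k\<in>d. Sup k - Inf k) < \<delta> \<longrightarrow>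
      (\<Sum>k\<in>d. norm (f (Sup k) - f (Inf k))) < e"
  using assms(1)[unfolded absolutely_continuous_on_def, rule_format, OF assms(2)]
  by (simp only: conj_imp_eq_imp_imp imp_conjL)

lemma has_vector_derivative_at_rightD:
  fixes x :: "real \<Rightarrow> 'a::real_normed_vector"
  assumes "(x has_vector_derivative v) (at t within {t..b})" "t < b" "0 < e"
  shows "\<forall>\<^sub>F s in at_right t. norm (x s - x t - (s - t) *\<^sub>R v) \<le> e * (s - t)"
proof -
  obtain d where d: "0 < d" "\<And>s. s \<in> {t..b} \<Longrightarrow> norm (s - t) < d \<Longrightarrow>
      norm (x s - x t - (s - t) *\<^sub>R v) \<le> e * norm (s - t)"
    using assms unfolding has_vector_derivative_def has_derivative_within_alt by blast
  have "\<forall>\<^sub>F s in at_right t. t < s \<and> s < min b (t + d)"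
    using d(1) assms(2) by (subst eventually_at_right_field) (auto intro!: exI[of _ "min b (t + d)"])
  then show ?thesis
  proof eventually_elim
    case (elim s)
    then show ?case using d(2)[of s] by simp
  qed
qed

text \<open>One comparison covers Lipschitz functions, changes of a function off \<open>S\<close>,
  and Lipschitz perturbations: the second term adds at most \<open>M\<close> times the total length.
  \<open>M'\<close> is positive so that it can be divided by.\<close>

lemma absolutely_continuous_on_dominated:
  fixes f :: "real \<Rightarrow> 'a::real_normed_vector" and g :: "real \<Rightarrow> 'b::real_normed_vector"
  assumes f: "absolutely_continuous_on S f"
    and le: "\<And>s t. s \<in> S \<Longrightarrow> t \<in> S \<Longrightarrow> s \<le> t \<Longrightarrow> norm (g t - g s) \<le> norm (f t - f s) + M * (t - s)"
  shows "absolutely_continuous_on S g"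
  unfolding absolutely_continuous_on_def
proof (intro allI impI)
  fix e :: real assume e: "0 < e"
  obtain \<delta> where \<delta>: "0 < \<delta>" "\<forall>d. d division_of \<Union>d \<longrightarrow> \<Union>d \<subseteq> S \<longrightarrow> (\<Sum>k\<in>d. Sup k - Inf k) < \<delta>
      \<longrightarrow> (\<Sum>k\<in>d. norm (f (Sup k) - f (Inf k))) < e/2"
    using absolutely_continuous_onD[OF f half_gt_zero[OF e]] by (elim exE conjE)
  define M' where "M' = max M 0 + 1"
  have M': "0 < M'" "M \<le> M'" by (auto simp: M'_def)
  show "\<exists>\<delta>>0. \<forall>d. d division_of \<Union>d \<and> \<Union>d \<subseteq> S \<and> (\<Sum>k\<in>d. Sup k - Inf k) < \<delta> \<longrightarrow>
        (\<Sum>k\<in>d. norm (g (Sup k) - g (Inf k))) < e"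
  proof (intro exI[of _ "min \<delta> (e/(2*M'))"] conjI allI impI)
    fix d assume d: "d division_of \<Union>d \<and> \<Union>d \<subseteq> S \<and> (\<Sum>k\<in>d. Sup k - Inf k) < min \<delta> (e/(2*M'))"
    note I = division_interval[OF conjunct1[OF d] conjunct1[OF conjunct2[OF d]]]
    have "(\<Sum>k\<in>d. norm (g (Sup k) - g (Inf k))) \<le> (\<Sum>k\<in>d. norm (f (Sup k) - f (Inf k)) + M' * (Sup k - Inf k))"
    proof (rule sum_mono)
      fix k assume k: "k \<in> d"
      have "M * (Sup k - Inf k) \<le> M' * (Sup k - Inf k)" using I(2)[OF k] M' by (intro mult_right_mono) auto
      then show "norm (g (Sup k) - g (Inf k)) \<le> norm (f (Sup k) - f (Inf k)) + M' * (Sup k - Inf k)"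
        using le[OF I(3)[OF k] I(4)[OF k] I(2)[OF k]] by simp
    qed
    also have "\<dots> = (\<Sum>k\<in>d. norm (f (Sup k) - f (Inf k))) + M' * (\<Sum>k\<in>d. Sup k - Inf k)"
      by (simp add: sum.distrib sum_distrib_left)
    also have "\<dots> < e/2 + M' * (e/(2*M'))"
    proof (rule add_strict_mono)
      show "(\<Sum>k\<in>d. norm (f (Sup k) - f (Inf k))) < e/2" using \<delta>(2)[rule_format, of d] d by simp
      show "M' * (\<Sum>k\<in>d. Sup k - Inf k) < M' * (e/(2*M'))" using M' d by (intro mult_strict_left_mono) simp_all
    qed
    also have "\<dots> = e" using M' by simp
    finally show "(\<Sum>k\<in>d. norm (g (Sup k) - g (Inf k))) < e" .
  qed (use \<delta> e M' in auto)
qed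

lemma absolutely_continuous_on_const: "absolutely_continuous_on S (\<lambda>_. c)"
  unfolding absolutely_continuous_on_def by (auto intro: exI[of _ 1])

lemma lipschitz_imp_absolutely_continuous:
  fixes f :: "real \<Rightarrow> 'a::real_normed_vector"
  assumes "\<And>s t. s \<in> S \<Longrightarrow> t \<in> S \<Longrightarrow> s \<le> t \<Longrightarrow> norm (f t - f s) \<le> M * (t - s)"
  shows "absolutely_continuous_on S f"
  by (rule absolutely_continuous_on_dominated[OF absolutely_continuous_on_const[of S "0::real"], where M = M])
    (use assms in auto)

lemma absolutely_continuous_on_cong:
  assumes "absolutely_continuous_on S f" "\<And>t. t \<in> S \<Longrightarrow> g t = f t"
  shows "absolutely_continuous_on S g"
  by (rule absolutely_continuous_on_dominated[OF assms(1), where M = 0]) (use assms(2) in auto)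

lemma absolutely_continuous_on_subset:
  "absolutely_continuous_on S f \<Longrightarrow> T \<subseteq> S \<Longrightarrow> absolutely_continuous_on T f"
  unfolding absolutely_continuous_on_def by (meson subset_trans)

lemma absolutely_continuous_imp_continuous_on:
  assumes f: "absolutely_continuous_on {a..b} f"
  shows "continuous_on {a..b} f"
proof -
  show ?thesis
    unfolding continuous_on_iff
  proof (intro ballI allI impI)
    fix t e :: real assume t: "t \<in> {a..b}" and e: "0 < e"
    obtain \<delta> where \<delta>: "0 < \<delta>" "\<forall>d. d division_of \<Union>d \<longrightarrow> \<Union>d \<subseteq> {a..b} \<longrightarrow> (\<Sum>k\<in>d. Sup k - Inf k) < \<delta>
      \<longrightarrow> (\<Sum>k\<in>d. norm (f (Sup k) - f (Inf k))) < e"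
      using absolutely_continuous_onD[OF f e] by (elim exE conjE)
    have near: "norm (f t - f s) < e" if "s \<in> {a..b}" "t \<in> {a..b}" "s \<le> t" "t - s < \<delta>" for s t
    proof -
      have "{{s..t}} division_of \<Union>{{s..t}}" using division_of_self[of s t, unfolded box_real] that by auto
      then show ?thesis using \<delta>(2)[rule_format, of "{{s..t}}"] that by auto
    qed
    have "dist (f s) (f t) < e" if "s \<in> {a..b}" "dist s t < \<delta>" for s
      using near[of s t] near[of t s] that t by (cases "s \<le> t") (auto simp: dist_norm norm_minus_commute)
    then show "\<exists>\<delta>>0. \<forall>s\<in>{a..b}. dist s t < \<delta> \<longrightarrow> dist (f s) (f t) < e" using \<delta>(1) by blast
  qed
qed

text \<open>Continuous induction along \<open>[a,b]\<close>. The exceptional null set is covered by an open set \<open>U\<close> so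
  small that the variation of \<open>G\<close> over \<open>U \<inter> [a,t]\<close>, called \<open>\<phi> t\<close> below, stays below \<open>\<epsilon>\<close>; every
  increase of \<open>G\<close> across points of \<open>U\<close> is charged to \<open>\<phi>\<close>.\<close>

lemma absolutely_continuous_nonincreasing:
  fixes G :: "real \<Rightarrow> real"
  assumes ab: "a \<le> b" and ac: "absolutely_continuous_on {a..b} G" and N: "negligible N"
    and der: "\<And>t e. a \<le> t \<Longrightarrow> t < b \<Longrightarrow> t \<notin> N \<Longrightarrow> 0 < e \<Longrightarrow> \<forall>\<^sub>F s in at_right t. G s - G t \<le> e * (s - t)"
  shows "G b \<le> G a"
proof -
  have "G b \<le> G a + \<epsilon>" if "0 < \<epsilon>" for \<epsilon>
  proof -
    define e1 where "e1 = \<epsilon> / 2"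
    \<comment> \<open>The slope error \<open>e2 * (b - a)\<close> and the variation bound
      \<open>e1\<close> take half of \<open>\<epsilon>\<close> each; the 1 covers
      \<open>a = b\<close>.\<close>
    define e2 where "e2 = \<epsilon> / (2 * (b - a + 1))"
    have e1: "0 < e1" and e2: "0 < e2" "e2 * (b - a) \<le> \<epsilon>/2" using that ab
      by (auto simp: e1_def e2_def divide_simps)
    obtain \<delta> where \<delta>: "0 < \<delta>" "\<forall>d. d division_of \<Union>d \<longrightarrow> \<Union>d \<subseteq> {a..b} \<longrightarrow> (\<Sum>k\<in>d. Sup k - Inf k) < \<delta>
      \<longrightarrow> (\<Sum>k\<in>d. norm (G (Sup k) - G (Inf k))) < e1"
      using absolutely_continuous_onD[OF ac e1] by (elim exE conjE)
    obtain U where U: "open U" "N \<subseteq> U" "U - N \<in> lmeasurable" "emeasure lebesgue (U - N) < ennreal \<delta>"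
      using sets_lebesgue_outer_open[of N \<delta>] N \<delta>(1) by (auto simp: negligible_iff_null_sets)
    have Nm: "N \<in> lmeasurable" using N by (rule negligible_imp_measurable)
    have UN: "U = (U - N) \<union> N" using U(2) by blast
    have Um: "U \<in> lmeasurable" using U(3) Nm UN by (metis fmeasurable.Un)
    have "emeasure lebesgue U \<le> emeasure lebesgue (U - N) + emeasure lebesgue N"
      using emeasure_subadditive[of "U - N" lebesgue N] UN U(3) Nm by (simp add: fmeasurableD)
    also have "\<dots> < ennreal \<delta>" using U(4) N by (simp add: negligible_iff_null_sets null_setsD1)
    finally have mU: "measure lebesgue U < \<delta>" using Um \<delta>(1) by (simp add: emeasure_eq_measure2 ennreal_less_iff)
    define \<V> where "\<V> t = {d. d division_of \<Union>d \<and> \<Union>d \<subseteq> U \<inter> {a..t}}" for t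
    define w where "w d = (\<Sum>k\<in>d. norm (G (Sup k) - G (Inf k)))" for d
    define \<phi> where "\<phi> t = Sup (w ` \<V> t)" for t
    have w_less: "w d < e1" if "d \<in> \<V> t" "t \<le> b" for d t
      unfolding w_def
    proof (rule \<delta>(2)[rule_format])
      show d: "d division_of \<Union>d" and "\<Union>d \<subseteq> {a..b}" using that by (auto simp: \<V>_def)
      have "(\<Sum>k\<in>d. Sup k - Inf k) = (\<Sum>k\<in>d. measure lebesgue k)"
      proof (rule sum.cong)
        fix k assume "k \<in> d"
        from division_interval(1,2)[OF d order_refl this]
        have k: "k = {Inf k..Sup k}" "Inf k \<le> Sup k" .
        have "measure lebesgue {Inf k..Sup k} = Sup k - Inf k"
          using measure_completion[of "{Inf k..Sup k}" lborel] content_real[OF k(2)] by simp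
        then show "Sup k - Inf k = measure lebesgue k" by (subst (3) k(1)) (rule sym)
      qed simp
      also have "\<dots> = measure lebesgue (\<Union>d)" by (rule content_division[OF d])
      also have "\<dots> \<le> measure lebesgue U"
        using that d lmeasurable_division[OF d] by (intro measure_mono_fmeasurable Um) (auto simp: \<V>_def)
      finally show "(\<Sum>k\<in>d. Sup k - Inf k) < \<delta>" using mU by simp
    qed
    have bdd: "bdd_above (w ` \<V> t)" if "t \<le> b" for t
      by (rule bdd_aboveI2[of _ _ e1]) (use w_less that in \<open>auto intro: less_imp_le\<close>)
    have empty: "{} \<in> \<V> t" for t by (simp add: \<V>_def)
    have \<phi>0: "0 \<le> \<phi> t" if "t \<le> b" for t
      unfolding \<phi>_def by (rule cSUP_upper2[OF bdd[OF that] empty]) (simp add: w_def)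
    have \<phi>1: "\<phi> t \<le> e1" if "t \<le> b" for t
      unfolding \<phi>_def by (rule cSUP_least) (use w_less that empty in \<open>auto intro: less_imp_le\<close>)
    have \<phi>_mono: "\<phi> s \<le> \<phi> t" if "s \<le> t" "t \<le> b" for s t
      unfolding \<phi>_def by (rule cSUP_subset_mono) (use that bdd empty in \<open>auto simp: \<V>_def\<close>)
    \<comment> \<open>\<open>{s..t}\<close> meets a division of a part of \<open>{a..s}\<close> at
      most in \<open>s\<close>, so it can be adjoined, and the increase of \<open>G\<close> then
      counts towards \<open>\<phi> t\<close>.\<close>
    have \<phi>_add: "\<phi> s + (G t - G s) \<le> \<phi> t" if st: "a \<le> s" "s < t" "t \<le> b" "{s..t} \<subseteq> U" for s t
    proof -
      have "w d \<le> \<phi> t - (G t - G s)" if d: "d \<in> \<V> s" for d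
      proof -
        have dd: "d division_of \<Union>d" "\<Union>d \<subseteq> U \<inter> {a..s}" using d by (auto simp: \<V>_def)
        have "{s..t} \<notin> d"
        proof
          assume "{s..t} \<in> d"
          then have "{s..t} \<subseteq> {a..s}" using dd(2) by blast
          then show False using st by auto
        qed
        moreover have "insert {s..t} d division_of \<Union>(insert {s..t} d)"
        proof -
          have "interior {s..t} \<inter> interior (\<Union>d) \<subseteq> {s<..<t} \<inter> {a..s}"
            using dd(2) interior_subset[of "\<Union>d"] by auto
          then have "interior {s..t} \<inter> interior (\<Union>d) = {}" by fastforce
          then have "{{s..t}} \<union> d division_of {s..t} \<union> \<Union>d"
            using st dd division_of_self[of s t, unfolded box_real] by (intro division_disjoint_union) auto
          then show ?thesis by simp
        qed
        ultimately have "w (insert {s..t} d) = \<bar>G t - G s\<bar> + w d"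
          using st division_of_finite[OF dd(1)] by (simp add: w_def)
        moreover have "insert {s..t} d \<in> \<V> t"
          using dd st \<open>insert {s..t} d division_of _\<close> by (fastforce simp: \<V>_def)
        then have "w (insert {s..t} d) \<le> \<phi> t" unfolding \<phi>_def using st by (intro cSUP_upper bdd) auto
        ultimately show ?thesis by linarith
      qed
      then have "\<phi> s \<le> \<phi> t - (G t - G s)" unfolding \<phi>_def[of s] using empty by (intro cSUP_least) auto
      then show ?thesis by simp
    qed
    define S where "S = {t\<in>{a..b}. G t - G a \<le> e2 * (t - a) + \<phi> t}"
    have aS: "a \<in> S" using ab \<phi>0[of a] by (auto simp: S_def)
    have Sb: "bdd_above S" by (rule bdd_aboveI[of _ b]) (auto simp: S_def)
    define m where "m = Sup S"
    have m: "a \<le> m" "m \<le> b" unfolding m_def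
      using aS Sb by (auto intro!: cSup_upper cSup_least simp: S_def)
    have cont: "continuous_on {a..b} G" by (rule absolutely_continuous_imp_continuous_on[OF ac])
    \<comment> \<open>Points of \<open>S\<close> approach \<open>m\<close> from the left; continuity
      of \<open>G\<close> and monotonicity of \<open>\<phi>\<close> carry the inequality to
      \<open>m\<close>.\<close>
    have "G m - G a \<le> e2 * (m - a) + \<phi> m"
    proof (rule field_le_epsilon)
      fix e :: real assume "0 < e"
      then obtain \<eta> where \<eta>: "0 < \<eta>" "\<And>s. s \<in> {a..b} \<Longrightarrow> dist s m < \<eta> \<Longrightarrow> dist (G s) (G m) < e"
        using cont m unfolding continuous_on_iff by (metis atLeastAtMost_iff)
      obtain s where s: "s \<in> S" "m - \<eta> < s" unfolding m_def
        using less_cSup_iff[of S "Sup S - \<eta>"] aS Sb \<eta>(1) by auto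
      have "s \<le> m" unfolding m_def using s Sb by (intro cSup_upper)
      then have "G m - G s \<le> e" using \<eta>(2)[of s] s by (auto simp: S_def dist_real_def)
      moreover have "e2 * (s - a) \<le> e2 * (m - a)" using \<open>s \<le> m\<close> e2 by (intro mult_left_mono) auto
      ultimately show "G m - G a \<le> e2 * (m - a) + \<phi> m + e"
        using s \<phi>_mono[OF \<open>s \<le> m\<close> m(2)] by (auto simp: S_def)
    qed
    then have mS: "m \<in> S" using m by (auto simp: S_def)
    have "m = b"
    proof (rule ccontr)
      assume "m \<noteq> b"
      then have mb: "m < b" using m by simp
      have "\<exists>s. m < s \<and> s < b \<and> s \<in> S"
      proof (cases "m \<in> N")
        case True
        then have "m \<in> U" using U by blast
        then obtain r where r: "0 < r" "cball m r \<subseteq> U" using U(1) open_contains_cball by blast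
        define s where "s = m + min r ((b - m)/2)"
        have s: "m < s" "s < b" "s \<le> m + r" using r mb by (auto simp: s_def min_def field_simps)
        have "{m..s} \<subseteq> U" using r s by (auto simp: dist_real_def subset_eq)
        then have "\<phi> m + (G s - G m) \<le> \<phi> s" using \<phi>_add s m by auto
        moreover have "e2 * (m - a) \<le> e2 * (s - a)" using s e2 by (intro mult_left_mono) auto
        ultimately have "s \<in> S" using mS s m by (auto simp: S_def)
        then show ?thesis using s by blast
      next
        case False
        have "\<forall>\<^sub>F s in at_right m. G s - G m \<le> e2 * (s - m)" using der m mb False e2 by blast
        moreover have "\<forall>\<^sub>F s in at_right m. m < s \<and> s < b"
          using mb by (auto simp: eventually_at_right_field)
        ultimately have "\<forall>\<^sub>F s in at_right m. G s - G m \<le> e2 * (s - m) \<and> m < s \<and> s < b"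
          by (rule eventually_conj)
        then obtain s where s: "G s - G m \<le> e2 * (s - m)" "m < s" "s < b"
          using eventually_happens'[OF trivial_limit_at_right_real] by blast
        then have "s \<in> S" using mS m \<phi>_mono[of m s] by (auto simp: S_def algebra_simps)
        then show ?thesis using s by blast
      qed
      then obtain s where "m < s" "s \<in> S" by blast
      then show False using cSup_upper[OF _ Sb] by (fastforce simp: m_def)
    qed
    then show ?thesis using mS \<phi>1[of b] e2 by (auto simp: S_def e1_def)
  qed
  then show ?thesis by (rule field_le_epsilon)
qed

text \<open>Subtracting the primitive \<open>C\<close> of \<open>c\<close> leaves nonpositive upper
  right derivatives off \<open>N\<close>. As \<open>c\<close> is bounded, \<open>C\<close> is
  Lipschitz, and the difference stays absolutely continuous.\<close>

lemma absolutely_continuous_integral_bound: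
  fixes g c :: "real \<Rightarrow> real"
  assumes ab: "a \<le> b" and ac: "absolutely_continuous_on {a..b} g" and N: "negligible N"
    and c: "continuous_on {a..b} c"
    and der: "\<And>t e. a \<le> t \<Longrightarrow> t < b \<Longrightarrow> t \<notin> N \<Longrightarrow> 0 < e \<Longrightarrow>
      \<forall>\<^sub>F s in at_right t. g s - g t \<le> (c t + e) * (s - t)"
  shows "g b - g a \<le> integral {a..b} c"
proof -
  define C where "C t = integral {a..t} c" for t
  have C: "(C has_vector_derivative c t) (at t within {a..b})" if "t \<in> {a..b}" for t
    unfolding C_def using integral_has_vector_derivative[OF c that] .
  have Cint: "C t - C s = integral {s..t} c" if "a \<le> s" "s \<le> t" "t \<le> b" for s t
  proof -
    have "c integrable_on {a..t}" using c that by (intro integrable_continuous_real continuous_on_subset[OF c]) auto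
    then show ?thesis using Henstock_Kurzweil_Integration.integral_combine[of a s t c] that by (simp add: C_def)
  qed
  obtain B where "\<forall>t\<in>{a..b}. norm (c t) \<le> B"
    using compact_imp_bounded[OF compact_continuous_image[OF c compact_Icc]] by (auto simp: bounded_iff)
  then have B: "\<And>t. t \<in> {a..b} \<Longrightarrow> norm (c t) \<le> B" by blast
  have Clip: "norm (C t - C s) \<le> B * (t - s)" if "a \<le> s" "s \<le> t" "t \<le> b" for s t
  proof -
    have "norm (c u) \<le> B" if "u \<in> {s..t}" for u using B[of u] that \<open>a \<le> s\<close> \<open>t \<le> b\<close> by simp
    then show ?thesis
      unfolding Cint[OF that] using that by (intro integral_bound continuous_on_subset[OF c]) simp_all
  qed
  have "g b - C b \<le> g a - C a"
  proof (rule absolutely_continuous_nonincreasing[OF ab _ N])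
    show "absolutely_continuous_on {a..b} (\<lambda>t. g t - C t)"
    proof (rule absolutely_continuous_on_dominated[OF ac, where M = B])
      show "norm (g t - C t - (g s - C s)) \<le> norm (g t - g s) + B * (t - s)"
        if "s \<in> {a..b}" "t \<in> {a..b}" "s \<le> t" for s t
        using Clip[of s t] that by auto
    qed
    fix t e :: real assume t: "a \<le> t" "t < b" "t \<notin> N" and e: "0 < e"
    have "(C has_vector_derivative c t) (at t within {t..b})"
      using C[of t] t by (auto intro: has_vector_derivative_within_subset)
    then have "\<forall>\<^sub>F s in at_right t. norm (C s - C t - (s - t) *\<^sub>R c t) \<le> e/2 * (s - t)"
      using t(2) e by (intro has_vector_derivative_at_rightD) auto
    moreover have "\<forall>\<^sub>F s in at_right t. g s - g t \<le> (c t + e/2) * (s - t)" using der t e by simp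
    ultimately show "\<forall>\<^sub>F s in at_right t. g s - C s - (g t - C t) \<le> e * (s - t)"
    proof eventually_elim
      case (elim s)
      have "- (e/2 * (s - t)) \<le> C s - C t - (s - t) * c t" using elim(1) by (simp only: real_norm_def real_scaleR_def abs_le_iff) linarith
      moreover have "(c t + e/2) * (s - t) = (s - t) * c t + e/2 * (s - t)" by (simp add: algebra_simps)
      moreover have "e * (s - t) = e/2 * (s - t) + e/2 * (s - t)" by simp
      ultimately show ?case using elim(2) by linarith
    qed
  qed
  then show ?thesis by (simp add: C_def)
qed

text \<open>The norm is not differentiable at 0, but by the triangle inequality
  \<open>norm (x u - x s) - M * (u - s)\<close> satisfies the upper right bound, which is all that
  continuous induction asks for.\<close>

lemma absolutely_continuous_lipschitz:
  fixes x :: "real \<Rightarrow> 'a::euclidean_space"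
  assumes ac: "absolutely_continuous_on {a..b} x" and N: "negligible N" and M: "0 \<le> M"
    and der: "\<And>t. t \<in> {a..b} - N \<Longrightarrow> \<exists>v. norm v \<le> M \<and> (x has_vector_derivative v) (at t)"
    and st: "a \<le> s" "s \<le> t" "t \<le> b"
  shows "norm (x t - x s) \<le> M * (t - s)"
proof -
  define G where "G u = norm (x u - x s) - M * (u - s)" for u
  have "G t \<le> G s"
  proof (rule absolutely_continuous_nonincreasing[OF st(2) _ N])
    show "absolutely_continuous_on {s..t} G"
    proof (rule absolutely_continuous_on_dominated[where M = M])
      show "absolutely_continuous_on {s..t} x" using ac st by (auto intro: absolutely_continuous_on_subset)
      fix u v assume "u \<in> {s..t}" "v \<in> {s..t}" "u \<le> v"
      moreover have "\<bar>norm (x v - x s) - norm (x u - x s)\<bar> \<le> norm (x v - x u)"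
        using norm_triangle_ineq3[of "x v - x s" "x u - x s"] by simp
      moreover have "0 \<le> M * (v - u)" using M \<open>u \<le> v\<close> by simp
      ultimately show "norm (G v - G u) \<le> norm (x v - x u) + M * (v - u)"
        by (simp add: G_def algebra_simps)
    qed
    fix u e :: real assume u: "s \<le> u" "u < t" "u \<notin> N" and e: "0 < e"
    then obtain v where v: "norm v \<le> M" "(x has_vector_derivative v) (at u)" using der[of u] st by auto
    then have "(x has_vector_derivative v) (at u within {u..t})" using has_vector_derivative_at_within by blast
    then have "\<forall>\<^sub>F w in at_right u. norm (x w - x u - (w - u) *\<^sub>R v) \<le> e * (w - u)"
      using u e by (intro has_vector_derivative_at_rightD) auto
    moreover have "\<forall>\<^sub>F w in at_right u. u < w" by (rule eventually_at_right_less)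
    ultimately show "\<forall>\<^sub>F w in at_right u. G w - G u \<le> e * (w - u)"
    proof eventually_elim
      case (elim w)
      have "norm (x w - x u) \<le> norm (x w - x u - (w - u) *\<^sub>R v) + norm ((w - u) *\<^sub>R v)"
        using norm_triangle_ineq[of "x w - x u - (w - u) *\<^sub>R v" "(w - u) *\<^sub>R v"] by simp
      moreover have "norm ((w - u) *\<^sub>R v) \<le> M * (w - u)" using elim v by (simp add: mult.commute)
      ultimately have "norm (x w - x u) \<le> (M + e) * (w - u)" using elim by (simp add: algebra_simps)
      moreover have "norm (x w - x s) \<le> norm (x w - x u) + norm (x u - x s)"
        using norm_triangle_ineq[of "x w - x u" "x u - x s"] by simp
      ultimately show ?case by (simp add: G_def algebra_simps)
    qed
  qed
  then show ?thesis by (simp add: G_def)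
qed

section \<open>Solutions of differential inclusions\<close>

definition lipschitz_set_map_on :: "real \<Rightarrow> 'a set \<Rightarrow> ('a::real_normed_vector \<Rightarrow> 'a set) \<Rightarrow> bool" where
  "lipschitz_set_map_on L S F \<longleftrightarrow>
     (\<forall>y\<in>S. \<forall>z\<in>S. \<forall>a\<in>F y. \<exists>b\<in>F z. norm (a - b) \<le> L * norm (y - z))"

text \<open>A finite subcover has a largest local constant, but two points of the ball need not
  share a patch. The segment between them stays in the ball, bisection cuts it into pieces inside
  patches, and \<open>P\<close> measures the error by length along the segment, so the errors add up
  with the same \<open>L\<close>.\<close>

lemma locally_Lipschitz_set_map_on_cball:
  fixes F :: "real^'n \<Rightarrow> (real^'n) set"
  assumes F: "locally_Lipschitz_set_map F"
  obtains L where "0 < L" "lipschitz_set_map_on L (cball 0 R) F"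
proof -
  obtain U Lf where U: "\<And>\<xi>. open (U \<xi>)" "\<And>\<xi>. \<xi> \<in> U \<xi>"
    and FU: "\<And>\<xi> \<eta> \<zeta>. \<eta> \<in> U \<xi> \<Longrightarrow> \<zeta> \<in> U \<xi> \<Longrightarrow>
           F \<eta> \<subseteq> {a + (Lf \<xi> * norm (\<eta> - \<zeta>)) *\<^sub>R b | a b. a \<in> F \<zeta> \<and> b \<in> cball 0 1}"
    and Lf: "\<And>\<xi>. 0 < Lf \<xi>"
  proof -
    let ?P = "\<lambda>\<xi> U L. open U \<and> \<xi> \<in> U \<and> L > 0 \<and> (\<forall>\<eta>\<in>U. \<forall>\<zeta>\<in>U.
        F \<eta> \<subseteq> {a + (L * norm (\<eta> - \<zeta>)) *\<^sub>R b | a b. a \<in> F \<zeta> \<and> b \<in> cball 0 1})"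
    obtain U where "\<forall>\<xi>. \<exists>L. ?P \<xi> (U \<xi>) L"
      using choice[OF F[unfolded locally_Lipschitz_set_map_def]] by (rule exE)
    from choice[OF this] obtain Lf where "\<forall>\<xi>. ?P \<xi> (U \<xi>) (Lf \<xi>)" by (rule exE)
    then show thesis by (intro that[of U Lf]) simp_all
  qed
  have "compact (cball (0::real^'n) R)" by simp
  moreover have "open (U \<xi>)" for \<xi> by (rule U(1))
  moreover have "cball 0 R \<subseteq> (\<Union>c\<in>cball 0 R. U c)" using U(2) by blast
  ultimately obtain C where C: "finite C" "cball 0 R \<subseteq> (\<Union>c\<in>C. U c)"
    by (rule compactE_image)
  define L where "L = Max (insert 1 (Lf ` C))"
  have L: "1 \<le> L" "\<And>c. c \<in> C \<Longrightarrow> Lf c \<le> L" using C(1) by (auto simp: L_def)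
  have near: "\<exists>b\<in>F \<zeta>. norm (a - b) \<le> L * norm (\<eta> - \<zeta>)"
    if c: "c \<in> C" "\<eta> \<in> U c" "\<zeta> \<in> U c" and a: "a \<in> F \<eta>" for c \<eta> \<zeta> a
  proof -
    obtain b e where b: "b \<in> F \<zeta>" "norm e \<le> 1" "a = b + (Lf c * norm (\<eta> - \<zeta>)) *\<^sub>R e"
      using FU[OF c(2,3)] a by auto
    have "norm (a - b) = Lf c * norm (\<eta> - \<zeta>) * norm e" using b(3) less_imp_le[OF Lf[of c]] by (simp add: abs_mult)
    also have "\<dots> \<le> L * norm (\<eta> - \<zeta>) * 1" using L c b less_imp_le[OF Lf[of c]] by (intro mult_mono) auto
    finally show ?thesis using b(1) by auto
  qed
  have "lipschitz_set_map_on L (cball 0 R) F"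
    unfolding lipschitz_set_map_on_def
  proof (intro ballI)
    fix y z a :: "real^'n" assume yz: "y \<in> cball 0 R" "z \<in> cball 0 R" and a: "a \<in> F y"
    define p where "p s = y + s *\<^sub>R (z - y)" for s :: real
    define P where "P s t \<longleftrightarrow> (\<forall>a\<in>F (p s). \<exists>b\<in>F (p t). norm (a - b) \<le> L * ((t - s) * norm (z - y)))" for s t
    have "P 0 1"
    proof (rule Bolzano)
      fix r s t assume "P r s" "P s t"
      show "P r t" unfolding P_def
      proof
        fix a assume "a \<in> F (p r)"
        then obtain b where b: "b \<in> F (p s)" "norm (a - b) \<le> L * ((s - r) * norm (z - y))" using \<open>P r s\<close> by (auto simp: P_def)
        then obtain c where c: "c \<in> F (p t)" "norm (b - c) \<le> L * ((t - s) * norm (z - y))" using \<open>P s t\<close> by (auto simp: P_def)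
        have "norm (a - c) \<le> norm (a - b) + norm (b - c)" using norm_triangle_ineq[of "a - b" "b - c"] by simp
        also have "\<dots> \<le> L * ((t - r) * norm (z - y))" using b(2) c(2) by (simp add: algebra_simps)
        finally show "\<exists>b\<in>F (p t). norm (a - b) \<le> L * ((t - r) * norm (z - y))" using c(1) by blast
      qed
    next
      fix s :: real assume s: "0 \<le> s" "s \<le> 1"
      have "p s \<in> cball 0 R"
        using convexD_alt[OF convex_cball yz, of s] s by (simp add: p_def algebra_simps)
      then obtain c where c: "c \<in> C" "p s \<in> U c" using C(2) by blast
      have "isCont p s" unfolding p_def by (intro continuous_intros)
      then have "\<forall>\<^sub>F r in at s. p r \<in> U c" using U(1) c(2) unfolding isCont_def by (rule topological_tendstoD)
      then obtain d where d: "0 < d" "\<And>r. dist r s < d \<Longrightarrow> p r \<in> U c"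
        using c(2) unfolding eventually_at by (metis UNIV_I)
      have "P r t" if "r \<le> s \<and> s \<le> t \<and> t - r < d" for r t
        unfolding P_def
      proof
        fix a assume "a \<in> F (p r)"
        moreover have "p r \<in> U c" "p t \<in> U c" using that by (auto intro!: d(2) simp: dist_real_def)
        moreover have "norm (p r - p t) = (t - r) * norm (z - y)"
        proof -
          have "p r - p t = (r - t) *\<^sub>R (z - y)" by (simp add: p_def algebra_simps)
          then show ?thesis using that by simp
        qed
        ultimately show "\<exists>b\<in>F (p t). norm (a - b) \<le> L * ((t - r) * norm (z - y))"
          using near[OF c(1), of "p r" "p t" a] by auto
      qed
      then show "\<exists>d>0. \<forall>r t. r \<le> s \<and> s \<le> t \<and> t - r < d \<longrightarrow> P r t" using d(1) by blast
    qed simp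
    then show "\<exists>b\<in>F z. norm (a - b) \<le> L * norm (y - z)"
      using a by (auto simp: P_def p_def norm_minus_commute[of y z])
  qed
  with L that show thesis by (meson less_le_trans zero_less_one)
qed

lemma locally_Lipschitz_set_map_bounded:
  fixes F :: "real^'n \<Rightarrow> (real^'n) set"
  assumes F: "locally_Lipschitz_set_map F" and cpt: "\<And>\<xi>. compact (F \<xi>)"
  obtains M where "0 < M" "\<And>y a. y \<in> cball 0 R \<Longrightarrow> a \<in> F y \<Longrightarrow> norm a \<le> M"
proof -
  obtain L where L: "0 < L" "lipschitz_set_map_on L (cball 0 R) F"
    using locally_Lipschitz_set_map_on_cball[OF F] by blast
  obtain B where B: "\<And>b. b \<in> F 0 \<Longrightarrow> norm b \<le> B" using compact_imp_bounded[OF cpt[of 0]] by (auto simp: bounded_iff)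
  \<comment> \<open>Every value is compared with one in the compact set \<open>F 0\<close>, at
    distance at most \<open>L * \<bar>R\<bar>\<close>.\<close>
  have "norm a \<le> \<bar>B\<bar> + L * \<bar>R\<bar> + 1" if y: "y \<in> cball 0 R" and a: "a \<in> F y" for y a
  proof -
    have "0 \<in> cball (0::real^'n) R" using y norm_ge_zero[of y] by (simp del: norm_ge_zero)
    then obtain b where b: "b \<in> F 0" "norm (a - b) \<le> L * norm (y - 0)"
      using L(2) y a unfolding lipschitz_set_map_on_def by blast
    have "L * norm (y - 0) \<le> L * \<bar>R\<bar>" using y L(1) by (intro mult_left_mono) auto
    then show ?thesis using b B[of b] norm_triangle_ineq[of "a - b" b] by simp
  qed
  moreover have "0 < \<bar>B\<bar> + L * \<bar>R\<bar> + 1" using L by (intro add_nonneg_pos add_nonneg_nonneg) auto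
  ultimately show thesis using that by blast
qed

section \<open>Elementary properties and maximal extension of solutions\<close>

lemma is_solutionE:
  assumes "is_solution F x T"
  obtains N where "negligible N"
    "\<And>t. 0 \<le> t \<Longrightarrow> ereal t < T \<Longrightarrow> t \<notin> N \<Longrightarrow> \<exists>v\<in>F (x t). (x has_vector_derivative v) (at t)"
proof -
  have "AE t in lebesgue. 0 \<le> t \<and> ereal t < T \<longrightarrow> (\<exists>v \<in> F (x t). (x has_vector_derivative v) (at t))"
    using assms by (simp add: is_solution_def)
  then obtain N where "N \<in> null_sets lebesgue"
    "{t\<in>space lebesgue. \<not> (0 \<le> t \<and> ereal t < T \<longrightarrow> (\<exists>v \<in> F (x t). (x has_vector_derivative v) (at t)))} \<subseteq> N"
    unfolding eventually_ae_filter by blast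
  then show thesis by (intro that[of N]) (auto simp: negligible_iff_null_sets)
qed

lemma is_solution_continuous_on:
  assumes "is_solution F x T" "ereal b < T" shows "continuous_on {0..b} x"
proof (cases "0 \<le> b")
  case True
  then have "absolutely_continuous_on {0..b} x" using assms by (simp add: is_solution_def)
  then show ?thesis by (rule absolutely_continuous_imp_continuous_on)
qed simp

lemma is_solution_lipschitz:
  assumes sol: "is_solution F x T" and b: "ereal b < T" and M: "0 \<le> M"
    and bd: "\<And>t v. t \<in> {0..b} \<Longrightarrow> v \<in> F (x t) \<Longrightarrow> norm v \<le> M"
    and st: "0 \<le> s" "s \<le> t" "t \<le> b"
  shows "norm (x t - x s) \<le> M * (t - s)"
proof -
  obtain N where N: "negligible N"
    "\<And>t. 0 \<le> t \<Longrightarrow> ereal t < T \<Longrightarrow> t \<notin> N \<Longrightarrow> \<exists>v\<in>F (x t). (x has_vector_derivative v) (at t)"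
    using is_solutionE[OF sol] by blast
  have "absolutely_continuous_on {0..b} x" using sol b st by (simp add: is_solution_def)
  then show ?thesis
  proof (rule absolutely_continuous_lipschitz[OF _ N(1) M _ st])
    fix t assume t: "t \<in> {0..b} - N"
    then have "ereal t < T" using b by (simp add: le_less_trans[of "ereal t" "ereal b" T])
    then show "\<exists>v. norm v \<le> M \<and> (x has_vector_derivative v) (at t)" using N(2)[of t] bd[of t] t by auto
  qed
qed

text \<open>Solutions are extended step by step, each time almost as far as possible; the horizon is measured
  on a bounded scale so that an infinite horizon needs no special treatment.\<close>

lemma is_solution_maximal_extension:
  assumes sol: "is_solution F x T"
  obtains z T' where "is_maximal_solution F z T'" "T \<le> T'"
    "\<And>t. 0 \<le> t \<Longrightarrow> ereal t < T \<Longrightarrow> z t = x t"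
proof -
  \<comment> \<open>\<open>arctan\<close> stays below \<open>pi/2 < 2\<close>, so the value 2 ranks
    the infinite horizon strictly above all finite ones.\<close>
  define \<phi> where "\<phi> T = (if T = \<infinity> then 2 else arctan (real_of_ereal T))" for T :: ereal
  have \<phi>_less: "\<phi> T < \<phi> T'" if "0 < T" "T < T'" for T T'
  proof (cases T; cases T')
    fix r r' assume "T = ereal r" "T' = ereal r'"
    then show ?thesis using that by (simp add: \<phi>_def arctan_monotone)
  next
    fix r assume "T = ereal r" "T' = \<infinity>"
    then show ?thesis using arctan_ubound[of r] pi_less_4 by (simp add: \<phi>_def)
  qed (use that in auto)
  have \<phi>_le2: "\<phi> T \<le> 2" for T using arctan_ubound[of "real_of_ereal T"] pi_less_4 by (simp add: \<phi>_def)
  define Ext where "Ext s s' \<longleftrightarrow> is_solution F (fst s') (snd s') \<and> snd s \<le> snd s' \<and>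
    (\<forall>t. 0 \<le> t \<and> ereal t < snd s \<longrightarrow> fst s' t = fst s t)" for s s'
  have Ext_refl: "Ext s s" if "is_solution F (fst s) (snd s)" for s using that by (simp add: Ext_def)
  have Ext_trans: "Ext s s''" if "Ext s s'" "Ext s' s''" for s s' s''
    using that unfolding Ext_def by (metis order_trans less_le_trans)
  have step: "\<exists>s'. Ext s s' \<and> (\<forall>s''. Ext s' s'' \<longrightarrow> \<phi> (snd s'') \<le> \<phi> (snd s') + e)"
    if s: "is_solution F (fst s) (snd s)" and e: "0 < e" for s e
  proof -
    define A where "A = (\<lambda>s'. \<phi> (snd s')) ` {s'. Ext s s'}"
    have bA: "bdd_above A" unfolding A_def by (rule bdd_aboveI2[of _ _ 2]) (rule \<phi>_le2)
    have "\<phi> (snd s) \<in> A" unfolding A_def by (intro imageI CollectI Ext_refl s)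
    then have "A \<noteq> {}" by blast
    then obtain s' where s': "Ext s s'" "Sup A - e < \<phi> (snd s')"
    proof -
      have "Sup A - e < Sup A" using e by simp
      then obtain r where "r \<in> A" "Sup A - e < r" using less_cSupE \<open>A \<noteq> {}\<close> by metis
      then show thesis using that by (force simp: A_def)
    qed
    have "\<phi> (snd s'') \<le> Sup A" if "Ext s' s''" for s''
      using Ext_trans[OF s'(1) that] by (intro cSup_upper bA) (auto simp: A_def)
    then show ?thesis using s' by (intro exI[of _ s']) force
  qed
  have "\<exists>f. \<forall>n. Ext (x, T) (f n) \<and> (Ext (f n) (f (Suc n)) \<and>
      (\<forall>s''. Ext (f (Suc n)) s'' \<longrightarrow> \<phi> (snd s'') \<le> \<phi> (snd (f (Suc n))) + 1 / Suc n))"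
  proof (rule dependent_nat_choice)
    show "\<exists>s. Ext (x, T) s" using Ext_refl[of "(x, T)"] sol by auto
    fix s n assume "Ext (x, T) s"
    moreover obtain s' where "Ext s s'" "\<forall>s''. Ext s' s'' \<longrightarrow> \<phi> (snd s'') \<le> \<phi> (snd s') + 1 / Suc n"
      using step[of s "1 / Suc n"] calculation by (auto simp: Ext_def)
    ultimately show "\<exists>s'. Ext (x, T) s' \<and> (Ext s s' \<and> (\<forall>s''. Ext s' s'' \<longrightarrow> \<phi> (snd s'') \<le> \<phi> (snd s') + 1 / Suc n))"
      using Ext_trans by blast
  qed
  then obtain f where f: "\<And>n. Ext (x, T) (f n)" "\<And>n. Ext (f n) (f (Suc n))"
    "\<And>n s''. Ext (f (Suc n)) s'' \<Longrightarrow> \<phi> (snd s'') \<le> \<phi> (snd (f (Suc n))) + 1 / Suc n"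
    by blast
  define X where "X n = fst (f n)" for n
  define Y where "Y n = snd (f n)" for n
  have solX: "is_solution F (X n) (Y n)" for n using f(1)[of n] by (simp add: Ext_def X_def Y_def)
  have Ext_le: "Ext (f m) (f n)" if "m \<le> n" for m n
    using that
  proof (induction n rule: dec_induct)
    case base then show ?case using solX by (intro Ext_refl) (simp add: X_def Y_def)
  next
    case (step n) then show ?case using f(2) Ext_trans by blast
  qed
  have agree: "X n t = X m t" if "0 \<le> t" "ereal t < Y m" "ereal t < Y n" for m n t
    using Ext_le[of m n] Ext_le[of n m] that by (cases "m \<le> n") (auto simp: Ext_def X_def Y_def)
  define Yi where "Yi = (SUP n. Y n)"
  have Y_le: "Y n \<le> Yi" for n unfolding Yi_def by (rule SUP_upper) simp
  have ex: "\<exists>n. ereal t < Y n" if "ereal t < Yi" for t using that by (simp add: Yi_def less_SUP_iff)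
  \<comment> \<open>The least index is only a canonical choice: by \<open>agree\<close>, every
    member of the chain whose horizon exceeds \<open>t\<close> gives the same value.\<close>
  define z where "z t = X (LEAST n. ereal t < Y n) t" for t
  have z: "z t = X n t" if "0 \<le> t" "ereal t < Y n" for t n
    unfolding z_def using that LeastI[of "\<lambda>n. ereal t < Y n" n] by (intro agree) auto
  have T_le: "T \<le> Y n" for n using f(1)[of n] by (simp add: Ext_def Y_def)
  have zx: "z t = x t" if "0 \<le> t" "ereal t < T" for t
    using z[of t 0] that T_le[of 0] f(1)[of 0] by (auto simp: Ext_def X_def Y_def)
  have T0: "0 < T" using sol by (simp add: is_solution_def)
  have zsol: "is_solution F z Yi"
    unfolding is_solution_def
  proof (intro conjI allI impI)
    show "0 < Yi" using T0 T_le[of 0] Y_le[of 0] by simp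
    fix a b assume ab: "0 \<le> a \<and> a \<le> b \<and> ereal b < Yi"
    then obtain n where n: "ereal b < Y n" using ex by blast
    have "absolutely_continuous_on {a..b} (X n)" using solX[of n] ab n by (simp add: is_solution_def)
    then show "absolutely_continuous_on {a..b} z"
    proof (rule absolutely_continuous_on_cong)
      fix t assume "t \<in> {a..b}"
      then show "z t = X n t" using ab n by (intro z) (auto intro: le_less_trans[of "ereal t" "ereal b" "Y n"])
    qed
  next
    have "AE t in lebesgue. \<forall>n. 0 \<le> t \<and> ereal t < Y n \<longrightarrow> (\<exists>v \<in> F (X n t). (X n has_vector_derivative v) (at t))"
      unfolding AE_all_countable using solX by (simp add: is_solution_def)
    \<comment> \<open>At 0 the members of the chain agree with \<open>z\<close> only to the right,
      which does not determine a two-sided derivative.\<close>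
    moreover have "AE t in lebesgue. t \<noteq> (0::real)"
      by (rule AE_I'[of "{0}"]) (auto simp flip: negligible_iff_null_sets)
    ultimately show "AE t in lebesgue. 0 \<le> t \<and> ereal t < Yi \<longrightarrow> (\<exists>v \<in> F (z t). (z has_vector_derivative v) (at t))"
    proof eventually_elim
      case (elim t)
      show ?case
      proof
        assume t: "0 \<le> t \<and> ereal t < Yi"
        then obtain n where n: "ereal t < Y n" using ex by blast
        then obtain v where v: "v \<in> F (X n t)" "(X n has_vector_derivative v) (at t)" using elim t by blast
        have "open {s. 0 < s \<and> ereal s < Y n}"
          by (cases "Y n") (auto simp: open_Collect_conj open_Collect_less)
        then have "(z has_vector_derivative v) (at t)"
          using v(2) elim t n z by (intro has_vector_derivative_transform_within_open[OF v(2)]) auto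
        then show "\<exists>v \<in> F (z t). (z has_vector_derivative v) (at t)" using v(1) z t n by auto
      qed
    qed
  qed
  have "is_maximal_solution F z Yi"
    unfolding is_maximal_solution_def
  proof (intro conjI notI zsol)
    assume "\<exists>y T'. Yi < T' \<and> is_solution F y T' \<and> (\<forall>t. 0 \<le> t \<and> ereal t < Yi \<longrightarrow> y t = z t)"
    then obtain y T' where y: "Yi < T'" "is_solution F y T'" "\<And>t. 0 \<le> t \<Longrightarrow> ereal t < Yi \<Longrightarrow> y t = z t" by blast
    \<comment> \<open>A proper extension of \<open>z\<close> extends every member of the chain, and
      member \<open>Suc n\<close> was chosen so that no extension gains more than
      \<open>1 / Suc n\<close>.\<close>
    have "\<phi> T' \<le> \<phi> Yi + 1 / Suc n" for n
    proof -
      have "Ext (f (Suc n)) (y, T')"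
        using y Y_le[of "Suc n"] z[of _ "Suc n"] by (auto simp: Ext_def X_def Y_def intro: less_le_trans)
      then have "\<phi> T' \<le> \<phi> (Y (Suc n)) + 1 / Suc n" using f(3) by (fastforce simp: Y_def)
      moreover have "\<phi> (Y (Suc n)) \<le> \<phi> Yi"
        using \<phi>_less[of "Y (Suc n)" Yi] Y_le[of "Suc n"] less_le_trans[OF T0 T_le[of "Suc n"]]
        by (cases "Y (Suc n) = Yi") (simp_all add: order.strict_iff_order)
      ultimately show ?thesis by simp
    qed
    moreover have "\<phi> Yi < \<phi> T'" using y(1) T0 T_le[of 0] Y_le[of 0] by (intro \<phi>_less) auto
    then obtain n where "1 / Suc n < \<phi> T' - \<phi> Yi" using nat_approx_posE[of "\<phi> T' - \<phi> Yi"] by auto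
    ultimately show False by (metis add.commute less_diff_eq not_le)
  qed
  moreover have "T \<le> Yi" using T_le[of 0] Y_le[of 0] by simp
  ultimately show thesis using that zx by blast
qed

section \<open>Regular solutions\<close>

definition grid :: "nat \<Rightarrow> real \<Rightarrow> real" where
  "grid k t = of_int \<lfloor>2^k * t\<rfloor> / 2^k"

lemma grid_le: "grid k t \<le> t"
  unfolding grid_def by (simp add: divide_le_eq mult.commute)

lemma grid_ge: "t - 1 / 2^k \<le> grid k t"
proof -
  have "2^k * t - 1 \<le> of_int \<lfloor>2^k * t\<rfloor>" by linarith
  then have "(2^k * t - 1) / 2^k \<le> of_int \<lfloor>2^k * t\<rfloor> / 2^k" by (rule divide_right_mono) simp
  then show ?thesis by (simp add: grid_def diff_divide_distrib)
qed

lemma grid_nonneg: "0 \<le> t \<Longrightarrow> 0 \<le> grid k t"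
  unfolding grid_def by simp

lemma grid_mem: "t \<in> {0..\<tau>} \<Longrightarrow> grid k t \<in> {0..\<tau>}"
  using grid_le[of k t] grid_nonneg[of t k] by auto

text \<open>Each cell of the finer grid lies in one cell of the coarser grid, as \<open>2^k\<close>
  is a multiple of \<open>2^j\<close>. Hence step functions remain step functions under
  refinement.\<close>

lemma grid_grid:
  assumes "j \<le> k" shows "grid j (grid k t) = grid j t"
proof -
  have pow: "(2::real)^k = 2^j * 2^(k-j)" using assms by (simp flip: power_add)
  have "2^j * grid k t = of_int \<lfloor>2^k * t\<rfloor> / of_int (2^(k-j))" by (simp add: grid_def pow)
  then have "\<lfloor>2^j * grid k t\<rfloor> = \<lfloor>2^k * t\<rfloor> div 2^(k-j)" by (simp only: floor_divide_of_int_eq)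
  also have "\<dots> = \<lfloor>(2^k * t) / of_int (2^(k-j))\<rfloor>" by (rule floor_divide_real_eq_div[symmetric]) simp
  also have "(2^k * t) / of_int (2^(k-j)) = 2^j * t" by (simp add: pow)
  finally show ?thesis by (simp add: grid_def)
qed

text \<open>A multiple of the mesh passes through the floor; this is what allows velocities to be
  joined at time \<open>1 / 2^j\<close>.\<close>

lemma grid_shift:
  assumes "j \<le> k" shows "grid k (t + 1 / 2^j) = grid k t + 1 / 2^j"
proof -
  have pow: "(2::real)^k = 2^j * 2^(k-j)" using assms by (simp flip: power_add)
  have "2^k * (t + 1 / 2^j) = 2^k * t + of_int (2^(k-j))" by (simp add: pow algebra_simps)
  then have "\<lfloor>2^k * (t + 1 / 2^j)\<rfloor> = \<lfloor>2^k * t\<rfloor> + 2^(k-j)" by (simp only: floor_add_int)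
  then show ?thesis by (simp add: grid_def pow add_divide_distrib)
qed

text \<open>Invariance under rounding, so that no list of breakpoints has to be carried
  along.\<close>

definition step_on_grid :: "nat \<Rightarrow> (real \<Rightarrow> 'a) \<Rightarrow> bool" where
  "step_on_grid k w \<longleftrightarrow> (\<forall>t. w (grid k t) = w t)"

lemma step_on_grid_integrable:
  fixes w :: "real \<Rightarrow> 'a::euclidean_space"
  assumes w: "step_on_grid k w" shows "w integrable_on {a..b}"
proof -
  define v where "v i = w (of_int i / 2^k)" for i
  have wv: "w t = v \<lfloor>2^k * t\<rfloor>" for t using w by (simp add: v_def step_on_grid_def grid_def)
  have "(\<lambda>t::real. \<lfloor>2^k * t\<rfloor>) \<in> borel \<rightarrow>\<^sub>M count_space UNIV" by measurable
  then have "(\<lambda>t::real. v \<lfloor>2^k * t\<rfloor>) \<in> borel_measurable borel"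
    by (rule measurable_compose) simp
  then have "w \<in> borel_measurable borel" using wv by presburger
  then have m: "w \<in> borel_measurable (lebesgue_on {a..b})"
    by (simp add: borel_measurable_if_I measurable_completion measurable_restrict_space1)
  define B where "B = (\<Sum>i\<in>{\<lfloor>2^k * a\<rfloor>..\<lfloor>2^k * b\<rfloor>}. norm (v i))"
  have "norm (w t) \<le> B" if "t \<in> {a..b}" for t
    unfolding B_def wv[of t] using that by (intro member_le_sum) (auto intro!: floor_mono mult_left_mono)
  then show ?thesis
    by (intro measurable_bounded_by_integrable_imp_integrable[OF m, of "\<lambda>_. B"]) auto
qed

lemma integral_norm_le:
  fixes f :: "real \<Rightarrow> 'a::euclidean_space"
  assumes "f integrable_on {a..b}" "\<And>t. t \<in> {a..b} \<Longrightarrow> norm (f t) \<le> B" "a \<le> b"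
  shows "norm (integral {a..b} f) \<le> B * (b - a)"
  using integral_norm_bound_integral[of f "{a..b}" "\<lambda>_. B"] integrable_const_ivl[of B a b] assms
  by (simp add: mult.commute)

lemma integral_diff_initial:
  fixes f :: "real \<Rightarrow> 'a::euclidean_space"
  assumes "f integrable_on {a..t}" "a \<le> s" "s \<le> t"
  shows "integral {a..t} f - integral {a..s} f = integral {s..t} f"
  using Henstock_Kurzweil_Integration.integral_combine[OF assms(2,3,1)] by (simp add: algebra_simps)

text \<open>Uniform limits of step functions on dyadic grids: a class of velocities that avoids measurable
  selections altogether.\<close>

definition dyadic_regulated :: "real \<Rightarrow> (real \<Rightarrow> 'a::real_normed_vector) \<Rightarrow> bool" where
  "dyadic_regulated \<tau> w \<longleftrightarrow> (\<forall>e>0. \<exists>k. \<forall>t\<in>{0..\<tau>}. norm (w t - w (grid k t)) \<le> e)"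

text \<open>Both \<open>w t\<close> and \<open>w (grid j t)\<close> are close to the value at the
  same coarse point, since \<open>grid k (grid j t) = grid k t\<close>; hence the halved tolerance.
  Validity for all finer levels lets two velocities share one grid.\<close>

lemma dyadic_regulatedD:
  assumes w: "dyadic_regulated \<tau> w" and e: "0 < e"
  shows "\<exists>k. \<forall>j\<ge>k. \<forall>t\<in>{0..\<tau>}. norm (w t - w (grid j t)) \<le> e"
proof -
  obtain k where k: "\<And>t. t \<in> {0..\<tau>} \<Longrightarrow> norm (w t - w (grid k t)) \<le> e/2"
    using w[unfolded dyadic_regulated_def, rule_format, OF half_gt_zero[OF e]] by blast
  have "norm (w t - w (grid j t)) \<le> e" if "k \<le> j" "t \<in> {0..\<tau>}" for j t
    using k[OF that(2)] k[OF grid_mem[OF that(2), of j]] grid_grid[OF that(1), of t]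
      norm_triangle_ineq4[of "w t - w (grid k t)" "w (grid j t) - w (grid k t)"] by simp
  then show ?thesis by blast
qed

lemma dyadic_regulated_integrable:
  fixes w :: "real \<Rightarrow> 'a::euclidean_space"
  assumes w: "dyadic_regulated \<tau> w" shows "w integrable_on {0..\<tau>}"
proof -
  have "w integrable_on cbox 0 \<tau>"
  proof (rule integrable_uniform_limit)
    fix e :: real assume "0 < e"
    then obtain k where k: "\<And>t. t \<in> {0..\<tau>} \<Longrightarrow> norm (w t - w (grid k t)) \<le> e"
      using dyadic_regulatedD[OF w] by blast
    have "step_on_grid k (\<lambda>t. w (grid k t))" by (simp add: step_on_grid_def grid_grid)
    then show "\<exists>g. (\<forall>x\<in>cbox 0 \<tau>. norm (w x - g x) \<le> e) \<and> g integrable_on cbox 0 \<tau>"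
      using step_on_grid_integrable[of k "\<lambda>t. w (grid k t)" 0 \<tau>] k by (intro exI[of _ "\<lambda>t. w (grid k t)"]) auto
  qed
  then show ?thesis by simp
qed

lemma dyadic_regulated_bounded:
  assumes w: "dyadic_regulated \<tau> w"
  obtains B where "\<And>t. t \<in> {0..\<tau>} \<Longrightarrow> norm (w t) \<le> B"
proof -
  obtain k where k: "\<And>t. t \<in> {0..\<tau>} \<Longrightarrow> norm (w t - w (grid k t)) \<le> 1"
    using dyadic_regulatedD[OF w zero_less_one] by blast
  define B where "B = (\<Sum>i\<in>{0..\<lfloor>2^k * \<tau>\<rfloor>}. norm (w (of_int i / 2^k)))"
  have "norm (w t) \<le> B + 1" if t: "t \<in> {0..\<tau>}" for t
  proof -
    have "norm (w (grid k t)) \<le> B" unfolding B_def grid_def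
      using t by (intro member_le_sum[where f = "\<lambda>i. norm (w (of_int i / 2^k))"])
        (auto intro!: floor_mono mult_left_mono)
    then show ?thesis using k[OF t] norm_triangle_ineq[of "w t - w (grid k t)" "w (grid k t)"] by simp
  qed
  then show thesis using that by blast
qed

text \<open>Off the grid points every rounding is constant near \<open>t\<close>, so
  \<open>w\<close> is a uniform limit of functions constant near \<open>t\<close>. Inside the
  interval the trajectory can therefore fail to be differentiable at countably many times
  only.\<close>

lemma dyadic_regulated_isCont:
  assumes w: "dyadic_regulated \<tau> w" and t: "0 < t" "t < \<tau>" and nd: "\<And>k. grid k t \<noteq> t"
  shows "continuous (at t within {0..\<tau>}) w"
  unfolding continuous_within_eps_delta
proof (intro allI impI)
  fix e :: real assume e: "0 < e"
  obtain k where k: "\<And>t. t \<in> {0..\<tau>} \<Longrightarrow> norm (w t - w (grid k t)) \<le> e/3"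
  proof -
    have "0 < e/3" using e by simp
    then show thesis using that dyadic_regulatedD[OF w] by (metis order_refl)
  qed
  define d where "d = min (t - grid k t) (grid k t + 1 / 2^k - t)"
  have "t < grid k t + 1 / 2^k"
  proof -
    have "2^k * t < of_int \<lfloor>2^k * t\<rfloor> + 1" by linarith
    then have "(2^k * t) / 2^k < (of_int \<lfloor>2^k * t\<rfloor> + 1) / 2^k" by (intro divide_strict_right_mono) auto
    then show ?thesis by (simp add: grid_def add_divide_distrib)
  qed
  then have d: "0 < d" using nd[of k] grid_le[of k t] by (simp add: d_def)
  have same: "grid k s = grid k t" if "dist s t < d" for s
  proof -
    have "grid k t < s" "s < grid k t + 1 / 2^k" using that by (auto simp: d_def dist_real_def abs_less_iff)
    then have "of_int \<lfloor>2^k * t\<rfloor> < 2^k * s" "2^k * s < of_int \<lfloor>2^k * t\<rfloor> + 1"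
      by (simp_all add: grid_def field_simps)
    then have "\<lfloor>2^k * s\<rfloor> = \<lfloor>2^k * t\<rfloor>" by linarith
    then show ?thesis by (simp add: grid_def)
  qed
  have "dist (w s) (w t) < e" if "s \<in> {0..\<tau>}" "dist s t < d" for s
    using k[OF that(1)] k[of t] same[OF that(2)] t e
      norm_triangle_ineq4[of "w s - w (grid k s)" "w t - w (grid k t)"] by (simp add: dist_norm)
  with d show "\<exists>d>0. \<forall>s\<in>{0..\<tau>}. dist s t < d \<longrightarrow> dist (w s) (w t) < e" by blast
qed

lemma negligible_grid_points: "negligible {t. \<exists>k. grid k t = t}"
proof -
  have "{t. \<exists>k. grid k t = t} \<subseteq> (\<Union>k. range (\<lambda>i::int. of_int i / 2^k))"
    by (auto simp: grid_def) (metis rangeI)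
  then have "countable {t. \<exists>k. grid k t = t}" by (rule countable_subset) auto
  then show ?thesis by (rule countable_imp_null_set_lborel[THEN null_sets_completionI, folded negligible_iff_null_sets])
qed

text \<open>The velocity is carried along and the inclusion is required at every time, not almost
  everywhere: only then may the velocity be sampled at grid points, which form a null set.\<close>

definition regular_solution ::
  "(real^'n \<Rightarrow> (real^'n) set) \<Rightarrow> (real \<Rightarrow> real^'n) \<Rightarrow> (real \<Rightarrow> real^'n) \<Rightarrow> real \<Rightarrow> bool" where
  "regular_solution F x w \<tau> \<longleftrightarrow> 0 < \<tau> \<and> dyadic_regulated \<tau> w \<and>
     (\<forall>t\<in>{0..\<tau>}. w t \<in> F (x t) \<and> x t = x 0 + integral {0..t} w)"

lemma regular_solutionD:
  assumes "regular_solution F x w \<tau>"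
  shows "0 < \<tau>" "dyadic_regulated \<tau> w"
    "\<And>t. 0 \<le> t \<Longrightarrow> t \<le> \<tau> \<Longrightarrow> w t \<in> F (x t)"
    "\<And>t. 0 \<le> t \<Longrightarrow> t \<le> \<tau> \<Longrightarrow> x t = x 0 + integral {0..t} w"
proof -
  have *: "0 < \<tau> \<and> dyadic_regulated \<tau> w \<and> (\<forall>t\<in>{0..\<tau>}. w t \<in> F (x t) \<and> x t = x 0 + integral {0..t} w)"
    using assms unfolding regular_solution_def .
  then show "0 < \<tau>" "dyadic_regulated \<tau> w" by blast+
  fix t assume "0 \<le> t" "t \<le> \<tau>"
  then have "t \<in> {0..\<tau>}" by simp
  with * show "w t \<in> F (x t)" "x t = x 0 + integral {0..t} w" by blast+
qed

lemma regular_solution_lipschitz: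
  assumes sol: "regular_solution F x w \<tau>" and bd: "\<And>t. t \<in> {0..\<tau>} \<Longrightarrow> norm (w t) \<le> B"
    and st: "0 \<le> s" "s \<le> t" "t \<le> \<tau>"
  shows "norm (x t - x s) \<le> B * (t - s)"
proof -
  have "w integrable_on {0..\<tau>}" using regular_solutionD(2)[OF sol] by (rule dyadic_regulated_integrable)
  then have i: "w integrable_on {0..t}" "w integrable_on {s..t}"
    using st by (auto intro: integrable_on_subinterval)
  have "x t = x 0 + integral {0..t} w" "x s = x 0 + integral {0..s} w"
    by (rule regular_solutionD(4)[OF sol]; use st in linarith)+
  then have "x t - x s = integral {s..t} w"
    using integral_diff_initial[OF i(1) st(1,2)] by simp
  then show ?thesis using integral_norm_le[OF i(2) _ st(2)] bd st by auto
qed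

lemma regular_solution_is_solution:
  assumes sol: "regular_solution F x w \<tau>" shows "is_solution F x (ereal \<tau>)"
  unfolding is_solution_def
proof (intro conjI allI impI)
  have reg: "dyadic_regulated \<tau> w" and \<tau>: "0 < \<tau>" using regular_solutionD[OF sol] by blast+
  show "0 < ereal \<tau>" using \<tau> by simp
  obtain B where B: "\<And>t. t \<in> {0..\<tau>} \<Longrightarrow> norm (w t) \<le> B" using dyadic_regulated_bounded[OF reg] by blast
  show "absolutely_continuous_on {a..b} x" if "0 \<le> a \<and> a \<le> b \<and> ereal b < ereal \<tau>" for a b
    by (rule lipschitz_imp_absolutely_continuous[where M = B])
      (use regular_solution_lipschitz[OF sol B] that in auto)
  have "AE t in lebesgue. t \<notin> {t. \<exists>k. grid k t = t}"
    by (rule AE_not_in) (use negligible_grid_points in \<open>simp add: negligible_iff_null_sets\<close>)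
  then show "AE t in lebesgue. 0 \<le> t \<and> ereal t < ereal \<tau> \<longrightarrow> (\<exists>v\<in>F (x t). (x has_vector_derivative v) (at t))"
  proof eventually_elim
    case (elim t)
    show ?case
    proof
      assume t': "0 \<le> t \<and> ereal t < ereal \<tau>"
      have "grid 0 0 = 0" by (simp add: grid_def)
      then have t: "0 < t" "t < \<tau>" using t' elim by (auto simp: less_le)
      have nd: "grid k t \<noteq> t" for k using elim by blast
      have "((\<lambda>u. integral {0..u} w) has_vector_derivative w t) (at t within {0..\<tau>})"
        using integral_has_vector_derivative_continuous_at[of w 0 \<tau> t "{}"]
          dyadic_regulated_integrable[OF reg] dyadic_regulated_isCont[OF reg t nd] t by auto
      then have "((\<lambda>u. x 0 + integral {0..u} w) has_vector_derivative w t) (at t within {0<..<\<tau>})"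
        by (auto intro!: derivative_eq_intros elim: has_vector_derivative_within_subset)
      then have "((\<lambda>u. x 0 + integral {0..u} w) has_vector_derivative w t) (at t)"
        using t by (simp add: at_within_open[of t "{0<..<\<tau>}"])
      then have "(x has_vector_derivative w t) (at t)"
        by (rule has_vector_derivative_transform_within_open[of _ _ _ "{0<..<\<tau>}"])
          (use t regular_solutionD(4)[OF sol, symmetric] in \<open>simp_all\<close>)
      moreover have "w t \<in> F (x t)" using regular_solutionD(3)[OF sol] t by simp
      ultimately show "\<exists>v\<in>F (x t). (x has_vector_derivative v) (at t)" by blast
    qed
  qed
qed

text \<open>With the junction at \<open>1 / 2^j\<close>, rounding on level \<open>j\<close> or finer
  never moves a time across the junction and commutes with the shift, so both approximations pass to
  the joined velocity.\<close>

lemma regular_solution_concat: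
  assumes x: "regular_solution F x w \<tau>" and \<tau>: "\<tau> = 1 / 2^j"
    and y: "regular_solution F y u \<sigma>" and eq: "y 0 = x \<tau>"
  shows "regular_solution F (\<lambda>t. if t < \<tau> then x t else y (t - \<tau>)) (\<lambda>t. if t < \<tau> then w t else u (t - \<tau>)) (\<tau> + \<sigma>)"
    (is "regular_solution F ?X ?W _")
proof -
  have wr: "dyadic_regulated \<tau> w" and ur: "dyadic_regulated \<sigma> u" and pos: "0 < \<tau>" "0 < \<sigma>"
    using regular_solutionD[OF x] regular_solutionD[OF y] by blast+
  have reg: "dyadic_regulated (\<tau> + \<sigma>) ?W"
    unfolding dyadic_regulated_def
  proof (intro allI impI)
    fix e :: real assume e: "0 < e"
    obtain k where k: "\<And>j t. k \<le> j \<Longrightarrow> t \<in> {0..\<tau>} \<Longrightarrow> norm (w t - w (grid j t)) \<le> e"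
      using dyadic_regulatedD[OF wr e] by blast
    obtain l where l: "\<And>j t. l \<le> j \<Longrightarrow> t \<in> {0..\<sigma>} \<Longrightarrow> norm (u t - u (grid j t)) \<le> e"
      using dyadic_regulatedD[OF ur e] by blast
    define m where "m = max j (max k l)"
    have "norm (?W t - ?W (grid m t)) \<le> e" if t: "t \<in> {0..\<tau>+\<sigma>}" for t
    proof (cases "t < \<tau>")
      case True
      then show ?thesis using k[of m t] t grid_le[of m t] by (auto simp: m_def)
    next
      case False
      have "grid m t = grid m (t - \<tau>) + \<tau>" using grid_shift[of j m "t - \<tau>"] by (simp add: m_def \<tau>)
      moreover have "0 \<le> grid m (t - \<tau>)" using False by (intro grid_nonneg) simp
      ultimately show ?thesis using l[of m "t - \<tau>"] t False by (auto simp: m_def)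
    qed
    then show "\<exists>k. \<forall>t\<in>{0..\<tau> + \<sigma>}. norm (?W t - ?W (grid k t)) \<le> e" by blast
  qed
  have hw: "(?W has_integral integral {0..t} w) {0..t}" if "0 \<le> t" "t \<le> \<tau>" for t
  proof (rule has_integral_spike[of "{\<tau>}"])
    show "(w has_integral integral {0..t} w) {0..t}"
      using dyadic_regulated_integrable[OF wr] that by (intro integrable_integral) (auto intro: integrable_on_subinterval)
  qed (use that in auto)
  have hu: "(?W has_integral integral {0..t} u) {\<tau>..t + \<tau>}" if "0 \<le> t" "t \<le> \<sigma>" for t
  proof -
    have "(u has_integral integral {0..t} u) {0..t}"
      using dyadic_regulated_integrable[OF ur] that by (intro integrable_integral) (auto intro: integrable_on_subinterval)
    then have "(?W \<circ> (+) \<tau> has_integral integral {0..t} u) {0..t}"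
      by (rule has_integral_eq[rotated]) auto
    then show ?thesis by (simp only: has_integral_shift_Icc_real) simp
  qed
  have "?W t \<in> F (?X t) \<and> ?X t = ?X 0 + integral {0..t} ?W" if t: "t \<in> {0..\<tau>+\<sigma>}" for t
  proof (cases "t < \<tau>")
    case True
    then show ?thesis using regular_solutionD(3,4)[OF x, of t] t pos hw[of t, THEN integral_unique] by simp
  next
    case False
    have "(?W has_integral integral {0..\<tau>} w + integral {0..t-\<tau>} u) {0..t}"
      using hw[of \<tau>] hu[of "t - \<tau>"] t False pos by (intro has_integral_combine[of 0 \<tau> t]) auto
    moreover have "x \<tau> = x 0 + integral {0..\<tau>} w" using regular_solutionD(4)[OF x, of \<tau>] pos by simp
    moreover have "y (t - \<tau>) = y 0 + integral {0..t - \<tau>} u" "u (t - \<tau>) \<in> F (y (t - \<tau>))"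
      using regular_solutionD(3,4)[OF y, of "t - \<tau>"] t False by simp_all
    ultimately show ?thesis using False pos eq by (simp add: integral_unique)
  qed
  with reg show ?thesis unfolding regular_solution_def using pos by (intro conjI ballI) (simp, assumption, blast+)
qed

section \<open>Filippov's theorem\<close>

lemma step_on_grid_refine: "step_on_grid k w \<Longrightarrow> k \<le> j \<Longrightarrow> w (grid j t) = w t"
  unfolding step_on_grid_def by (metis grid_grid)

text \<open>Integration gains a factor \<open>1 / L\<close> against the weight
  \<open>exp (L * r)\<close>. Used with \<open>2 * L\<close>, it makes Picard iteration contract on
  the whole interval, whatever its length.\<close>

lemma exp_integral_bound:
  fixes f :: "real \<Rightarrow> 'a::euclidean_space"
  assumes f: "f integrable_on {0..s}" and s: "0 \<le> s" and L: "0 < L" and C: "0 \<le> C"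
    and le: "\<And>r. r \<in> {0..s} \<Longrightarrow> norm (f r) \<le> C * exp (L * r)"
  shows "norm (integral {0..s} f) \<le> C * exp (L * s) / L"
proof -
  have *: "((\<lambda>r. C * exp (L * r)) has_integral (C * exp (L * s) / L - C * exp (L * 0) / L)) {0..s}"
    using s L by (intro fundamental_theorem_of_calculus)
      (auto intro!: derivative_eq_intros simp flip: has_real_derivative_iff_has_vector_derivative)
  have "norm (integral {0..s} f) \<le> integral {0..s} (\<lambda>r. C * exp (L * r))"
    using * le by (intro integral_norm_bound_integral f) (auto simp: integrable_on_def)
  also have "\<dots> = C * exp (L * s) / L - C / L" using integral_unique[OF *] by simp
  also have "\<dots> \<le> C * exp (L * s) / L" using C L by simp
  finally show ?thesis .
qed

text \<open>Filippov's theorem by Picard iteration: the new velocity is a point of \<open>F\<close>, frozen at the previous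
  grid point of the old trajectory, that is closest to the old velocity. Refining the grid in each
  step keeps every velocity a step function, and the velocities converge uniformly.\<close>

lemma filippov_global:
  assumes ne: "\<And>y. F y \<noteq> {}" and cl: "\<And>y. closed (F y)"
    and lip: "lipschitz_set_map_on L UNIV F" and L: "0 < L"
    and bd: "\<And>y a. a \<in> F y \<Longrightarrow> norm a \<le> M" and M: "0 < M" and \<tau>: "0 < \<tau>"
    and step: "step_on_grid K w" and wM: "\<And>t. norm (w t) \<le> M" and c: "0 \<le> c"
    and near: "\<And>t. t \<in> {0..\<tau>} \<Longrightarrow> \<exists>a\<in>F (\<eta> + integral {0..grid (Suc K) t} w). norm (w t - a) \<le> c"
  obtains x u where "regular_solution F x u \<tau>" "x 0 = \<eta>"
    "\<And>t. t \<in> {0..\<tau>} \<Longrightarrow> norm (u t - w t) \<le> 4 * (c + 2 * (L * M / 2^K)) * exp (2 * L * \<tau>)"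
proof -
  define W where "W = rec_nat w (\<lambda>k v t. closest_point (F (\<eta> + integral {0..grid (K + Suc k) t} v)) (v t))"
  define X where "X k t = \<eta> + integral {0..t} (W k)" for k t
  have W0: "W 0 = w" by (simp add: W_def)
  have WS: "W (Suc k) t = closest_point (F (X k (grid (K + Suc k) t))) (W k t)" for k t
    by (simp add: W_def X_def)
  have Wstep: "step_on_grid (K + k) (W k)" for k
  proof (induction k)
    case 0 then show ?case using step by (simp add: W0)
  next
    case (Suc k)
    have "W k (grid (K + Suc k) t) = W k t" for t by (rule step_on_grid_refine[OF Suc]) simp
    then show ?case unfolding step_on_grid_def WS by (simp add: grid_grid)
  qed
  have WM: "norm (W k t) \<le> M" for k t
  proof (cases k)
    case (Suc j)
    show ?thesis unfolding Suc WS by (rule bd[OF closest_point_in_set[OF cl ne]])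
  qed (simp add: W0 wM)
  have Wint: "W k integrable_on {a..b}" for k a b using step_on_grid_integrable[OF Wstep] .
  have XM: "norm (X k t - X k s) \<le> M * (t - s)" if "0 \<le> s" "s \<le> t" for k s t
    using integral_diff_initial[OF Wint that] integral_norm_le[OF Wint WM that(2)] by (simp add: X_def)
  have memF: "W (Suc k) t \<in> F (X k (grid (K + Suc k) t))" for k t
    unfolding WS by (rule closest_point_in_set[OF cl ne])
  have lipD: "\<exists>b\<in>F z. norm (a - b) \<le> L * norm (y - z)" if "a \<in> F y" for a y z
    using lip that by (auto simp: lipschitz_set_map_on_def)
  \<comment> \<open>\<open>B\<close> is \<open>L\<close> times the drift within one cell of level
    \<open>K\<close>; \<open>A\<close> dominates the initial defect \<open>c\<close> and twice
    \<open>B\<close>; \<open>Q\<close> is the largest value of the weight.\<close>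
  define B where "B = L * M / 2^K"
  define A where "A = c + 2 * B"
  define Q where "Q = exp (2 * L * \<tau>)"
  have B: "0 \<le> B" using L M by (simp add: B_def)
  then have A: "0 \<le> A" "c \<le> A" "2 * B \<le> A" using c by (auto simp: A_def)
  have Q: "1 \<le> Q" using L \<tau> by (simp add: Q_def)
  \<comment> \<open>The factor 3/4 is 1/2 from the exponential weight plus 1/4 from freezing the
    state at grid points: that error is \<open>B * (1/2)^k / 2\<close>, at most
    \<open>A * (3/4)^k / 4\<close>.\<close>
  have diff: "norm (W (Suc k) t - W k t) \<le> A * (3/4)^k * exp (2 * L * t)" if "t \<in> {0..\<tau>}" for k t
    using that
  proof (induction k arbitrary: t)
    case 0
    obtain a where a: "a \<in> F (X 0 (grid (Suc K) t))" "norm (w t - a) \<le> c"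
      using near[OF 0] by (auto simp: X_def W0)
    have "norm (W (Suc 0) t - W 0 t) \<le> norm (w t - a)"
      using closest_point_le[OF cl a(1), of "w t"] by (simp add: WS W0 dist_norm norm_minus_commute)
    also have "\<dots> \<le> A * 1" using a A by simp
    also have "\<dots> \<le> A * exp (2 * L * t)" using A 0 L by (intro mult_left_mono) auto
    finally show ?case by simp
  next
    case (Suc k)
    define s where "s = grid (K + Suc k) t"
    define s' where "s' = grid (K + Suc (Suc k)) t"
    have s: "0 \<le> s" "s \<le> s'" "s' \<le> t" "s' - s \<le> 1 / 2^(K + Suc k)"
    proof -
      have "grid (K + Suc k) s' = s" unfolding s_def s'_def by (rule grid_grid) simp
      then show "s \<le> s'" "s' - s \<le> 1 / 2^(K + Suc k)"
        using grid_le[of "K + Suc k" s'] grid_ge[of s' "K + Suc k"] by auto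
      show "0 \<le> s" "s' \<le> t" using Suc.prems grid_nonneg grid_le by (auto simp: s_def s'_def)
    qed
    obtain b where b: "b \<in> F (X (Suc k) s')" "norm (W (Suc k) t - b) \<le> L * norm (X k s - X (Suc k) s')"
      using lipD[OF memF[of k t]] unfolding s_def by blast
    have "norm (X k s' - X (Suc k) s') = norm (integral {0..s'} (\<lambda>r. W (Suc k) r - W k r))"
      by (simp add: X_def Henstock_Kurzweil_Integration.integral_diff Wint norm_minus_commute)
    also have "\<dots> \<le> A * (3/4)^k * exp (2 * L * s') / (2 * L)"
      using s Suc.prems Suc.IH A L by (intro exp_integral_bound integrable_diff Wint) auto
    also have "\<dots> \<le> A * (3/4)^k * exp (2 * L * t) / (2 * L)"
      using s A L by (intro divide_right_mono mult_left_mono) auto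
    finally have 1: "norm (X k s' - X (Suc k) s') \<le> A * (3/4)^k * exp (2 * L * t) / (2 * L)" .
    have "norm (X k s' - X k s) \<le> M * (s' - s)" using XM s by auto
    also have "\<dots> \<le> M * (1 / 2^(K + Suc k))" using s M by (intro mult_left_mono) auto
    finally have 2: "norm (X k s' - X k s) \<le> M * (1 / 2^(K + Suc k))" .
    have "norm (X k s - X (Suc k) s') \<le> M * (1 / 2^(K + Suc k)) + A * (3/4)^k * exp (2 * L * t) / (2 * L)"
      using 1 2 norm_triangle_ineq[of "X k s - X k s'" "X k s' - X (Suc k) s'"] by (simp add: norm_minus_commute)
    then have "L * norm (X k s - X (Suc k) s') \<le> L * (M * (1 / 2^(K + Suc k)) + A * (3/4)^k * exp (2 * L * t) / (2 * L))"
      using L by (intro mult_left_mono) auto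
    also have "\<dots> = B * ((1/2)^k / 2) + A * (3/4)^k * exp (2 * L * t) / 2"
      using L by (simp add: B_def power_add power_divide field_simps)
    also have "\<dots> \<le> A/2 * ((3/4)^k / 2) * exp (2 * L * t) + A * (3/4)^k * exp (2 * L * t) / 2"
    proof -
      have "B * ((1/2)^k / 2) \<le> A/2 * ((3/4)^k / 2)" using A B by (intro mult_mono divide_right_mono power_mono) auto
      also have "\<dots> \<le> A/2 * ((3/4)^k / 2) * exp (2 * L * t)"
        using A L Suc.prems mult_left_mono[of 1 "exp (2 * L * t)" "A/2 * ((3/4)^k / 2)"] by simp
      finally show ?thesis by (rule add_right_mono)
    qed
    also have "\<dots> = A * (3/4)^(Suc k) * exp (2 * L * t)" by (simp add: field_simps)
    finally have "norm (W (Suc k) t - b) \<le> A * (3/4)^(Suc k) * exp (2 * L * t)" using b(2) by linarith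
    moreover have "norm (W (Suc (Suc k)) t - W (Suc k) t) \<le> norm (W (Suc k) t - b)"
      using closest_point_le[OF cl b(1), of "W (Suc k) t"] unfolding WS[of "Suc k"] s'_def
      by (simp add: dist_norm norm_minus_commute)
    ultimately show ?case by linarith
  qed
  \<comment> \<open>Telescoping sum of a geometric series; the 4 is
    \<open>1 / (1 - 3/4)\<close>.\<close>
  have tail: "norm (W (k + m) t - W k t) \<le> 4 * A * Q * ((3/4)^k - (3/4)^(k + m))" if t: "t \<in> {0..\<tau>}" for k m t
  proof (induction m)
    case (Suc m)
    have "A * (3/4)^(k + m) * exp (2 * L * t) \<le> A * (3/4)^(k + m) * Q"
      using t A L unfolding Q_def by (intro mult_left_mono) auto
    then have "norm (W (Suc (k + m)) t - W (k + m) t) \<le> A * (3/4)^(k + m) * Q" using diff[OF t, of "k + m"] by simp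
    moreover have "4 * A * Q * ((3/4)^k - (3/4)^(k + Suc m))
        = 4 * A * Q * ((3/4)^k - (3/4)^(k + m)) + A * (3/4)^(k + m) * Q" by (simp add: algebra_simps)
    ultimately show ?case
      using Suc norm_triangle_ineq[of "W (Suc (k + m)) t - W (k + m) t" "W (k + m) t - W k t"] by simp
  qed simp
  define T where "T k = 4 * A * Q * (3/4)^k" for k :: nat
  have T0: "T \<longlonglongrightarrow> 0" unfolding T_def by (rule tendsto_mult_right_zero[OF LIMSEQ_power_zero]) simp
  have T_small: "\<exists>k. T k < e" if "0 < e" for e
    using order_tendstoD(2)[OF T0 that] by (auto simp: eventually_sequentially)
  have tailT: "norm (W j t - W k t) \<le> T k" if "t \<in> {0..\<tau>}" "k \<le> j" for j k t
  proof -
    have "0 \<le> 4 * A * Q * (3/4)^j" using A Q by simp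
    then show ?thesis using tail[OF that(1), of k "j - k"] that(2) by (simp add: T_def right_diff_distrib)
  qed
  have conv: "convergent (\<lambda>k. W k t)" if t: "t \<in> {0..\<tau>}" for t
  proof (rule Cauchy_convergent, rule metric_CauchyI)
    fix e :: real assume "0 < e"
    then obtain k where k: "T k < e/2" using T_small[of "e/2"] by auto
    have "dist (W i t) (W j t) < e" if "k \<le> i" "k \<le> j" for i j
      using tailT[OF t that(1)] tailT[OF t that(2)] k norm_triangle_ineq4[of "W i t - W k t" "W j t - W k t"]
      by (simp add: dist_norm)
    then show "\<exists>M. \<forall>m\<ge>M. \<forall>n\<ge>M. dist (W m t) (W n t) < e" by blast
  qed
  define u where "u t = lim (\<lambda>k. W k t)" for t
  have lim: "(\<lambda>k. W k t) \<longlonglongrightarrow> u t" if "t \<in> {0..\<tau>}" for t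
    using conv[OF that] by (simp add: u_def convergent_LIMSEQ_iff)
  have uT: "norm (u t - W k t) \<le> T k" if t: "t \<in> {0..\<tau>}" for k t
  proof (rule Lim_bounded)
    show "(\<lambda>j. norm (W j t - W k t)) \<longlonglongrightarrow> norm (u t - W k t)" by (intro tendsto_intros lim t)
  qed (use tailT[OF t] in blast)
  have ureg: "dyadic_regulated \<tau> u"
    unfolding dyadic_regulated_def
  proof (intro allI impI)
    fix e :: real assume "0 < e"
    then obtain k where k: "T k < e/2" using T_small[of "e/2"] by auto
    have "norm (u t - u (grid (K + k) t)) \<le> e" if t: "t \<in> {0..\<tau>}" for t
      using uT[OF t, of k] uT[OF grid_mem[OF t, of "K + k"], of k] k step_on_grid_refine[OF Wstep order_refl, of k t]
        norm_triangle_ineq4[of "u t - W k t" "u (grid (K + k) t) - W k t"] by simp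
    then show "\<exists>k. \<forall>t\<in>{0..\<tau>}. norm (u t - u (grid k t)) \<le> e" by blast
  qed
  note uint = dyadic_regulated_integrable[OF ureg]
  define x where "x t = \<eta> + integral {0..t} u" for t
  have xX: "norm (X k t - x t) \<le> T k * \<tau>" if t: "t \<in> {0..\<tau>}" for k t
  proof -
    have ui: "u integrable_on {0..t}" using uint t by (auto intro: integrable_on_subinterval)
    have "norm (X k t - x t) = norm (integral {0..t} (\<lambda>r. u r - W k r))"
      using ui by (simp add: X_def x_def Henstock_Kurzweil_Integration.integral_diff Wint norm_minus_commute)
    also have "\<dots> \<le> T k * (t - 0)"
      using t uT by (intro integral_norm_le integrable_diff ui Wint) auto
    also have "\<dots> \<le> T k * \<tau>" using t A Q by (intro mult_left_mono) (auto simp: T_def)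
    finally show ?thesis .
  qed
  \<comment> \<open>\<open>W (Suc k) t\<close> lies in \<open>F\<close> at a frozen state that tends
    to \<open>x t\<close>, so the Lipschitz property yields points of the closed set
    \<open>F (x t)\<close> at vanishing distance.\<close>
  have uF: "u t \<in> F (x t)" if t: "t \<in> {0..\<tau>}" for t
  proof -
    have "\<exists>b\<in>F (x t). norm (W (Suc k) t - b) \<le> L * (M / 2^k + T k * \<tau>)" for k
    proof -
      define s where "s = grid (K + Suc k) t"
      have s: "0 \<le> s" "s \<le> t" "t - s \<le> 1 / 2^(K + Suc k)"
        using grid_le[of "K + Suc k" t] grid_ge[of t "K + Suc k"] grid_nonneg t by (auto simp: s_def)
      obtain b where b: "b \<in> F (x t)" "norm (W (Suc k) t - b) \<le> L * norm (X k s - x t)"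
        using lipD[OF memF[of k t]] unfolding s_def by blast
      have "(1::real) / 2^(K + Suc k) \<le> 1 / 2^k" by (intro divide_left_mono power_increasing) auto
      then have "M * (t - s) \<le> M * (1 / 2^k)" using s M by (intro mult_left_mono) auto
      then have "norm (X k s - x t) \<le> M / 2^k + T k * \<tau>"
        using XM[OF s(1,2), of k] xX[OF t, of k] norm_triangle_ineq[of "X k s - X k t" "X k t - x t"]
        by (simp add: norm_minus_commute)
      then have "L * norm (X k s - x t) \<le> L * (M / 2^k + T k * \<tau>)" using L by (intro mult_left_mono) auto
      then show ?thesis using b by force
    qed
    then obtain b where b: "\<And>k. b k \<in> F (x t)" "\<And>k. norm (W (Suc k) t - b k) \<le> L * (M / 2^k + T k * \<tau>)"
      by metis
    have "(\<lambda>k. L * (M * (1/2)^k + T k * \<tau>)) \<longlonglongrightarrow> L * (M * 0 + 0 * \<tau>)"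
      by (intro tendsto_intros T0 LIMSEQ_power_zero) auto
    then have "(\<lambda>k. L * (M / 2^k + T k * \<tau>)) \<longlonglongrightarrow> 0" by (simp add: power_divide)
    then have "(\<lambda>k. W (Suc k) t - b k) \<longlonglongrightarrow> 0"
      by (rule Lim_null_comparison[rotated]) (use b in auto)
    then have "(\<lambda>k. W (Suc k) t - (W (Suc k) t - b k)) \<longlonglongrightarrow> u t - 0"
      by (intro tendsto_diff LIMSEQ_Suc lim t)
    then have "b \<longlonglongrightarrow> u t" by simp
    then show ?thesis using closed_sequentially[OF cl] b(1) by blast
  qed
  have "regular_solution F x u \<tau>"
    unfolding regular_solution_def using \<tau> ureg uF by (auto simp: x_def)
  moreover have "x 0 = \<eta>" by (simp add: x_def)
  moreover have "norm (u t - w t) \<le> 4 * (c + 2 * (L * M / 2^K)) * exp (2 * L * \<tau>)" if "t \<in> {0..\<tau>}" for t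
    using uT[OF that, of 0] by (simp add: T_def W0 A_def B_def Q_def)
  ultimately show thesis using that by blast
qed

text \<open>Projection onto a ball does not increase distances, so it makes the Lipschitz bound
  global without changing the map inside the ball. This is how \<open>filippov_global\<close>
  reaches maps that are only locally Lipschitz.\<close>

lemma lipschitz_set_map_on_retract:
  fixes F :: "'a::euclidean_space \<Rightarrow> 'a set"
  assumes F: "lipschitz_set_map_on L (cball 0 R) F" and L: "0 \<le> L" and R: "0 \<le> R"
  shows "lipschitz_set_map_on L UNIV (\<lambda>y. F (closest_point (cball 0 R) y))"
  unfolding lipschitz_set_map_on_def
proof (intro ballI)
  fix y z a assume a: "a \<in> F (closest_point (cball 0 R) y)"
  let ?p = "closest_point (cball (0::'a) R)"
  have mem: "?p y \<in> cball 0 R" for y using R by (intro closest_point_in_set) auto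
  obtain b where b: "b \<in> F (?p z)" "norm (a - b) \<le> L * norm (?p y - ?p z)"
    using F a mem unfolding lipschitz_set_map_on_def by blast
  have "dist (?p y) (?p z) \<le> dist y z" using R by (intro closest_point_lipschitz) auto
  then have "L * norm (?p y - ?p z) \<le> L * norm (y - z)" using L by (intro mult_left_mono) (auto simp: dist_norm)
  then show "\<exists>b\<in>F (?p z). norm (a - b) \<le> L * norm (y - z)" using b by force
qed

lemma locally_Lipschitz_set_map_retract:
  fixes F :: "real^'n \<Rightarrow> (real^'n) set"
  assumes cpt: "\<And>y. compact (F y)" and F: "locally_Lipschitz_set_map F" and R: "0 \<le> R"
    and G: "G = (\<lambda>y. F (closest_point (cball 0 R) y))"
  obtains L M where "0 < L" "0 < M" "lipschitz_set_map_on L UNIV G" "\<And>y a. a \<in> G y \<Longrightarrow> norm a \<le> M"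
proof -
  obtain L where L: "0 < L" "lipschitz_set_map_on L (cball 0 R) F"
    using locally_Lipschitz_set_map_on_cball[OF F] by blast
  obtain M where M: "0 < M" "\<And>y a. y \<in> cball 0 R \<Longrightarrow> a \<in> F y \<Longrightarrow> norm a \<le> M"
    using locally_Lipschitz_set_map_bounded[OF F cpt] by blast
  have "closest_point (cball 0 R) y \<in> cball 0 R" for y :: "real^'n"
    using R by (intro closest_point_in_set) auto
  then have "\<And>y a. a \<in> G y \<Longrightarrow> norm a \<le> M" using M(2) unfolding G by blast
  moreover have "lipschitz_set_map_on L UNIV G"
    unfolding G using L R by (intro lipschitz_set_map_on_retract) auto
  ultimately show thesis using that L(1) M(1) by blast
qed

lemma regular_solution_retract:
  assumes "regular_solution (\<lambda>y. F (closest_point (cball 0 R) y)) x u \<tau>"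
    and "\<And>t. t \<in> {0..\<tau>} \<Longrightarrow> norm (x t) \<le> R"
  shows "regular_solution F x u \<tau>"
  unfolding regular_solution_def
proof (intro conjI ballI)
  note D = regular_solutionD[OF assms(1)]
  show "0 < \<tau>" "dyadic_regulated \<tau> u" using D(1,2) .
  fix t assume t: "t \<in> {0..\<tau>}"
  then show "x t = x 0 + integral {0..t} u" by (intro D(4)) auto
  have "closest_point (cball 0 R) (x t) = x t" using assms(2)[OF t] by (intro closest_point_self) simp
  then show "u t \<in> F (x t)" using D(3)[of t] t by simp
qed

text \<open>Filippov's theorem is applied to the straight line with velocity \<open>v\<close>. Over
  a time \<open>\<tau>\<close> its defect is at most \<open>L * M * \<tau>\<close>, so with a mesh
  not above \<open>\<tau>\<close> the corrected velocity stays within \<open>C * \<tau>\<close> of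
  \<open>v\<close>, and integration gives the second power. The solution depends on
  \<open>\<tau>\<close>; only \<open>C\<close> and \<open>\<tau>0\<close> are uniform.\<close>

lemma regular_solution_from_velocity:
  assumes cpt: "\<And>y. compact (F y)" and ne: "\<And>y. F y \<noteq> {}" and F: "locally_Lipschitz_set_map F"
    and v: "v \<in> F \<xi>"
  shows "\<exists>C \<tau>0. 0 < C \<and> 0 < \<tau>0 \<and> (\<forall>\<tau>. 0 < \<tau> \<longrightarrow> \<tau> \<le> \<tau>0 \<longrightarrow> (\<exists>x u. regular_solution F x u \<tau> \<and> x 0 = \<xi> \<and>
      norm (x \<tau> - \<xi> - \<tau> *\<^sub>R v) \<le> C * \<tau>^2 \<and> (\<forall>t\<in>{0..\<tau>}. norm (x t - \<xi>) \<le> C * \<tau>)))"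
    (is "\<exists>C \<tau>0. _ \<and> _ \<and> (\<forall>\<tau>. _ \<longrightarrow> _ \<longrightarrow> ?P C \<tau>)")
proof -
  define R where "R = norm \<xi> + 1"
  have R: "0 \<le> R" by (simp add: R_def)
  define G where "G = (\<lambda>y. F (closest_point (cball 0 R) y))"
  obtain L M where L: "0 < L" and M: "0 < M" and Glip: "lipschitz_set_map_on L UNIV G"
    and GM: "\<And>y a. a \<in> G y \<Longrightarrow> norm a \<le> M"
    using locally_Lipschitz_set_map_retract[OF cpt F R G_def] by blast
  have G\<xi>: "G \<xi> = F \<xi>" by (simp add: G_def closest_point_self R_def)
  \<comment> \<open>For \<open>\<tau> \<le> 1\<close> the exponential is at most \<open>E\<close>;
    12 is \<open>4 * (1 + 2)\<close>, the defect plus twice the grid error, which is again at most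
    \<open>L * M * \<tau>\<close>. The cap \<open>1 / M\<close> keeps the solution within distance 1
    of \<open>\<xi>\<close>, where \<open>G\<close> agrees with \<open>F\<close>.\<close>
  define E where "E = exp (2 * L)"
  define C where "C = max M (12 * (L * M) * E)"
  define \<tau>0 where "\<tau>0 = min 1 (1 / M)"
  have main: "?P C \<tau>" if \<tau>: "0 < \<tau>" "\<tau> \<le> \<tau>0" for \<tau>
  proof -
    obtain K where "1 / \<tau> < 2^K" using real_arch_pow[of 2 "1/\<tau>"] by auto
    then have K: "1 / 2^K \<le> \<tau>" using \<tau> by (simp add: field_simps)
    have vM: "norm v \<le> M" using v GM[of v \<xi>] by (simp add: G\<xi>)
    have near: "\<exists>a\<in>G (\<xi> + integral {0..grid (Suc K) t} (\<lambda>_. v)). norm (v - a) \<le> L * M * \<tau>"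
      if t: "t \<in> {0..\<tau>}" for t
    proof -
      define s where "s = grid (Suc K) t"
      have s: "0 \<le> s" "s \<le> \<tau>" using grid_mem[OF t, of "Suc K"] by (auto simp: s_def)
      have i: "integral {0..s} (\<lambda>_. v) = s *\<^sub>R v" using s by simp
      obtain a where a: "a \<in> G (\<xi> + s *\<^sub>R v)" "norm (v - a) \<le> L * norm (\<xi> - (\<xi> + s *\<^sub>R v))"
        using Glip v unfolding lipschitz_set_map_on_def G\<xi>[symmetric] by blast
      have "norm (\<xi> - (\<xi> + s *\<^sub>R v)) = s * norm v" using s by simp
      also have "\<dots> \<le> \<tau> * M" using s vM by (intro mult_mono) auto
      finally have "L * norm (\<xi> - (\<xi> + s *\<^sub>R v)) \<le> L * (\<tau> * M)" using L by (intro mult_left_mono) auto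
      then show ?thesis using a unfolding s_def[symmetric] i by (intro bexI[of _ a]) (auto simp: mult_ac)
    qed
    obtain x u where xu: "regular_solution G x u \<tau>" "x 0 = \<xi>"
      "\<And>t. t \<in> {0..\<tau>} \<Longrightarrow> norm (u t - v) \<le> 4 * (L * M * \<tau> + 2 * (L * M / 2^K)) * exp (2 * L * \<tau>)"
    proof (rule filippov_global[of G L M \<tau> K "\<lambda>_. v" "L * M * \<tau>" \<xi>])
      show "closed (G y)" for y unfolding G_def using cpt compact_imp_closed by blast
    qed (use ne GM Glip L M \<tau> vM near in \<open>auto simp: G_def step_on_grid_def\<close>)
    have uv: "norm (u t - v) \<le> C * \<tau>" if t: "t \<in> {0..\<tau>}" for t
    proof -
      have "L * M / 2^K \<le> L * M * \<tau>" using K L M mult_left_mono[OF K, of "L * M"] by simp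
      moreover have "exp (2 * L * \<tau>) \<le> E" using \<tau> L by (simp add: E_def \<tau>0_def)
      ultimately have "4 * (L * M * \<tau> + 2 * (L * M / 2^K)) * exp (2 * L * \<tau>) \<le> 4 * (3 * (L * M * \<tau>)) * E"
        using L M \<tau> by (intro mult_mono) auto
      also have "\<dots> = 12 * (L * M) * E * \<tau>" by (simp add: mult_ac)
      also have "\<dots> \<le> C * \<tau>" using \<tau> by (intro mult_right_mono) (auto simp: C_def)
      finally show ?thesis using xu(3)[OF t] by linarith
    qed
    have uM: "norm (u t) \<le> M" if "t \<in> {0..\<tau>}" for t
      using regular_solutionD(3)[OF xu(1), of t] that GM by auto
    have x\<xi>: "norm (x t - \<xi>) \<le> M * \<tau>" if t: "t \<in> {0..\<tau>}" for t
    proof -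
      have "norm (x t - x 0) \<le> M * (t - 0)" using t by (intro regular_solution_lipschitz[OF xu(1) uM]) auto
      also have "\<dots> \<le> M * \<tau>" using t M by simp
      finally show ?thesis using xu(2) by simp
    qed
    have "M * \<tau> \<le> 1" using \<tau> M by (simp add: \<tau>0_def field_simps)
    then have "norm (x t) \<le> R" if "t \<in> {0..\<tau>}" for t
      using x\<xi>[OF that] norm_triangle_ineq[of "x t - \<xi>" \<xi>] by (simp add: R_def)
    then have "regular_solution F x u \<tau>" by (rule regular_solution_retract[OF xu(1)[unfolded G_def]])
    moreover have "norm (x \<tau> - \<xi> - \<tau> *\<^sub>R v) \<le> C * \<tau>^2"
    proof -
      have ui: "u integrable_on {0..\<tau>}" by (rule dyadic_regulated_integrable[OF regular_solutionD(2)[OF xu(1)]])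
      have "x \<tau> = \<xi> + integral {0..\<tau>} u" using regular_solutionD(4)[OF xu(1), of \<tau>] \<tau> xu(2) by simp
      then have "x \<tau> - \<xi> - \<tau> *\<^sub>R v = integral {0..\<tau>} (\<lambda>t. u t - v)"
        using \<tau> Henstock_Kurzweil_Integration.integral_diff[OF ui integrable_const_ivl[of v 0 \<tau>]] by simp
      also have "norm \<dots> \<le> C * \<tau> * (\<tau> - 0)"
        using \<tau> uv by (intro integral_norm_le integrable_diff ui) auto
      finally show ?thesis by (simp add: power2_eq_square mult.assoc)
    qed
    moreover have "norm (x t - \<xi>) \<le> C * \<tau>" if "t \<in> {0..\<tau>}" for t
    proof -
      have "M * \<tau> \<le> C * \<tau>" using \<tau> by (intro mult_right_mono) (auto simp: C_def)
      then show ?thesis using x\<xi>[OF that] by simp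
    qed
    ultimately show ?thesis using xu(2) by blast
  qed
  have "0 < \<tau>0" "0 < C" using M by (auto simp: \<tau>0_def C_def)
  then show ?thesis using main by (intro exI[of _ C] exI[of _ \<tau>0] conjI allI impI)
qed

text \<open>Sampling \<open>w\<close> on a fine grid gives a step velocity lying in \<open>F\<close>
  at the sampled states of \<open>x\<close>. Started at a nearby \<open>\<eta>\<close> it has a
  small defect, and Filippov's theorem corrects it to a solution from \<open>\<eta>\<close> on the
  same interval.\<close>

lemma regular_solution_stable:
  assumes cpt: "\<And>y. compact (F y)" and ne: "\<And>y. F y \<noteq> {}" and F: "locally_Lipschitz_set_map F"
    and x: "regular_solution F x w \<tau>" and e: "0 < e"
  shows "\<exists>\<delta>>0. \<forall>\<eta>. norm (\<eta> - x 0) < \<delta> \<longrightarrow>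
    (\<exists>z u. regular_solution F z u \<tau> \<and> z 0 = \<eta> \<and> (\<forall>t\<in>{0..\<tau>}. norm (z t - x t) \<le> e))"
    (is "\<exists>\<delta>>0. \<forall>\<eta>. _ \<longrightarrow> ?P \<eta>")
proof -
  note xD = regular_solutionD[OF x]
  have \<tau>: "0 < \<tau>" by (rule xD)
  obtain B where B: "\<And>t. t \<in> {0..\<tau>} \<Longrightarrow> norm (w t) \<le> B" using dyadic_regulated_bounded[OF xD(2)] by blast
  \<comment> \<open>The extra 1 leaves room for the solution from \<open>\<eta>\<close>, which stays
    within \<open>min e 1\<close> of \<open>x\<close>.\<close>
  define R where "R = norm (x 0) + \<bar>B\<bar> * \<tau> + 1"
  have xR: "norm (x t) \<le> R - 1" if t: "t \<in> {0..\<tau>}" for t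
  proof -
    have "norm (x t - x 0) \<le> B * (t - 0)" using t B by (intro regular_solution_lipschitz[OF x]) auto
    also have "\<dots> \<le> \<bar>B\<bar> * \<tau>" using t by (intro mult_mono) auto
    finally show ?thesis using norm_triangle_ineq[of "x t - x 0" "x 0"] by (simp add: R_def)
  qed
  have R: "0 \<le> R" using \<tau> by (simp add: R_def)
  define G where "G = (\<lambda>y. F (closest_point (cball 0 R) y))"
  obtain L M where L: "0 < L" and M: "0 < M" and Glip: "lipschitz_set_map_on L UNIV G"
    and GM: "\<And>y a. a \<in> G y \<Longrightarrow> norm a \<le> M"
    using locally_Lipschitz_set_map_retract[OF cpt F R G_def] by blast
  have Gx: "G (x t) = F (x t)" if "t \<in> {0..\<tau>}" for t
    using xR[OF that] by (simp add: G_def closest_point_self)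
  have wM: "norm (w t) \<le> M" if "t \<in> {0..\<tau>}" for t
    using xD(3)[of t] that GM[of "w t" "x t"] Gx[OF that] by simp
  \<comment> \<open>The final distance is at most \<open>Q * (5 * q) + 2 * q\<close>: the 5 is 3
    from the defect and 2 from twice the grid error, and the uncorrected curve is
    \<open>2 * q\<close> away from \<open>x\<close>. The choice of \<open>q\<close> makes the sum
    equal to \<open>min e 1\<close>.\<close>
  define Q where "Q = 4 * \<tau> * exp (2 * L * \<tau>) * L"
  define q where "q = min e 1 / (5 * Q + 2)"
  have Q: "0 \<le> Q" using L \<tau> by (simp add: Q_def)
  have "Q * (5 * q) + 2 * q = (5 * Q + 2) * q" by (simp add: algebra_simps)
  also have "\<dots> = min e 1" using Q by (simp add: q_def)
  finally have q: "0 < q" "Q * (5 * q) + 2 * q \<le> e" "Q * (5 * q) + 2 * q \<le> 1" using e Q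
    by (auto simp: q_def)
  obtain k where k: "\<forall>j\<ge>k. \<forall>t\<in>{0..\<tau>}. norm (w t - w (grid j t)) \<le> q / \<tau>"
    using dyadic_regulatedD[OF xD(2), of "q/\<tau>"] q \<tau> by auto
  obtain l where "M / q < 2^l" using real_arch_pow[of 2 "M/q"] by auto
  define K where "K = max k l"
  have K: "M / 2^K \<le> q"
  proof -
    have "(2::real)^l \<le> 2^K" by (intro power_increasing) (auto simp: K_def)
    then have "M / q < 2^K" using \<open>M / q < 2^l\<close> by linarith
    then show ?thesis using q by (simp add: field_simps)
  qed
  \<comment> \<open>The value 0 off the interval keeps the bound \<open>M\<close> at all times, as
    \<open>filippov_global\<close> requires.\<close>
  define v where "v t = (if grid K t \<in> {0..\<tau>} then w (grid K t) else 0)" for t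
  have v: "v t = w (grid K t)" if "t \<in> {0..\<tau>}" for t using grid_mem[OF that] by (simp add: v_def)
  have vstep: "step_on_grid K v" by (simp add: step_on_grid_def v_def grid_grid)
  have vM: "norm (v t) \<le> M" for t using wM M by (simp add: v_def)
  have wi: "w integrable_on {0..\<tau>}" by (rule dyadic_regulated_integrable[OF xD(2)])
  have vx: "norm (\<eta> + integral {0..t} v - x t) \<le> 2 * q" if \<eta>: "norm (\<eta> - x 0) < q" and t: "t \<in> {0..\<tau>}" for \<eta> t
  proof -
    have wi': "w integrable_on {0..t}" using wi t by (auto intro: integrable_on_subinterval)
    have "norm (v r - w r) \<le> q / \<tau>" if r: "r \<in> {0..t}" for r
    proof -
      have r': "r \<in> {0..\<tau>}" using r t by auto
      have "norm (w r - w (grid K r)) \<le> q / \<tau>" using k r' by (auto simp: K_def)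
      then show ?thesis by (simp add: v[OF r'] norm_minus_commute)
    qed
    then have "norm (integral {0..t} (\<lambda>r. v r - w r)) \<le> q / \<tau> * (t - 0)"
      using t by (intro integral_norm_le integrable_diff wi' step_on_grid_integrable[OF vstep]) auto
    also have "\<dots> \<le> q / \<tau> * \<tau>" using t q \<tau> by (intro mult_left_mono) auto
    finally have "norm (integral {0..t} v - integral {0..t} w) \<le> q"
      using \<tau> by (simp add: Henstock_Kurzweil_Integration.integral_diff wi' step_on_grid_integrable[OF vstep])
    moreover have "x t = x 0 + integral {0..t} w" using t by (intro xD(4)) auto
    then have eq: "\<eta> + integral {0..t} v - x t = (\<eta> - x 0) + (integral {0..t} v - integral {0..t} w)" by simp
    ultimately show ?thesis unfolding eq
      using \<eta> norm_triangle_ineq[of "\<eta> - x 0" "integral {0..t} v - integral {0..t} w"] by linarith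
  qed
  have main: "?P \<eta>" if \<eta>: "norm (\<eta> - x 0) < q" for \<eta>
  proof -
    have near: "\<exists>a\<in>G (\<eta> + integral {0..grid (Suc K) t} v). norm (v t - a) \<le> L * (3 * q)"
      if t: "t \<in> {0..\<tau>}" for t
    proof -
      define g where "g = grid K t"
      define s where "s = grid (Suc K) t"
      have gs: "g \<in> {0..\<tau>}" "s \<in> {0..\<tau>}" using grid_mem[OF t] by (auto simp: g_def s_def)
      have "g = grid K s" by (simp add: g_def s_def grid_grid)
      then have "g \<le> s" "s - g \<le> 1 / 2^K" using grid_le[of K s] grid_ge[of s K] by auto
      then have "norm (x s - x g) \<le> M * (s - g)" using gs wM by (intro regular_solution_lipschitz[OF x]) auto
      also have "\<dots> \<le> M * (1 / 2^K)" using M \<open>s - g \<le> 1 / 2^K\<close> by (intro mult_left_mono) auto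
      finally have "norm (x s - x g) \<le> q" using K by simp
      then have "norm (x g - (\<eta> + integral {0..s} v)) \<le> q + 2 * q"
        using vx[OF \<eta> gs(2)] by (intro norm_diff_triangle_le[of "x g" "x s" q]) (simp_all add: norm_minus_commute)
      then have "norm (x g - (\<eta> + integral {0..s} v)) \<le> 3 * q" by simp
      then have le: "L * norm (x g - (\<eta> + integral {0..s} v)) \<le> L * (3 * q)" using L by (intro mult_left_mono) auto
      have "v t \<in> G (x g)" using xD(3)[of g] gs Gx[OF gs(1)] v[OF t] by (simp add: g_def)
      then obtain a where "a \<in> G (\<eta> + integral {0..s} v)" "norm (v t - a) \<le> L * norm (x g - (\<eta> + integral {0..s} v))"
        using Glip unfolding lipschitz_set_map_on_def by blast
      then show ?thesis using le unfolding s_def by force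
    qed
    obtain z u where zu: "regular_solution G z u \<tau>" "z 0 = \<eta>"
      "\<And>t. t \<in> {0..\<tau>} \<Longrightarrow> norm (u t - v t) \<le> 4 * (L * (3 * q) + 2 * (L * M / 2^K)) * exp (2 * L * \<tau>)"
    proof (rule filippov_global[of G L M \<tau> K v "L * (3 * q)" \<eta>])
      show "closed (G y)" for y unfolding G_def using cpt compact_imp_closed by blast
      show "0 \<le> L * (3 * q)" using L q by simp
      show "G y \<noteq> {}" for y using ne by (simp add: G_def)
    qed (use GM Glip L M \<tau> vM near vstep in blast)+
    have "L * M / 2^K \<le> L * q" using mult_left_mono[OF K, of L] L by simp
    then have "4 * (L * (3 * q) + 2 * (L * M / 2^K)) * exp (2 * L * \<tau>) \<le> 4 * (L * (5 * q)) * exp (2 * L * \<tau>)"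
      by (intro mult_right_mono) auto
    also have "\<dots> = Q * (5 * q) / \<tau>" using \<tau> by (simp add: Q_def)
    finally have uv: "norm (u t - v t) \<le> Q * (5 * q) / \<tau>" if "t \<in> {0..\<tau>}" for t using zu(3)[OF that] by linarith
    have ui: "u integrable_on {0..\<tau>}" by (rule dyadic_regulated_integrable[OF regular_solutionD(2)[OF zu(1)]])
    have zx: "norm (z t - x t) \<le> Q * (5 * q) + 2 * q" if t: "t \<in> {0..\<tau>}" for t
    proof -
      have ui': "u integrable_on {0..t}" using ui t by (auto intro: integrable_on_subinterval)
      have "norm (integral {0..t} (\<lambda>r. u r - v r)) \<le> Q * (5 * q) / \<tau> * (t - 0)"
        using t uv by (intro integral_norm_le integrable_diff ui' step_on_grid_integrable[OF vstep]) auto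
      also have "\<dots> \<le> Q * (5 * q) / \<tau> * \<tau>" using t q Q \<tau> by (intro mult_left_mono) auto
      finally have "norm (integral {0..t} u - integral {0..t} v) \<le> Q * (5 * q)"
        using \<tau> by (simp add: Henstock_Kurzweil_Integration.integral_diff ui' step_on_grid_integrable[OF vstep])
      moreover have "z t = \<eta> + integral {0..t} u" using regular_solutionD(4)[OF zu(1), of t] t zu(2) by simp
      then have eq: "z t - x t = (integral {0..t} u - integral {0..t} v) + (\<eta> + integral {0..t} v - x t)" by simp
      ultimately show ?thesis unfolding eq
        using vx[OF \<eta> t] norm_triangle_ineq[of "integral {0..t} u - integral {0..t} v" "\<eta> + integral {0..t} v - x t"]
        by linarith
    qed
    have "norm (z t) \<le> R" if "t \<in> {0..\<tau>}" for t
      using zx[OF that] xR[OF that] q(3) norm_triangle_ineq[of "z t - x t" "x t"] by simp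
    then have "regular_solution F z u \<tau>" by (rule regular_solution_retract[OF zu(1)[unfolded G_def]])
    moreover have "\<forall>t\<in>{0..\<tau>}. norm (z t - x t) \<le> e" using zx q(2) by force
    ultimately show ?thesis using zu(2) by blast
  qed
  show ?thesis using q(1) main by (intro exI[of _ q] conjI allI impI)
qed


lemma regular_solution_exists:
  assumes cpt: "\<And>y. compact (F y)" and ne: "\<And>y. F y \<noteq> {}" and F: "locally_Lipschitz_set_map F"
  shows "\<exists>x u \<tau>. regular_solution F x u \<tau> \<and> x 0 = \<xi>"
proof -
  obtain v where "v \<in> F \<xi>" using ne by blast
  from regular_solution_from_velocity[OF cpt ne F this] show ?thesis by (meson order_refl)
qed

section \<open>Viscosity subdifferentials and inf-convolution\<close>

lemma viscosity_subdifferential_iff: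
  "\<zeta> \<in> viscosity_subdifferential V \<xi> \<longleftrightarrow>
     (\<forall>e>0. \<exists>d>0. \<forall>k. norm k < d \<longrightarrow> - (e * norm k) \<le> V (\<xi> + k) - V \<xi> - \<zeta> \<bullet> k)"
  (is "_ \<longleftrightarrow> ?R")
proof
  assume "\<zeta> \<in> viscosity_subdifferential V \<xi>"
  then obtain r N where r: "((\<lambda>k. r k / norm k) \<longlongrightarrow> 0) (at 0)" and N: "open N" "0 \<in> N"
    and le: "\<And>k. k \<in> N \<Longrightarrow> r k \<le> V (\<xi> + k) - V \<xi> - \<zeta> \<bullet> k"
    unfolding viscosity_subdifferential_def by blast
  show ?R
  proof (intro allI impI)
    fix e :: real assume e: "0 < e"
    have "\<forall>\<^sub>F k in at 0. - e < r k / norm k" using order_tendstoD(1)[OF r, of "-e"] e by simp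
    then obtain d1 where d1: "0 < d1" "\<And>k. k \<noteq> 0 \<Longrightarrow> norm k < d1 \<Longrightarrow> - e < r k / norm k"
      unfolding eventually_at by (auto simp: dist_norm)
    obtain d2 where d2: "0 < d2" "ball 0 d2 \<subseteq> N" using N open_contains_ball by blast
    have "- (e * norm k) \<le> V (\<xi> + k) - V \<xi> - \<zeta> \<bullet> k" if k: "norm k < min d1 d2" for k
    proof (cases "k = 0")
      case False
      then have "- e * norm k < r k" using d1(2)[of k] k by (simp add: pos_less_divide_eq)
      moreover have "k \<in> N" using d2 k by auto
      ultimately show ?thesis using le[of k] by simp
    qed simp
    then show "\<exists>d>0. \<forall>k. norm k < d \<longrightarrow> - (e * norm k) \<le> V (\<xi> + k) - V \<xi> - \<zeta> \<bullet> k"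
      using d1(1) d2(1) by (intro exI[of _ "min d1 d2"]) auto
  qed
next
  assume R: ?R
  \<comment> \<open>Cutting the defect at 0 gives a remainder below the defect everywhere, whose
    size the one-sided estimate controls.\<close>
  define r where "r k = min 0 (V (\<xi> + k) - V \<xi> - \<zeta> \<bullet> k)" for k
  have "((\<lambda>k. r k / norm k) \<longlongrightarrow> 0) (at 0)"
  proof (rule tendstoI)
    fix e :: real assume e: "0 < e"
    then obtain d where d: "0 < d" "\<And>k. norm k < d \<Longrightarrow> - (e/2 * norm k) \<le> V (\<xi> + k) - V \<xi> - \<zeta> \<bullet> k"
      using R by (meson half_gt_zero)
    have "dist (r k / norm k) 0 < e" if "k \<noteq> 0" "norm k < d" for k
    proof -
      have "\<bar>r k\<bar> \<le> e/2 * norm k" using d(2)[OF that(2)] e by (auto simp: r_def min_def)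
      also have "\<dots> < e * norm k" using e that by simp
      finally show ?thesis using that by (simp add: pos_divide_less_eq)
    qed
    then show "\<forall>\<^sub>F k in at 0. dist (r k / norm k) 0 < e"
      unfolding eventually_at using d(1) by (intro exI[of _ d]) (auto simp: dist_norm)
  qed
  then show "\<zeta> \<in> viscosity_subdifferential V \<xi>"
    unfolding viscosity_subdifferential_def
    by (intro CollectI exI[of _ r] conjI exI[of _ UNIV]) (auto simp: r_def)
qed

lemma proximal_subgradient:
  assumes p: "0 \<le> p" and le: "\<And>k. V \<xi> + \<zeta> \<bullet> k - p * (norm k)^2 \<le> V (\<xi> + k)"
  shows "\<zeta> \<in> viscosity_subdifferential V \<xi>"
  unfolding viscosity_subdifferential_iff
proof (intro allI impI)
  fix e :: real assume e: "0 < e"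
  have "- (e * norm k) \<le> V (\<xi> + k) - V \<xi> - \<zeta> \<bullet> k" if "norm k < e / (p + 1)" for k
  proof -
    have "norm k * (p + 1) \<le> e" using that p by (simp add: pos_less_divide_eq)
    then have "p * norm k \<le> e" using norm_ge_zero[of k] by (simp only: distrib_left mult.commute)
    then have "(p * norm k) * norm k \<le> e * norm k" by (intro mult_right_mono) auto
    then show ?thesis using le[of k] by (simp add: power2_eq_square mult.assoc)
  qed
  then show "\<exists>d>0. \<forall>k. norm k < d \<longrightarrow> - (e * norm k) \<le> V (\<xi> + k) - V \<xi> - \<zeta> \<bullet> k"
    using e p by (intro exI[of _ "e / (p + 1)"]) auto
qed

section \<open>Lower semicontinuous functions and their inf-convolutions\<close>

lemma lower_semicontinuous_add:
  fixes V f :: "'a::t2_space \<Rightarrow> real"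
  assumes V: "lower_semicontinuous V" and f: "continuous_on UNIV f"
  shows "lower_semicontinuous (\<lambda>\<xi>. V \<xi> + f \<xi>)"
  unfolding lower_semicontinuous_def
proof (intro allI impI)
  fix \<xi> a assume "a < V \<xi> + f \<xi>"
  define d where "d = (V \<xi> + f \<xi> - a) / 2"
  have d: "d = (V \<xi> + f \<xi> - a) / 2" "0 < d" using \<open>a < V \<xi> + f \<xi>\<close> by (simp_all add: d_def)
  have "\<forall>\<^sub>F \<eta> in nhds \<xi>. V \<xi> - d < V \<eta>" using V d(2) by (simp add: lower_semicontinuous_def)
  moreover have "(f \<longlongrightarrow> f \<xi>) (nhds \<xi>)"
  proof -
    have "isCont f \<xi>" using f by (simp add: continuous_on_eq_continuous_at)
    then show ?thesis unfolding isCont_def tendsto_at_iff_tendsto_nhds .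
  qed
  then have "\<forall>\<^sub>F \<eta> in nhds \<xi>. f \<xi> - d < f \<eta>" using d(2) by (intro order_tendstoD(1)) auto
  ultimately show "\<forall>\<^sub>F \<eta> in nhds \<xi>. a < V \<eta> + f \<eta>"
  proof eventually_elim
    case (elim \<eta>)
    have "a = V \<xi> + f \<xi> - 2 * d" using d(1) by simp
    then show ?case using elim by linarith
  qed
qed

text \<open>If every point of \<open>S\<close> were beaten by another one, semicontinuity would give
  each a neighbourhood beaten as a whole. Of the finitely many competitors belonging to a subcover,
  the best would then be beaten by another of them.\<close>

lemma lower_semicontinuous_attains_inf:
  assumes V: "lower_semicontinuous V" and S: "compact S" "S \<noteq> {}"
  shows "\<exists>s\<in>S. \<forall>t\<in>S. V s \<le> V t"
proof (rule ccontr)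
  assume "\<not> ?thesis"
  then have "\<forall>s. \<exists>t. s \<in> S \<longrightarrow> t \<in> S \<and> V t < V s" by (meson not_le)
  then obtain t where t: "\<And>s. s \<in> S \<Longrightarrow> t s \<in> S \<and> V (t s) < V s" by metis
  have "\<exists>U. s \<in> S \<longrightarrow> open U \<and> s \<in> U \<and> (\<forall>\<eta>\<in>U. V (t s) < V \<eta>)" for s
    using V t[of s] unfolding lower_semicontinuous_def eventually_nhds by blast
  then obtain U where U: "\<And>s. s \<in> S \<Longrightarrow> open (U s) \<and> s \<in> U s \<and> (\<forall>\<eta>\<in>U s. V (t s) < V \<eta>)" by metis
  have "S \<subseteq> (\<Union>s\<in>S. U s)" using U by blast
  then obtain C where C: "C \<subseteq> S" "finite C" "S \<subseteq> (\<Union>s\<in>C. U s)"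
    by (rule compactE_image[OF S(1), rotated]) (use U in auto)
  have "C \<noteq> {}" using C(3) S(2) by auto
  define m where "m = Min ((\<lambda>s. V (t s)) ` C)"
  have "m \<in> (\<lambda>s. V (t s)) ` C" unfolding m_def using C(2) \<open>C \<noteq> {}\<close> by (intro Min_in) auto
  then obtain c where c: "c \<in> C" "V (t c) = m" by auto
  have "t c \<in> S" using t c C by blast
  then obtain c' where c': "c' \<in> C" "t c \<in> U c'" using C(3) by blast
  then have "V (t c') < V (t c)" using U C(1) by blast
  moreover have "m \<le> V (t c')" unfolding m_def using C(2) c'(1) by (intro Min_le) auto
  ultimately show False using c(2) by simp
qed

text \<open>The Moreau envelope of \<open>V\<close>. The quadratic penalty makes it semiconcave, and
  its minimizers provide proximal subgradients of \<open>V\<close>.\<close>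

definition inf_convolution :: "real \<Rightarrow> ('a::real_normed_vector \<Rightarrow> real) \<Rightarrow> 'a \<Rightarrow> real" where
  "inf_convolution p V \<xi> = (INF \<eta>. V \<eta> + p * (norm (\<xi> - \<eta>))^2)"

lemma inf_convolution_le:
  assumes "\<And>\<eta>. 0 \<le> V \<eta>" "0 \<le> p"
  shows "inf_convolution p V \<xi> \<le> V \<eta> + p * (norm (\<xi> - \<eta>))^2"
  unfolding inf_convolution_def by (rule cINF_lower) (use assms in \<open>auto intro!: bdd_belowI2[of _ 0]\<close>)

lemma inf_convolution_ge:
  assumes "\<And>\<eta>. a \<le> V \<eta> + p * (norm (\<xi> - \<eta>))^2"
  shows "a \<le> inf_convolution p V \<xi>"
  unfolding inf_convolution_def by (rule cINF_greatest) (use assms in auto)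

lemma inf_convolution_attained:
  fixes V :: "'a::euclidean_space \<Rightarrow> real"
  assumes nn: "\<And>\<eta>. 0 \<le> V \<eta>" and V: "lower_semicontinuous V" and p: "0 < p"
  obtains \<eta> where "inf_convolution p V \<xi> = V \<eta> + p * (norm (\<xi> - \<eta>))^2"
proof -
  define g where "g \<eta> = V \<eta> + p * (norm (\<xi> - \<eta>))^2" for \<eta>
  \<comment> \<open>Beyond this radius the penalty alone is at least \<open>V \<xi>\<close>, the
    value of the competitor \<open>\<xi>\<close>, so a compact ball decides the infimum.\<close>
  define r where "r = sqrt (V \<xi> / p)"
  have r: "0 \<le> r" "p * r^2 = V \<xi>" using nn p by (simp_all add: r_def)
  have "lower_semicontinuous g" unfolding g_def
    by (intro lower_semicontinuous_add V continuous_intros)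
  then obtain \<eta> where \<eta>: "\<eta> \<in> cball \<xi> r" "\<And>t. t \<in> cball \<xi> r \<Longrightarrow> g \<eta> \<le> g t"
    using lower_semicontinuous_attains_inf[of g "cball \<xi> r"] r by auto
  have "g \<eta> \<le> g t" for t
  proof (cases "t \<in> cball \<xi> r")
    case False
    then have "r < norm (\<xi> - t)" by (simp add: dist_norm)
    then have "r^2 \<le> (norm (\<xi> - t))^2" using r by (intro power_mono) auto
    then have "V \<xi> \<le> p * (norm (\<xi> - t))^2" using r(2) p by (metis mult_le_cancel_left_pos)
    moreover have "g \<eta> \<le> V \<xi>" using \<eta>(2)[of \<xi>] r by (simp add: g_def)
    ultimately show ?thesis using nn[of t] by (simp add: g_def)
  qed (use \<eta> in auto)
  then have "g \<eta> \<le> inf_convolution p V \<xi>" by (intro inf_convolution_ge) (auto simp: g_def)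
  moreover have "inf_convolution p V \<xi> \<le> g \<eta>" unfolding g_def using nn p by (intro inf_convolution_le) auto
  ultimately show thesis using that by (simp add: g_def)
qed

text \<open>The upper bound holds as \<open>\<xi>\<close> competes. For the lower one, competitors
  within \<open>d\<close> have \<open>V > a'\<close> by semicontinuity, and the others pay at least
  \<open>p * d^2\<close>.\<close>

lemma inf_convolution_tendsto:
  fixes V :: "'a::real_normed_vector \<Rightarrow> real"
  assumes nn: "\<And>\<eta>. 0 \<le> V \<eta>" and V: "lower_semicontinuous V" and p: "filterlim p at_top G"
  shows "((\<lambda>n. inf_convolution (p n) V \<xi>) \<longlongrightarrow> V \<xi>) G"
proof (rule order_tendstoI)
  note pos = p[unfolded filterlim_at_top_dense, rule_format, of 0]
  fix a assume a: "V \<xi> < a"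
  show "\<forall>\<^sub>F n in G. inf_convolution (p n) V \<xi> < a" using pos
  proof eventually_elim
    case (elim n)
    then show ?case using inf_convolution_le[of V "p n" \<xi> \<xi>] nn a by simp
  qed
next
  note pos = p[unfolded filterlim_at_top_dense, rule_format, of 0]
  fix a assume "a < V \<xi>"
  then obtain a' where a': "a < a'" "a' < V \<xi>" using dense by blast
  have "\<forall>\<^sub>F \<eta> in nhds \<xi>. a' < V \<eta>" using V a'(2) by (simp add: lower_semicontinuous_def)
  then obtain U where U: "open U" "\<xi> \<in> U" "\<And>\<eta>. \<eta> \<in> U \<Longrightarrow> a' < V \<eta>"
    by (auto simp: eventually_nhds)
  then obtain d where d: "0 < d" "ball \<xi> d \<subseteq> U" using open_contains_ball by blast
  have "\<forall>\<^sub>F n in G. a' / d^2 < p n" using p by (simp add: filterlim_at_top_dense)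
  then show "\<forall>\<^sub>F n in G. a < inf_convolution (p n) V \<xi>" using pos
  proof eventually_elim
    case (elim n)
    have "a' \<le> inf_convolution (p n) V \<xi>"
    proof (rule inf_convolution_ge)
      fix \<eta>
      show "a' \<le> V \<eta> + p n * (norm (\<xi> - \<eta>))^2"
      proof (cases "\<eta> \<in> ball \<xi> d")
        case True
        then have "a' < V \<eta>" using d U by blast
        moreover have "0 \<le> p n * (norm (\<xi> - \<eta>))^2" using elim by simp
        ultimately show ?thesis by linarith
      next
        case False
        then have "d^2 \<le> (norm (\<xi> - \<eta>))^2" using d(1) by (intro power_mono) (auto simp: dist_norm)
        then have "p n * d^2 \<le> p n * (norm (\<xi> - \<eta>))^2" using elim by (intro mult_left_mono) auto
        moreover have "a' < p n * d^2" using elim(1) d(1) by (simp add: pos_divide_less_eq)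
        ultimately show ?thesis using nn[of \<eta>] by linarith
      qed
    qed
    then show ?case using a' by simp
  qed
qed

text \<open>A chain rule for subgradients of a discontinuous function. Where
  \<open>V \<xi> > 0\<close>, division by \<open>\<rho>' (V \<xi>)\<close> turns a subgradient of
  the composition into one of \<open>V\<close>. Where \<open>V \<xi> = 0\<close>, no derivative of
  \<open>\<rho>\<close> is given, but \<open>\<rho> r \<le> r\<close> on \<open>[0,1]\<close> makes
  the same vector a subgradient of \<open>V\<close>, and both rates are 0 there.\<close>

lemma decay_rate_rescale:
  assumes dec: "decays_with_rate F E V \<alpha>" and \<alpha>0: "\<alpha> 0 = 0" and nn: "\<And>\<xi>. 0 \<le> V \<xi>"
    and K: "class_K_inf \<rho>" and der: "\<And>r. 0 < r \<Longrightarrow> (\<rho> has_real_derivative \<rho>' r) (at r)"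
    and pos: "\<And>r. 0 < r \<Longrightarrow> 0 < \<rho>' r" and rate: "\<And>r. 0 < r \<Longrightarrow> \<rho> r \<le> \<rho>' r * \<alpha> r"
    and small: "\<And>r. 0 \<le> r \<Longrightarrow> r \<le> 1 \<Longrightarrow> \<rho> r \<le> r"
  shows "decays_with_rate F E (\<lambda>\<xi>. \<rho> (V \<xi>)) (\<lambda>r. r)"
  unfolding decays_with_rate_def
proof (intro ballI)
  fix \<xi> \<zeta> v assume \<xi>: "\<xi> \<in> E" and \<zeta>: "\<zeta> \<in> viscosity_subdifferential (\<lambda>\<xi>. \<rho> (V \<xi>)) \<xi>" and v: "v \<in> F \<xi>"
  have cK: "class_K \<rho>" using K by (simp add: class_K_inf_def)
  have \<rho>0: "\<rho> 0 = 0" using cK by (simp add: class_K_def)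
  note dec' = dec[unfolded decays_with_rate_def, rule_format, OF \<xi> _ v]
  show "\<zeta> \<bullet> v \<le> - \<rho> (V \<xi>)"
  proof (cases "V \<xi> = 0")
    case True
    have "\<zeta> \<in> viscosity_subdifferential V \<xi>"
      unfolding viscosity_subdifferential_iff
    proof (intro allI impI)
      fix e :: real assume e: "0 < e"
      then obtain d where d: "0 < d" "\<And>k. norm k < d \<Longrightarrow> - (e * norm k) \<le> \<rho> (V (\<xi> + k)) - \<rho> (V \<xi>) - \<zeta> \<bullet> k"
        using \<zeta> unfolding viscosity_subdifferential_iff by blast
      \<comment> \<open>This radius gives \<open>\<zeta> \<bullet> k \<le> 1\<close>, which settles
        the points where \<open>V\<close> exceeds 1; at the others \<open>small\<close>
        applies.\<close>
      have "- (e * norm k) \<le> V (\<xi> + k) - V \<xi> - \<zeta> \<bullet> k" if k: "norm k < min d (1 / (norm \<zeta> + 1))" for k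
      proof (cases "V (\<xi> + k) \<le> 1")
        case le1: True
        then show ?thesis using d(2)[of k] k small[OF nn le1] True \<rho>0 by simp
      next
        case False
        have "\<zeta> \<bullet> k \<le> norm \<zeta> * norm k" by (rule norm_cauchy_schwarz)
        also have "\<dots> \<le> (norm \<zeta> + 1) * (1 / (norm \<zeta> + 1))" using k by (intro mult_mono) auto
        also have "\<dots> = 1" using norm_ge_zero[of \<zeta>] by (simp add: add_nonneg_eq_0_iff)
        finally show ?thesis using False True e norm_ge_zero[of k] mult_nonneg_nonneg[of e "norm k"] by linarith
      qed
      moreover have "0 < min d (1 / (norm \<zeta> + 1))" using d(1) norm_ge_zero[of \<zeta>] by (simp add: add_nonneg_pos)
      ultimately show "\<exists>d>0. \<forall>k. norm k < d \<longrightarrow> - (e * norm k) \<le> V (\<xi> + k) - V \<xi> - \<zeta> \<bullet> k" by blast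
    qed
    then show ?thesis using dec' True \<alpha>0 \<rho>0 by simp
  next
    case False
    define r where "r = V \<xi>"
    have r: "0 < r" using False nn[of \<xi>] by (simp add: r_def)
    define D where "D = \<rho>' r"
    have D: "0 < D" using pos[OF r] by (simp add: D_def)
    have "\<zeta> /\<^sub>R D \<in> viscosity_subdifferential V \<xi>"
      unfolding viscosity_subdifferential_iff
    proof (intro allI impI)
      fix e :: real assume e: "0 < e"
      define B where "B = norm \<zeta> / D + e"
      have B: "0 < B" using D e by (simp add: B_def add_nonneg_pos)
      define e' where "e' = D * e / (4 * B)"
      have e': "0 < e'" using D e B by (simp add: e'_def)
      obtain s where s: "0 < s" "\<And>q. norm (q - r) < s \<Longrightarrow> norm (\<rho> q - \<rho> r - D * (q - r)) \<le> e' * norm (q - r)"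
        using der[OF r] e' unfolding has_field_derivative_def has_derivative_at_alt D_def by blast
      have De: "0 < D * e / 4" using D e by simp
      obtain d where d: "0 < d" "\<And>k. norm k < d \<Longrightarrow> - (D * e / 4 * norm k) \<le> \<rho> (V (\<xi> + k)) - \<rho> (V \<xi>) - \<zeta> \<bullet> k"
        using \<zeta> De unfolding viscosity_subdifferential_iff by blast
      have "- (e * norm k) \<le> V (\<xi> + k) - V \<xi> - (\<zeta> /\<^sub>R D) \<bullet> k" if k: "norm k < min d (s / B)" for k
      proof (rule ccontr)
        assume neg: "\<not> ?thesis"
        \<comment> \<open>\<open>V\<close> may jump near \<open>\<xi>\<close>, so
          \<open>\<rho>\<close> is linearised at the supposed upper bound \<open>q\<close>, which is
          within \<open>B * norm k\<close> of \<open>r\<close>; monotonicity then passes to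
          \<open>V (\<xi> + k)\<close>. The two errors \<open>D * e / 4 * norm k\<close> add up to
          half the deficit \<open>D * e * norm k\<close>.\<close>
        define q where "q = r + (\<zeta> \<bullet> k) / D - e * norm k"
        have Vq: "V (\<xi> + k) < q" using neg by (simp add: q_def r_def divide_inverse_commute)
        have "\<bar>q - r\<bar> \<le> \<bar>(\<zeta> \<bullet> k) / D\<bar> + e * norm k"
          using e abs_triangle_ineq4[of "(\<zeta> \<bullet> k) / D" "e * norm k"] by (simp add: q_def)
        also have "\<bar>(\<zeta> \<bullet> k) / D\<bar> \<le> norm \<zeta> * norm k / D"
          using D Cauchy_Schwarz_ineq2[of \<zeta> k] by (simp add: divide_right_mono)
        finally have qr: "\<bar>q - r\<bar> \<le> B * norm k" by (simp add: B_def algebra_simps)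
        also have "\<dots> < s" using k B by (simp add: pos_less_divide_eq mult.commute)
        finally have "\<rho> q - \<rho> r - D * (q - r) \<le> e' * \<bar>q - r\<bar>" using s(2)[of q] by simp
        also have "\<dots> \<le> e' * (B * norm k)" using qr e' by (intro mult_left_mono) auto
        also have "\<dots> = D * e / 4 * norm k" using B by (simp add: e'_def)
        finally have 1: "\<rho> q \<le> \<rho> r + D * (q - r) + D * e / 4 * norm k" by simp
        have 2: "D * (q - r) = \<zeta> \<bullet> k - D * e * norm k" using D by (simp add: q_def algebra_simps)
        have 3: "\<rho> (V (\<xi> + k)) < \<rho> q" using class_K_less[OF cK nn Vq] .
        have 4: "- (D * e / 4 * norm k) \<le> \<rho> (V (\<xi> + k)) - \<rho> r - \<zeta> \<bullet> k" using d(2)[of k] k by (simp add: r_def)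
        have "D * e * norm k < D * e / 2 * norm k" using 1 2 3 4 by (simp add: algebra_simps)
        then have "D * e / 2 * norm k < 0" by simp
        moreover have "0 \<le> D * e / 2 * norm k" using D e by simp
        ultimately show False by simp
      qed
      moreover have "0 < min d (s / B)" using d(1) s(1) B by simp
      ultimately show "\<exists>d>0. \<forall>k. norm k < d \<longrightarrow> - (e * norm k) \<le> V (\<xi> + k) - V \<xi> - (\<zeta> /\<^sub>R D) \<bullet> k" by blast
    qed
    then have "(\<zeta> /\<^sub>R D) \<bullet> v \<le> - \<alpha> r" unfolding r_def by (rule dec')
    then have "D * ((\<zeta> /\<^sub>R D) \<bullet> v) \<le> D * (- \<alpha> r)" using D by (intro mult_left_mono) auto
    then have "\<zeta> \<bullet> v \<le> - (D * \<alpha> r)" using D by (simp add: mult.assoc[symmetric])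
    then show ?thesis using rate[OF r] by (simp add: D_def r_def)
  qed
qed

lemma lower_semicontinuous_compose_class_K_inf:
  assumes V: "lower_semicontinuous V" and nn: "\<And>\<xi>. 0 \<le> V \<xi>" and K: "class_K_inf \<rho>"
  shows "lower_semicontinuous (\<lambda>\<xi>. \<rho> (V \<xi>))"
  unfolding lower_semicontinuous_def
proof (intro allI impI)
  fix \<xi> a assume a: "a < \<rho> (V \<xi>)"
  have cK: "class_K \<rho>" using K by (simp add: class_K_inf_def)
  show "\<forall>\<^sub>F \<eta> in nhds \<xi>. a < \<rho> (V \<eta>)"
  proof (cases "0 \<le> a")
    case True
    obtain q where q: "class_K_inf q" "\<And>s. 0 \<le> s \<Longrightarrow> q (\<rho> s) = s" "\<And>r. 0 \<le> r \<Longrightarrow> \<rho> (q r) = r"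
      using class_K_inf_inverse[OF K] by blast
    have qa: "0 \<le> q a" "\<rho> (q a) = a" using q True class_K_nonneg[of q a] by (auto simp: class_K_inf_def)
    have "q a < V \<xi>" using class_K_le[OF cK nn, of \<xi> "q a"] a qa by linarith
    then have "\<forall>\<^sub>F \<eta> in nhds \<xi>. q a < V \<eta>" using V by (simp add: lower_semicontinuous_def)
    then show ?thesis
    proof eventually_elim
      case (elim \<eta>)
      then show ?case using class_K_less[OF cK qa(1) elim] qa(2) by simp
    qed
  next
    case False
    then have "a < \<rho> (V \<eta>)" for \<eta> using class_K_nonneg[OF cK nn, of \<eta>] by linarith
    then show ?thesis by simp
  qed
qed

lemma inf_convolution_nonneg: "(\<And>\<eta>. 0 \<le> V \<eta>) \<Longrightarrow> 0 \<le> p \<Longrightarrow> 0 \<le> inf_convolution p V \<xi>"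
  by (rule inf_convolution_ge) (simp add: add_nonneg_nonneg)

lemma inf_convolution_le_self: "(\<And>\<eta>. 0 \<le> V \<eta>) \<Longrightarrow> 0 \<le> p \<Longrightarrow> inf_convolution p V \<xi> \<le> V \<xi>"
  using inf_convolution_le[of V p \<xi> \<xi>] by simp

text \<open>Keeps minimizers in a tube around the solution, hence in \<open>E\<close>, the only
  place where decay is assumed.\<close>

lemma inf_convolution_minimizer_near:
  fixes V :: "'a::euclidean_space \<Rightarrow> real"
  assumes nn: "\<And>\<eta>. 0 \<le> V \<eta>" and p: "0 < p" and C: "V \<xi> \<le> C" "C < p * d^2" "0 < d"
    and \<eta>: "inf_convolution p V \<xi> = V \<eta> + p * (norm (\<xi> - \<eta>))^2"
  shows "norm (\<xi> - \<eta>) < d"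
proof -
  have "V \<eta> + p * (norm (\<xi> - \<eta>))^2 \<le> C" using inf_convolution_le_self[of V p \<xi>] nn p C \<eta> by simp
  then have "p * (norm (\<xi> - \<eta>))^2 < p * d^2" using nn[of \<eta>] C by linarith
  then have "(norm (\<xi> - \<eta>))^2 < d^2" using p by simp
  then show ?thesis using C(3) by (simp add: power_less_imp_less_base)
qed

lemma norm_add_square:
  fixes a b :: "'a::real_inner" shows "(norm (a + b))^2 = (norm a)^2 + 2 * (a \<bullet> b) + (norm b)^2"
  by (simp add: power2_norm_eq_inner inner_add_left inner_add_right inner_commute)

text \<open>The minimizer at \<open>\<xi>\<close> competes at \<open>\<xi>'\<close>; expanding the
  square leaves a linear term and a quadratic remainder. An upper bound suffices, since only upper
  right increments are estimated.\<close>

lemma inf_convolution_increment: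
  fixes V :: "'a::euclidean_space \<Rightarrow> real"
  assumes nn: "\<And>\<eta>. 0 \<le> V \<eta>" and p: "0 \<le> p"
    and \<eta>: "inf_convolution p V \<xi> = V \<eta> + p * (norm (\<xi> - \<eta>))^2"
  shows "inf_convolution p V \<xi>' - inf_convolution p V \<xi> \<le>
    (2 * p) *\<^sub>R (\<xi> - \<eta>) \<bullet> (\<xi>' - \<xi>) + p * (norm (\<xi>' - \<xi>))^2"
proof -
  have "inf_convolution p V \<xi>' \<le> V \<eta> + p * (norm ((\<xi> - \<eta>) + (\<xi>' - \<xi>)))^2"
    using inf_convolution_le[of V p \<xi>' \<eta>] nn p by simp
  also have "\<dots> = V \<eta> + p * (norm (\<xi> - \<eta>))^2 + (2 * p) *\<^sub>R (\<xi> - \<eta>) \<bullet> (\<xi>' - \<xi>) + p * (norm (\<xi>' - \<xi>))^2"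
    unfolding norm_add_square by (simp add: algebra_simps)
  finally show ?thesis using \<eta> by simp
qed

text \<open>Optimality of \<open>\<eta>\<close> is a quadratic lower bound on \<open>V\<close>
  around \<open>\<eta>\<close>. The vector is the one in \<open>inf_convolution_increment\<close>,
  which links the slope at \<open>\<xi>\<close> to decay at \<open>\<eta>\<close>.\<close>

lemma inf_convolution_subgradient:
  fixes V :: "real^'n \<Rightarrow> real"
  assumes nn: "\<And>\<eta>. 0 \<le> V \<eta>" and p: "0 \<le> p"
    and \<eta>: "inf_convolution p V \<xi> = V \<eta> + p * (norm (\<xi> - \<eta>))^2"
  shows "(2 * p) *\<^sub>R (\<xi> - \<eta>) \<in> viscosity_subdifferential V \<eta>"
proof (rule proximal_subgradient[OF p])
  fix k
  have "V \<eta> + p * (norm (\<xi> - \<eta>))^2 \<le> V (\<eta> + k) + p * (norm ((\<xi> - \<eta>) + (- k)))^2"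
    using inf_convolution_le[of V p \<xi> "\<eta> + k"] nn p \<eta> by (simp add: algebra_simps)
  then show "V \<eta> + (2 * p) *\<^sub>R (\<xi> - \<eta>) \<bullet> k - p * (norm k)^2 \<le> V (\<eta> + k)"
    unfolding norm_add_square by (simp add: algebra_simps)
qed

text \<open>At a point with minimizer \<open>\<eta>\<close> the decay condition is available at \<open>\<eta>\<close> only; replacing the velocity by
  one from \<open>F \<eta>\<close> costs a multiple of the penalty \<open>p * (norm (\<xi> - \<eta>))\<^sup>2\<close>, which in turn is controlled by
  the gap between two inf-convolutions.\<close>

lemma inf_convolution_decay:
  fixes V :: "real^'n \<Rightarrow> real"
  assumes nn: "\<And>\<eta>. 0 \<le> V \<eta>" and p: "0 < p" and L: "0 \<le> L"
    and \<eta>: "inf_convolution p V \<xi> = V \<eta> + p * (norm (\<xi> - \<eta>))^2"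
    and dec: "decays_with_rate F E V (\<lambda>r. r)" and E: "\<eta> \<in> E"
    and v': "v' \<in> F \<eta>" "norm (v - v') \<le> L * norm (\<xi> - \<eta>)"
  shows "(2 * p) *\<^sub>R (\<xi> - \<eta>) \<bullet> v \<le>
    - inf_convolution p V \<xi> + (2 + 4 * L) * (inf_convolution p V \<xi> - inf_convolution (p/2) V \<xi>)"
proof -
  define \<zeta> where "\<zeta> = (2 * p) *\<^sub>R (\<xi> - \<eta>)"
  define r where "r = p * (norm (\<xi> - \<eta>))^2"
  have "\<zeta> \<in> viscosity_subdifferential V \<eta>" unfolding \<zeta>_def
    using p by (intro inf_convolution_subgradient nn \<eta>) simp
  then have 1: "\<zeta> \<bullet> v' \<le> - V \<eta>" using dec E v'(1) by (simp add: decays_with_rate_def)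
  have "\<zeta> \<bullet> (v - v') \<le> norm \<zeta> * norm (v - v')" by (rule norm_cauchy_schwarz)
  also have "\<dots> \<le> norm \<zeta> * (L * norm (\<xi> - \<eta>))" using v'(2) by (intro mult_left_mono) auto
  also have "\<dots> = 2 * L * r" using p by (simp add: \<zeta>_def r_def power2_eq_square)
  finally have 2: "\<zeta> \<bullet> v \<le> \<zeta> \<bullet> v' + 2 * L * r" by (simp add: inner_diff_right)
  \<comment> \<open>The minimizer for \<open>p\<close> also competes for \<open>p/2\<close>, where
    it saves half of the penalty \<open>r\<close>.\<close>
  have "inf_convolution (p/2) V \<xi> \<le> V \<eta> + (p/2) * (norm (\<xi> - \<eta>))^2"
    using nn p by (intro inf_convolution_le) auto
  then have 3: "r \<le> 2 * (inf_convolution p V \<xi> - inf_convolution (p/2) V \<xi>)"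
    using \<eta> by (simp add: r_def field_simps)
  have "\<zeta> \<bullet> v \<le> - inf_convolution p V \<xi> + (1 + 2 * L) * r" using 1 2 \<eta> by (simp add: r_def[symmetric] algebra_simps)
  also have "(1 + 2 * L) * r \<le> (1 + 2 * L) * (2 * (inf_convolution p V \<xi> - inf_convolution (p/2) V \<xi>))"
    using 3 L by (intro mult_left_mono) auto
  finally show ?thesis by (simp add: \<zeta>_def algebra_simps)
qed

section \<open>Exponential decay along solutions\<close>

lemma exp_increment_le: "exp t - exp s \<le> exp t * (t - s)" for s t :: real
proof -
  have "exp t * (1 + (s - t)) \<le> exp t * exp (s - t)" by (intro mult_left_mono exp_ge_add_one_self) simp
  also have "\<dots> = exp s" by (simp flip: exp_add)
  finally show ?thesis by (simp add: algebra_simps)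
qed

text \<open>The path is compact, so a tube of radius \<open>d\<close> around it lies in
  \<open>E\<close> and \<open>V\<close> is at most \<open>C\<close> on it. For
  \<open>p \<ge> P\<close> the penalty satisfies \<open>p * d^2 > C\<close>, which forces all
  minimizers into the tube. The estimate is made for the envelope \<open>m p\<close> and passed to
  the limit.\<close>

lemma exponential_decay_along_solution:
  assumes cpt: "\<And>y. compact (F y)" and F: "locally_Lipschitz_set_map F"
    and nn: "\<And>\<xi>. 0 \<le> V \<xi>" and lsc: "lower_semicontinuous V"
    and dec: "decays_with_rate F E V (\<lambda>r. r)" and E: "open E"
    and bdd: "\<And>K. compact K \<Longrightarrow> K \<subseteq> E \<Longrightarrow> bdd_above (V ` K)"
    and sol: "is_solution F x T" and b: "0 \<le> b" "ereal b < T" and xE: "\<And>t. t \<in> {0..b} \<Longrightarrow> x t \<in> E"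
  shows "exp b * V (x b) \<le> V (x 0)"
proof -
  define S where "S = x ` {0..b}"
  have xS: "x t \<in> S" if "0 \<le> t" "t \<le> b" for t using that by (auto simp: S_def)
  have S: "compact S" "S \<subseteq> E"
    unfolding S_def using is_solution_continuous_on[OF sol b(2)] xE by (auto intro: compact_continuous_image)
  obtain d where d: "0 < d" "(\<Union>\<xi>\<in>S. ball \<xi> d) \<subseteq> E"
    using compact_subset_open_imp_ball_epsilon_subset[OF S(1) E S(2)] by blast
  obtain C0 where "\<And>\<xi>. \<xi> \<in> S \<Longrightarrow> V \<xi> \<le> C0" using bdd[OF S] by (auto simp: bdd_above_def)
  moreover define C where "C = \<bar>C0\<bar>"
  ultimately have VC: "V \<xi> \<le> C" if "\<xi> \<in> S" for \<xi> using that by fastforce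
  have C0: "0 \<le> C" by (simp add: C_def)
  obtain R where R: "0 < R" "\<And>\<xi>. \<xi> \<in> S \<Longrightarrow> norm \<xi> \<le> R" using compact_imp_bounded[OF S(1)] bounded_pos by metis
  obtain L where L: "0 < L" "lipschitz_set_map_on L (cball 0 (R + d)) F"
    using locally_Lipschitz_set_map_on_cball[OF F] by blast
  obtain M where M: "0 < M" "\<And>y a. y \<in> cball 0 (R + d) \<Longrightarrow> a \<in> F y \<Longrightarrow> norm a \<le> M"
    using locally_Lipschitz_set_map_bounded[OF F cpt] by blast
  have xM: "norm (x t - x s) \<le> M * (t - s)" if "0 \<le> s" "s \<le> t" "t \<le> b" for s t
  proof (rule is_solution_lipschitz[OF sol b(2) less_imp_le[OF M(1)] _ that])
    fix t v assume "t \<in> {0..b}" "v \<in> F (x t)"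
    then show "norm v \<le> M" using M(2)[of "x t"] R(2)[OF xS, of t] d(1) by auto
  qed
  obtain N where N: "negligible N"
    "\<And>t. 0 \<le> t \<Longrightarrow> ereal t < T \<Longrightarrow> t \<notin> N \<Longrightarrow> \<exists>v\<in>F (x t). (x has_vector_derivative v) (at t)"
    using is_solutionE[OF sol] by blast
  define m where "m p t = inf_convolution p V (x t)" for p t
  define P where "P = C / d^2 + 1"
  have P: "0 < P" using C0 d by (simp add: P_def add_nonneg_pos)
  have big: "C < p * d^2" if "P \<le> p" for p
  proof -
    have "C / d^2 < p" using that by (simp add: P_def)
    then show ?thesis using d(1) by (simp add: pos_divide_less_eq)
  qed
  have m0: "0 \<le> m p t" if "P \<le> p" for p t
    unfolding m_def using that P nn by (intro inf_convolution_nonneg) auto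
  have mV: "m p t \<le> V (x t)" if "P \<le> p" for p t
    unfolding m_def using that P nn by (intro inf_convolution_le_self) auto
  have mC: "m p t \<le> C" if "P \<le> p" "0 \<le> t" "t \<le> b" for p t
    using mV[OF that(1)] VC[OF xS[OF that(2,3)]] by (rule order_trans)
  have min_near: "\<exists>\<eta>. m p t = V \<eta> + p * (norm (x t - \<eta>))^2 \<and> norm (x t - \<eta>) < d"
    if p: "P \<le> p" and t: "0 \<le> t" "t \<le> b" for p t
  proof -
    have p0: "0 < p" using p P by simp
    obtain \<eta> where \<eta>: "inf_convolution p V (x t) = V \<eta> + p * (norm (x t - \<eta>))^2"
      using inf_convolution_attained[where V = V, OF nn lsc p0] by blast
    then have "norm (x t - \<eta>) < d"
      using inf_convolution_minimizer_near[where V = V, OF nn p0 VC[OF xS[OF t]] big[OF p] d(1)] by blast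
    with \<eta> show ?thesis by (auto simp: m_def)
  qed
  \<comment> \<open>\<open>2 * p * d\<close> bounds the gradient of the penalty at a minimizer,
    \<open>2 * p * R\<close> comes from the quadratic remainder, as two points of the path are at
    most \<open>2 * R\<close> apart, and \<open>M\<close> bounds the speed.\<close>
  define \<Lambda> where "\<Lambda> p = p * (2 * d + 2 * R) * M" for p
  have m_incr: "m p t - m p s \<le> \<Lambda> p * \<bar>t - s\<bar>" if p: "P \<le> p" and st: "0 \<le> s" "s \<le> b" "0 \<le> t" "t \<le> b" for p s t
  proof -
    obtain \<eta> where \<eta>: "m p s = V \<eta> + p * (norm (x s - \<eta>))^2" "norm (x s - \<eta>) < d" using min_near[OF p st(1,2)] by blast
    define \<Delta> where "\<Delta> = norm (x t - x s)"
    have \<Delta>: "\<Delta> \<le> M * \<bar>t - s\<bar>" "\<Delta> \<le> 2 * R" "0 \<le> \<Delta>"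
    proof -
      show "\<Delta> \<le> M * \<bar>t - s\<bar>" using xM[of s t] xM[of t s] st by (cases "s \<le> t") (auto simp: \<Delta>_def norm_minus_commute)
      show "\<Delta> \<le> 2 * R" using R(2)[OF xS, of s] R(2)[OF xS, of t] st norm_triangle_ineq4[of "x t" "x s"] by (simp add: \<Delta>_def)
    qed (simp add: \<Delta>_def)
    have p0: "0 < p" using p P by simp
    have "m p t - m p s \<le> (2 * p) *\<^sub>R (x s - \<eta>) \<bullet> (x t - x s) + p * \<Delta>^2"
      unfolding m_def \<Delta>_def using \<eta>(1) p0 nn by (intro inf_convolution_increment) (auto simp: m_def)
    also have "(2 * p) *\<^sub>R (x s - \<eta>) \<bullet> (x t - x s) \<le> norm ((2 * p) *\<^sub>R (x s - \<eta>)) * \<Delta>"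
      unfolding \<Delta>_def by (rule norm_cauchy_schwarz)
    also have "\<dots> \<le> (2 * p * d) * \<Delta>" using \<eta>(2) p0 \<Delta>(3) by (intro mult_right_mono) auto
    also have "p * \<Delta>^2 \<le> p * (2 * R * \<Delta>)" using \<Delta> p0 by (intro mult_left_mono) (auto simp: power2_eq_square mult_right_mono)
    also have "2 * p * d * \<Delta> + p * (2 * R * \<Delta>) = p * (2 * d + 2 * R) * \<Delta>" by (simp add: algebra_simps)
    also have "\<dots> \<le> p * (2 * d + 2 * R) * (M * \<bar>t - s\<bar>)" using \<Delta> p0 d R by (intro mult_left_mono) auto
    finally show ?thesis by (simp add: \<Lambda>_def mult.assoc)
  qed
  have m_lip: "\<bar>m p t - m p s\<bar> \<le> \<Lambda> p * \<bar>t - s\<bar>" if "P \<le> p" "0 \<le> s" "s \<le> b" "0 \<le> t" "t \<le> b" for p s t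
    using m_incr[of p s t] m_incr[of p t s] that by (simp add: abs_le_iff abs_minus_commute)
  have m_cont: "continuous_on {0..b} (m p)" if p: "P \<le> p" for p
  proof (rule lipschitz_on_continuous_on, rule lipschitz_onI)
    show "dist (m p s) (m p t) \<le> \<Lambda> p * dist s t" if "s \<in> {0..b}" "t \<in> {0..b}" for s t
      using m_lip[OF p, of t s] that by (simp add: dist_real_def)
    show "0 \<le> \<Lambda> p" using p P d R M by (auto simp: \<Lambda>_def intro!: mult_nonneg_nonneg add_nonneg_nonneg)
  qed
  define k where "k = exp b * (2 + 4 * L)"
  define c where "c p t = m p t - m (p/2) t" for p t
  \<comment> \<open>Twice \<open>P\<close>, because penalties \<open>p\<close> and
    \<open>p/2\<close> are compared and both must be large enough.\<close>
  have main: "exp b * m p b - V (x 0) \<le> k * integral {0..b} (c p)" if p2: "2 * P \<le> p" for p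
  proof -
    have p: "P \<le> p" "P \<le> p/2" "0 < p" using p2 P by auto
    define g where "g t = exp t * m p t" for t
    have c0: "0 \<le> c p t" if t: "0 \<le> t" "t \<le> b" for t
    proof -
      obtain \<eta> where \<eta>: "m p t = V \<eta> + p * (norm (x t - \<eta>))^2" using min_near[OF p(1) t] by blast
      have "m (p/2) t \<le> V \<eta> + (p/2) * (norm (x t - \<eta>))^2"
        unfolding m_def using nn p by (intro inf_convolution_le) auto
      moreover have "0 \<le> p/2 * (norm (x t - \<eta>))^2" using p by simp
      moreover have "p * (norm (x t - \<eta>))^2 = p/2 * (norm (x t - \<eta>))^2 + p/2 * (norm (x t - \<eta>))^2" by simp
      ultimately show ?thesis using \<eta> unfolding c_def by linarith
    qed
    have ccont: "continuous_on {0..b} (c p)" unfolding c_def by (intro continuous_intros m_cont p)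
    have "g b - g 0 \<le> integral {0..b} (\<lambda>t. k * c p t)"
    proof (rule absolutely_continuous_integral_bound[OF b(1) _ N(1)])
      show "continuous_on {0..b} (\<lambda>t. k * c p t)" by (intro continuous_intros ccont)
      show "absolutely_continuous_on {0..b} g"
      proof (rule lipschitz_imp_absolutely_continuous[where M = "exp b * (\<Lambda> p + C)"])
        fix s t assume st: "s \<in> {0..b}" "t \<in> {0..b}" "s \<le> t"
        have "g t - g s = exp t * (m p t - m p s) + (exp t - exp s) * m p s" by (simp add: g_def algebra_simps)
        then have "norm (g t - g s) \<le> exp t * \<bar>m p t - m p s\<bar> + (exp t - exp s) * m p s"
          using abs_triangle_ineq[of "exp t * (m p t - m p s)" "(exp t - exp s) * m p s"] st m0[OF p(1), of s]
          by (simp add: abs_mult)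
        also have "exp t * \<bar>m p t - m p s\<bar> \<le> exp b * (\<Lambda> p * (t - s))"
          using m_lip[OF p(1), of s t] st by (intro mult_mono) auto
        also have "(exp t - exp s) * m p s \<le> (exp b * (t - s)) * C"
        proof (rule mult_mono)
          have "exp t * (t - s) \<le> exp b * (t - s)" using st by (intro mult_right_mono) auto
          then show "exp t - exp s \<le> exp b * (t - s)" using exp_increment_le[of t s] by linarith
        qed (use mC[OF p(1), of s] m0[OF p(1), of s] st in auto)
        finally show "norm (g t - g s) \<le> exp b * (\<Lambda> p + C) * (t - s)" by (simp add: algebra_simps)
      qed
      fix t e :: real assume t: "0 \<le> t" "t < b" "t \<notin> N" and e: "0 < e"
      have "ereal t < T" using t b(2) by (simp add: less_trans[of "ereal t" "ereal b" T])
      then obtain v where v: "v \<in> F (x t)" "(x has_vector_derivative v) (at t)" using N(2) t by blast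
      have tb: "t \<le> b" using t by simp
      obtain \<eta> where \<eta>: "m p t = V \<eta> + p * (norm (x t - \<eta>))^2" "norm (x t - \<eta>) < d"
        using min_near[OF p(1) t(1) tb] by blast
      have "\<eta> \<in> ball (x t) d" using \<eta>(2) by (simp add: dist_norm)
      then have \<eta>E: "\<eta> \<in> E" using d(2) xS[OF t(1) tb] by blast
      have "norm \<eta> \<le> R + d" using R(2)[OF xS[OF t(1) tb]] \<eta>(2) norm_triangle_ineq4[of "x t" "x t - \<eta>"] by simp
      moreover have "norm (x t) \<le> R + d" using R(2)[OF xS[OF t(1) tb]] d(1) by simp
      ultimately obtain v' where v': "v' \<in> F \<eta>" "norm (v - v') \<le> L * norm (x t - \<eta>)"
        using L(2) v(1) unfolding lipschitz_set_map_on_def by force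
      define \<zeta> where "\<zeta> = (2 * p) *\<^sub>R (x t - \<eta>)"
      have \<zeta>v: "\<zeta> \<bullet> v \<le> - m p t + (2 + 4 * L) * c p t"
        unfolding \<zeta>_def m_def c_def using \<eta>(1) L(1) p(3)
        by (intro inf_convolution_decay[where V = V, OF nn _ _ _ dec \<eta>E v']) (auto simp: m_def)
      \<comment> \<open>Half of \<open>e\<close> goes to the differentiation error of
        \<open>x\<close>, half to the quadratic remainder; \<open>exp b\<close> anticipates the
        weight, and the 1 in \<open>e1\<close> covers \<open>\<zeta> = 0\<close>.\<close>
      define e1 where "e1 = e / (2 * exp b * (norm \<zeta> + 1))"
      define e2 where "e2 = e / (2 * exp b * (p * M^2 + 1))"
      have e1: "0 < e1" "exp b * (norm \<zeta> * e1) \<le> e/2"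
      proof -
        have n: "0 < norm \<zeta> + 1" using norm_ge_zero[of \<zeta>] by linarith
        then show "0 < e1" using e by (simp add: e1_def)
        have "exp b * (norm \<zeta> * e1) \<le> exp b * ((norm \<zeta> + 1) * e1)" using \<open>0 < e1\<close> by simp
        also have "\<dots> = e/2" using n by (simp add: e1_def)
        finally show "exp b * (norm \<zeta> * e1) \<le> e/2" .
      qed
      have e2: "0 < e2" "exp b * (p * M^2 * e2) \<le> e/2"
      proof -
        have n: "0 < p * M^2 + 1" using p by (simp add: add_nonneg_pos)
        then show "0 < e2" using e by (simp add: e2_def)
        have "exp b * (p * M^2 * e2) \<le> exp b * ((p * M^2 + 1) * e2)" using \<open>0 < e2\<close> by simp
        also have "\<dots> = e/2" using n by (simp add: e2_def)
        finally show "exp b * (p * M^2 * e2) \<le> e/2" .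
      qed
      have "(x has_vector_derivative v) (at t within {t..b})" using v(2) has_vector_derivative_at_within by blast
      then have "\<forall>\<^sub>F s in at_right t. norm (x s - x t - (s - t) *\<^sub>R v) \<le> e1 * (s - t)"
        using t e1 by (intro has_vector_derivative_at_rightD) auto
      moreover have "\<forall>\<^sub>F s in at_right t. t < s \<and> s < min b (t + e2)"
        using t e2 by (subst eventually_at_right_field) (auto intro!: exI[of _ "min b (t + e2)"])
      ultimately show "\<forall>\<^sub>F s in at_right t. g s - g t \<le> (k * c p t + e) * (s - t)"
      proof eventually_elim
        case (elim s)
        define \<Delta> where "\<Delta> = x s - x t"
        have st: "0 < s - t" "s \<le> b" "s - t \<le> e2" using elim by auto
        have 1: "m p s - m p t \<le> \<zeta> \<bullet> \<Delta> + p * (norm \<Delta>)^2"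
          unfolding m_def \<zeta>_def \<Delta>_def using \<eta>(1) p(3) nn by (intro inf_convolution_increment) (auto simp: m_def)
        have "\<zeta> \<bullet> (\<Delta> - (s - t) *\<^sub>R v) \<le> norm \<zeta> * norm (\<Delta> - (s - t) *\<^sub>R v)" by (rule norm_cauchy_schwarz)
        also have "\<dots> \<le> norm \<zeta> * (e1 * (s - t))" using elim(1) by (intro mult_left_mono) (auto simp: \<Delta>_def)
        finally have 2: "\<zeta> \<bullet> \<Delta> \<le> (s - t) * (\<zeta> \<bullet> v) + norm \<zeta> * e1 * (s - t)" by (simp add: inner_diff_right)
        have "norm \<Delta> \<le> M * (s - t)" using xM[of t s] t st by (simp add: \<Delta>_def)
        then have "(norm \<Delta>)^2 \<le> (M * (s - t))^2" by (intro power_mono) auto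
        also have "\<dots> = M^2 * (s - t) * (s - t)" by (simp add: power2_eq_square)
        also have "\<dots> \<le> M^2 * (s - t) * e2" using st by (intro mult_left_mono) auto
        finally have 3: "p * (norm \<Delta>)^2 \<le> p * (M^2 * (s - t) * e2)" using p by (intro mult_left_mono) auto
        have "(s - t) * (\<zeta> \<bullet> v) \<le> (s - t) * (- m p t + (2 + 4 * L) * c p t)" using \<zeta>v st by (intro mult_left_mono) auto
        with 1 2 3 have "m p s - m p t \<le> (s - t) * (- m p t + (2 + 4 * L) * c p t) + norm \<zeta> * e1 * (s - t) + p * (M^2 * (s - t) * e2)"
          by linarith
        also have "\<dots> = (s - t) * ((2 + 4 * L) * c p t + norm \<zeta> * e1 + p * M^2 * e2) - (s - t) * m p t"
          by (simp add: algebra_simps)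
        finally have 4: "m p s - m p t \<le> (s - t) * ((2 + 4 * L) * c p t + norm \<zeta> * e1 + p * M^2 * e2) - (s - t) * m p t" .
        define B where "B = (2 + 4 * L) * c p t + norm \<zeta> * e1 + p * M^2 * e2"
        have B: "0 \<le> B" unfolding B_def using c0[OF t(1) tb] L e1 e2 p by (intro add_nonneg_nonneg mult_nonneg_nonneg) auto
        have "g s - g t = exp s * (m p s - m p t) + (exp s - exp t) * m p t" by (simp add: g_def algebra_simps)
        also have "exp s * (m p s - m p t) \<le> exp s * ((s - t) * B - (s - t) * m p t)"
          using 4 by (intro mult_left_mono) (auto simp: B_def)
        also have "(exp s - exp t) * m p t \<le> exp s * (s - t) * m p t"
          using exp_increment_le[of s t] m0[OF p(1), of t] by (intro mult_right_mono) auto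
        \<comment> \<open>The decay \<open>- m p t\<close> cancels the growth of the weight exactly;
          this is the point of the rate \<open>r\<close>.\<close>
        also have "exp s * ((s - t) * B - (s - t) * m p t) + exp s * (s - t) * m p t = exp s * ((s - t) * B)"
          by (simp add: algebra_simps)
        also have "\<dots> \<le> exp b * ((s - t) * B)" using st B by (intro mult_right_mono) auto
        also have "\<dots> = (k * c p t + exp b * (norm \<zeta> * e1) + exp b * (p * M^2 * e2)) * (s - t)"
          by (simp add: B_def k_def algebra_simps)
        also have "\<dots> \<le> (k * c p t + e) * (s - t)" using e1(2) e2(2) st by (intro mult_right_mono) auto
        finally show ?case by simp
      qed
    qed
    moreover have "g 0 \<le> V (x 0)" using mV[OF p(1), of 0] by (simp add: g_def)
    ultimately show ?thesis using ccont by (simp add: g_def)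
  qed
  define p where "p n = 2 * P + 2 * real n" for n
  have pP: "2 * P \<le> p n" "P \<le> p n" "P \<le> p n / 2" for n using P by (auto simp: p_def)
  have plim: "filterlim p at_top sequentially" "filterlim (\<lambda>n. p n / 2) at_top sequentially"
  proof -
    have *: "filterlim (\<lambda>n. P + real n) at_top sequentially"
      by (rule filterlim_tendsto_add_at_top[OF tendsto_const filterlim_real_sequentially])
    show "filterlim p at_top sequentially"
      by (rule filterlim_at_top_mono[OF *]) (use P in \<open>auto simp: p_def\<close>)
    have "(\<lambda>n. p n / 2) = (\<lambda>n. P + real n)" by (simp add: p_def fun_eq_iff)
    then show "filterlim (\<lambda>n. p n / 2) at_top sequentially" using * by simp
  qed
  have mlim: "(\<lambda>n. m (p n) t) \<longlonglongrightarrow> V (x t)" "(\<lambda>n. m (p n / 2) t) \<longlonglongrightarrow> V (x t)" for t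
    unfolding m_def by (intro inf_convolution_tendsto nn lsc plim)+
  \<comment> \<open>Both envelopes tend to \<open>V (x t)\<close> at each \<open>t\<close>, and
    their difference is at most \<open>C\<close> in size.\<close>
  have "(\<lambda>n. integral {0..b} (c (p n))) \<longlonglongrightarrow> integral {0..b} (\<lambda>_. 0)"
  proof (rule dominated_convergence(2)[where h = "\<lambda>_. C"])
    show "c (p n) integrable_on {0..b}" for n
      unfolding c_def by (intro integrable_continuous_real continuous_intros m_cont pP)
    show "norm (c (p n) t) \<le> C" if "t \<in> {0..b}" for n t
      using m0[OF pP(2), of n t] m0[OF pP(3), of n t] mC[OF pP(2), of t n] mC[OF pP(3), of t n] that by (simp add: c_def abs_le_iff)
    show "(\<lambda>n. c (p n) t) \<longlonglongrightarrow> 0" for t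
      using tendsto_diff[OF mlim(1)[of t] mlim(2)[of t]] by (simp add: c_def)
  qed (simp add: integrable_const_ivl)
  then have lim0: "(\<lambda>n. k * integral {0..b} (c (p n))) \<longlonglongrightarrow> 0" by (simp add: tendsto_mult_right_zero)
  have "(\<lambda>n. exp b * m (p n) b - V (x 0)) \<longlonglongrightarrow> exp b * V (x b) - V (x 0)"
    by (intro tendsto_intros mlim)
  then have "exp b * V (x b) - V (x 0) \<le> 0"
    by (rule LIMSEQ_le[OF _ lim0]) (use main[OF pP(1)] in blast)
  then show ?thesis by simp
qed

section \<open>The equivalence\<close>

lemma class_K_inf_scale: "class_K_inf g \<Longrightarrow> 0 < c \<Longrightarrow> class_K_inf (\<lambda>s. c * g s)"
proof -
  assume g: "class_K_inf g" and c: "0 < c"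
  then have K: "class_K g" by (simp add: class_K_inf_def)
  show ?thesis
  proof (rule class_K_infI)
    show "class_K (\<lambda>s. c * g s)"
      using K c class_K_less[OF K] by (intro class_KI) (auto simp: class_K_def intro!: continuous_intros)
    show "\<exists>s\<ge>0. B < c * g s" for B
    proof -
      obtain s where "0 < s" "B / c < g s" using class_K_inf_unbounded[OF g] by blast
      then show ?thesis using c by (intro exI[of _ s]) (auto simp: pos_divide_less_eq mult.commute)
    qed
  qed
qed

lemma class_KL_exponential_decay:
  assumes q: "class_K_inf q" and g: "class_K_inf g"
  shows "class_KL (\<lambda>s t. q (exp (- t) * g s))"
  unfolding class_KL_def
proof (intro conjI allI impI)
  have qK: "class_K q" and gK: "class_K g" using q g by (simp_all add: class_K_inf_def)
  show "class_K (\<lambda>s. q (exp (- t) * g s))" for t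
    using class_K_inf_compose[OF q class_K_inf_scale[OF g]] by (simp add: class_K_inf_def)
  fix s :: real assume s: "0 \<le> s"
  have gs: "0 \<le> g s" using class_K_nonneg[OF gK s] .
  show "antimono_on {0..} (\<lambda>t. q (exp (- t) * g s))"
    by (intro monotone_onI class_K_le[OF qK] mult_right_mono) (use gs in auto)
  have "((\<lambda>t. exp (- t)) \<longlongrightarrow> (0::real)) at_top"
    by (rule filterlim_compose[OF exp_at_bot filterlim_uminus_at_bot_at_top])
  then have "((\<lambda>t. exp (- t) * g s) \<longlongrightarrow> 0) at_top" by (rule tendsto_mult_left_zero)
  then have "((\<lambda>t. q (exp (- t) * g s)) \<longlongrightarrow> q 0) at_top"
    using qK gs by (intro continuous_on_tendsto_compose[of "{0..}" q]) (auto simp: class_K_def)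
  then show "((\<lambda>t. q (exp (- t) * g s)) \<longlongrightarrow> 0) at_top" using qK by (simp add: class_K_def)
qed

lemma lsc_RES_Lyapunov_function_imp_relatively_error_stable:
  assumes cpt: "\<And>\<xi>. compact (F \<xi>)" and F: "locally_Lipschitz_set_map F"
    and \<omega>0: "\<And>\<xi>. 0 \<le> \<omega> \<xi>" and \<omega>: "continuous_on UNIV \<omega>"
    and D: "closed D" and V: "lsc_RES_Lyapunov_function F h \<omega> (- D) V"
  shows "relatively_error_stable F h \<omega> D"
proof -
  have nn: "\<And>\<xi>. 0 \<le> V \<xi>" and lsc: "lower_semicontinuous V"
    using V by (simp_all add: lsc_RES_Lyapunov_function_def)
  obtain \<alpha>1 \<alpha>2 \<alpha>3 where a1: "class_K_inf \<alpha>1" and a2: "class_K_inf \<alpha>2"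
    and sand: "\<And>\<xi>. \<xi> \<in> - D \<Longrightarrow> \<alpha>1 (norm (h \<xi>)) \<le> V \<xi>" "\<And>\<xi>. \<xi> \<in> - D \<Longrightarrow> V \<xi> \<le> \<alpha>2 (\<omega> \<xi>)"
    and a3: "continuous_positive_definite \<alpha>3" and dec: "decays_with_rate F (- D) V \<alpha>3"
    using V unfolding lsc_RES_Lyapunov_function_def by blast
  obtain \<rho> \<rho>' where \<rho>: "class_K_inf \<rho>" "\<And>r. 0 < r \<Longrightarrow> (\<rho> has_real_derivative \<rho>' r) (at r)"
    "\<And>r. 0 < r \<Longrightarrow> 0 < \<rho>' r" "\<And>r. 0 < r \<Longrightarrow> \<rho> r \<le> \<rho>' r * \<alpha>3 r" "\<And>r. 0 \<le> r \<Longrightarrow> r \<le> 1 \<Longrightarrow> \<rho> r \<le> r"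
    using exponential_rate_rescaling[OF a3] by blast
  have \<rho>K: "class_K \<rho>" and a1K: "class_K \<alpha>1" using \<rho>(1) a1 by (simp_all add: class_K_inf_def)
  define W where "W \<xi> = \<rho> (V \<xi>)" for \<xi>
  define A1 where "A1 = (\<lambda>s. \<rho> (\<alpha>1 s))"
  define A2 where "A2 = (\<lambda>s. \<rho> (\<alpha>2 s))"
  have A: "class_K_inf A1" "class_K_inf A2" unfolding A1_def A2_def     by (rule class_K_inf_compose[OF \<rho>(1) a1], rule class_K_inf_compose[OF \<rho>(1) a2])
  then have AK: "class_K A1" "class_K A2" by (simp_all add: class_K_inf_def)
  have W: "A1 (norm (h \<xi>)) \<le> W \<xi>" "W \<xi> \<le> A2 (\<omega> \<xi>)" if "\<xi> \<in> - D" for \<xi>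
    unfolding W_def A1_def A2_def using sand[OF that] nn
    by (auto intro!: class_K_le[OF \<rho>K] class_K_nonneg[OF a1K])
  have Wnn: "0 \<le> W \<xi>" for \<xi> unfolding W_def by (intro class_K_nonneg[OF \<rho>K] nn)
  have Wlsc: "lower_semicontinuous W" unfolding W_def
    by (rule lower_semicontinuous_compose_class_K_inf[OF lsc nn \<rho>(1)])
  have Wdec: "decays_with_rate F (- D) W (\<lambda>r. r)" unfolding W_def
    using a3 by (intro decay_rate_rescale[OF dec _ nn \<rho>]) (auto simp: continuous_positive_definite_def)
  \<comment> \<open>Lower semicontinuity gives no upper bounds on compact sets; they come from
    \<open>A2 (\<omega> \<xi>)\<close> and continuity of \<open>\<omega>\<close>.\<close>
  have Wbdd: "bdd_above (W ` K)" if K: "compact K" "K \<subseteq> - D" for K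
  proof -
    have "bounded (\<omega> ` K)"
      by (intro compact_imp_bounded compact_continuous_image K continuous_on_subset[OF \<omega>]) auto
    then obtain B where B: "\<And>\<xi>. \<xi> \<in> K \<Longrightarrow> \<omega> \<xi> \<le> B" by (auto simp: bounded_iff abs_le_iff)
    show ?thesis
    proof (rule bdd_aboveI2)
      fix \<xi> assume \<xi>: "\<xi> \<in> K"
      then have "W \<xi> \<le> A2 (\<omega> \<xi>)" using W(2) K(2) by blast
      also have "\<dots> \<le> A2 B" by (rule class_K_le[OF AK(2) \<omega>0 B[OF \<xi>]])
      finally show "W \<xi> \<le> A2 B" .
    qed
  qed
  have "\<exists>q. class_K_inf q \<and> (\<forall>s\<ge>0. q (A1 s) = s)"
    by (rule class_K_inf_inverse[OF A(1)]) blast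
  then obtain q where q: "class_K_inf q" "\<forall>s\<ge>0. q (A1 s) = s" by blast
  have qK: "class_K q" using q(1) by (simp add: class_K_inf_def)
  show ?thesis
    unfolding relatively_error_stable_def
  proof (intro exI[of _ "\<lambda>s t. q (exp (- t) * A2 s)"] conjI allI impI ballI)
    show "class_KL (\<lambda>s t. q (exp (- t) * A2 s))" by (rule class_KL_exponential_decay[OF q(1) A(2)])
    fix x T t1 t assume x: "is_maximal_solution F x T"
      and t1: "0 < t1 \<and> ereal t1 < T \<and> (\<forall>t\<in>{0..t1}. x t \<notin> D)" and t: "t \<in> {0..t1}"
    have sol: "is_solution F x T" using x by (simp add: is_maximal_solution_def)
    have tT: "ereal t < T" using t t1 by (simp add: le_less_trans[of "ereal t" "ereal t1" T])
    have "exp t * W (x t) \<le> W (x 0)"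
      using t t1 by (intro exponential_decay_along_solution[OF cpt F Wnn Wlsc Wdec _ Wbdd sol _ tT]) (auto simp: D open_Compl)
    also have "\<dots> \<le> A2 (\<omega> (x 0))" using t1 by (intro W(2)) auto
    finally have "W (x t) \<le> exp (- t) * A2 (\<omega> (x 0))" by (simp add: exp_minus field_simps)
    moreover have "A1 (norm (h (x t))) \<le> W (x t)" using t t1 by (intro W(1)) auto
    ultimately have "A1 (norm (h (x t))) \<le> exp (- t) * A2 (\<omega> (x 0))" by simp
    then have "q (A1 (norm (h (x t)))) \<le> q (exp (- t) * A2 (\<omega> (x 0)))"
      by (intro class_K_le[OF qK] class_K_nonneg[OF AK(1)]) auto
    then show "norm (h (x t)) \<le> q (exp (- t) * A2 (\<omega> (x 0)))" using q(2) by simp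
  qed
qed

text \<open>Stability speaks of maximal solutions and positive horizons \<open>t1\<close>. An
  arbitrary solution is extended to a maximal one; for \<open>t = 0\<close> a short interval off
  \<open>D\<close> exists because \<open>x\<close> is continuous and \<open>- D\<close> is
  open.\<close>

lemma relatively_error_stable_bound:
  assumes bd: "\<forall>x T. is_maximal_solution F x T \<longrightarrow>
      (\<forall>t1. 0 < t1 \<and> ereal t1 < T \<and> (\<forall>t\<in>{0..t1}. x t \<notin> D) \<longrightarrow>
        (\<forall>t\<in>{0..t1}. norm (h (x t)) \<le> \<beta> (\<omega> (x 0)) t))"
    and D: "closed D" and sol: "is_solution F x T" and t: "0 \<le> t" "ereal t < T"
    and xD: "\<And>s. s \<in> {0..t} \<Longrightarrow> x s \<notin> D"
  shows "norm (h (x t)) \<le> \<beta> (\<omega> (x 0)) t"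
proof -
  obtain t1 where t1: "0 < t1" "t \<le> t1" "ereal t1 < T" "\<And>s. s \<in> {0..t1} \<Longrightarrow> x s \<notin> D"
  proof (cases "t = 0")
    case True
    have "0 < T" using sol by (simp add: is_solution_def)
    then obtain b where b: "0 < ereal b" "ereal b < T" using ereal_dense2 by blast
    have "continuous_on {0..b} x" using is_solution_continuous_on[OF sol b(2)] .
    moreover have "x 0 \<in> - D" using xD[of 0] t by auto
    moreover have "open (- D)" using D by auto
    ultimately obtain U where U: "open U" "0 \<in> U" "\<And>s. s \<in> {0..b} \<Longrightarrow> s \<in> U \<Longrightarrow> x s \<in> - D"
      using b(1) unfolding continuous_on_topological by (auto 0 4)
    obtain e where e: "0 < e" "ball 0 e \<subseteq> U" using U open_contains_ball by blast
    show thesis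
    proof (rule that[of "min b (e/2)"])
      show "0 < min b (e/2)" "t \<le> min b (e/2)" using b(1) e(1) True by auto
      show "ereal (min b (e/2)) < T" using b(2) by (simp add: le_less_trans[of _ "ereal b"])
      show "x s \<notin> D" if "s \<in> {0..min b (e/2)}" for s
        using U(3)[of s] e that by (auto simp: subset_eq dist_real_def)
    qed
  next
    case False
    then show thesis using that[of t] t xD by auto
  qed
  obtain z T' where z: "is_maximal_solution F z T'" "T \<le> T'" "\<And>t. 0 \<le> t \<Longrightarrow> ereal t < T \<Longrightarrow> z t = x t"
    using is_solution_maximal_extension[OF sol] by blast
  have zx: "z s = x s" if "s \<in> {0..t1}" for s
    using that t1(3) by (intro z(3)) (auto intro: le_less_trans[of "ereal s" "ereal t1" T])
  have "norm (h (z t)) \<le> \<beta> (\<omega> (z 0)) t"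
    using t1 z(2) zx t by (intro bd[rule_format, OF z(1), of t1]) auto
  then show ?thesis using zx[of t] zx[of 0] t t1 by simp
qed

text \<open>The Lyapunov function is the supremum of the exponentially weighted rescaled output along regular
  solutions up to their first exit. Restricting to regular solutions loses nothing, since the decay
  condition is only tested along solutions leaving with a prescribed velocity.\<close>

lemma relatively_error_stable_imp_exp_decay:
  assumes ne: "\<And>\<xi>. F \<xi> \<noteq> {}" and cpt: "\<And>\<xi>. compact (F \<xi>)" and F: "locally_Lipschitz_set_map F"
    and h: "continuous_on UNIV h" and \<omega>0: "\<And>\<xi>. 0 \<le> \<omega> \<xi>" and D: "closed D"
    and RES: "relatively_error_stable F h \<omega> D"
  shows "\<exists>V. lsc_exp_decay_RES_Lyapunov_function F h \<omega> (- D) V"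
proof -
  obtain \<beta> where \<beta>: "class_KL \<beta>" and bd: "\<forall>x T. is_maximal_solution F x T \<longrightarrow>
      (\<forall>t1. 0 < t1 \<and> ereal t1 < T \<and> (\<forall>t\<in>{0..t1}. x t \<notin> D) \<longrightarrow>
        (\<forall>t\<in>{0..t1}. norm (h (x t)) \<le> \<beta> (\<omega> (x 0)) t))"
    using RES unfolding relatively_error_stable_def by blast
  obtain p1 p2 where p: "class_K_inf p1" "class_K_inf p2"
    and p12: "\<And>s t. 0 \<le> s \<Longrightarrow> 0 \<le> t \<Longrightarrow> exp t * p1 (\<beta> s t) \<le> p2 s"
    using class_KL_exponential[OF \<beta>] by blast
  have p1K: "class_K p1" using p(1) by (simp add: class_K_inf_def)
  define g where "g y = p1 (norm (h y))" for y
  have g0: "0 \<le> g y" for y unfolding g_def by (intro class_K_nonneg[OF p1K]) simp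
  have gcont: "continuous_on UNIV g" unfolding g_def
  proof (rule continuous_on_compose2[of "{0..}" p1])
    show "continuous_on {0..} p1" using p1K by (simp add: class_K_def)
    show "continuous_on UNIV (\<lambda>y. norm (h y))" by (intro continuous_on_norm h)
  qed auto
  have openE: "open (- D)" using D by auto
  \<comment> \<open>Avoiding \<open>D\<close> on the closed interval \<open>{0..t}\<close> survives
    small perturbations by compactness; \<open>t < \<tau>\<close>, because a regular solution counts
    as a solution on the half-open interval.\<close>
  define admissible where "admissible \<xi> x w \<tau> t \<longleftrightarrow>
    regular_solution F x w \<tau> \<and> x 0 = \<xi> \<and> 0 \<le> t \<and> t < \<tau> \<and> (\<forall>s\<in>{0..t}. x s \<in> - D)" for \<xi> x w \<tau> t
  define S where "S \<xi> = {exp t * g (x t) | x w \<tau> t. admissible \<xi> x w \<tau> t}" for \<xi>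
  have S_le: "r \<le> p2 (\<omega> \<xi>)" if r: "r \<in> S \<xi>" for r \<xi>
  proof -
    obtain x w \<tau> t where *: "r = exp t * g (x t)" "regular_solution F x w \<tau>" "x 0 = \<xi>" "0 \<le> t" "t < \<tau>"
      "\<And>s. s \<in> {0..t} \<Longrightarrow> x s \<in> - D" using r by (auto simp: S_def admissible_def)
    have "norm (h (x t)) \<le> \<beta> (\<omega> (x 0)) t"
      using relatively_error_stable_bound[where h = h and \<beta> = \<beta> and \<omega> = \<omega>, OF bd D regular_solution_is_solution[OF *(2)] *(4)] *(5,6) by auto
    then have "g (x t) \<le> p1 (\<beta> (\<omega> (x 0)) t)" unfolding g_def by (intro class_K_le[OF p1K]) auto
    then have "exp t * g (x t) \<le> exp t * p1 (\<beta> (\<omega> (x 0)) t)" by (intro mult_left_mono) auto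
    also have "\<dots> \<le> p2 (\<omega> (x 0))" by (rule p12[OF \<omega>0 *(4)])
    finally show ?thesis using * by simp
  qed
  have S_bdd: "bdd_above (S \<xi>)" for \<xi> using S_le by (rule bdd_aboveI)
  have S_self: "g \<xi> \<in> S \<xi>" if \<xi>: "\<xi> \<in> - D" for \<xi>
  proof -
    obtain x u \<tau> where x: "regular_solution F x u \<tau>" "x 0 = \<xi>"
      using regular_solution_exists[OF cpt ne F] by blast
    then have "admissible \<xi> x u \<tau> 0" using \<xi> regular_solutionD(1)[OF x(1)] by (simp add: admissible_def)
    then show ?thesis using x(2) unfolding S_def by force
  qed
  \<comment> \<open>The value 0 on \<open>D\<close> is the least possible, so lower semicontinuity
    holds at points of \<open>D\<close> whatever happens nearby.\<close>
  define V where "V \<xi> = (if \<xi> \<in> - D then Sup (S \<xi>) else 0)" for \<xi>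
  have V_ge: "r \<le> V \<xi>" if "r \<in> S \<xi>" "\<xi> \<in> - D" for r \<xi>
    using that cSup_upper[OF that(1) S_bdd] by (simp add: V_def)
  have V_low: "g \<xi> \<le> V \<xi>" if "\<xi> \<in> - D" for \<xi> using V_ge[OF S_self[OF that] that] .
  have V_least: "V \<xi> \<le> B" if "\<xi> \<in> - D" "\<And>r. r \<in> S \<xi> \<Longrightarrow> r \<le> B" for \<xi> B
    using that S_self[OF that(1)] by (auto simp: V_def intro!: cSup_least)
  have V_up: "V \<xi> \<le> p2 (\<omega> \<xi>)" if "\<xi> \<in> - D" for \<xi> using V_least[OF that S_le] .
  have V0: "0 \<le> V \<xi>" for \<xi>
  proof (cases "\<xi> \<in> - D")
    case True
    then show ?thesis using V_low g0 order_trans by blast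
  qed (simp add: V_def)
  have lsc: "lower_semicontinuous V"
    unfolding lower_semicontinuous_def
  proof (intro allI impI)
    fix \<xi> a assume a: "a < V \<xi>"
    show "\<forall>\<^sub>F \<eta> in nhds \<xi>. a < V \<eta>"
    proof (cases "\<xi> \<in> - D")
      case False
      then have "a < 0" using a by (simp add: V_def)
      then have "a < V \<eta>" for \<eta> using V0[of \<eta>] by linarith
      then show ?thesis by simp
    next
      case True
      then have "a < Sup (S \<xi>)" using a by (simp add: V_def)
      moreover have "S \<xi> \<noteq> {}" using S_self[OF True] by blast
      ultimately obtain r where r: "r \<in> S \<xi>" "a < r" using less_cSupE by metis
      obtain x w \<tau> t where *: "r = exp t * g (x t)" "regular_solution F x w \<tau>" "x 0 = \<xi>" "0 \<le> t" "t < \<tau>"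
        "\<And>s. s \<in> {0..t} \<Longrightarrow> x s \<in> - D" using r(1) by (auto simp: S_def admissible_def)
      have "continuous_on UNIV (\<lambda>y. exp t * g y)" by (intro continuous_intros gcont)
      then have "isCont (\<lambda>y. exp t * g y) (x t)" by (simp add: continuous_on_eq_continuous_at)
      then have "((\<lambda>y. exp t * g y) \<longlongrightarrow> exp t * g (x t)) (nhds (x t))"
        unfolding isCont_def by (rule iffD1[OF tendsto_at_iff_tendsto_nhds[of "\<lambda>y. exp t * g y" "x t"]])
      from order_tendstoD(1)[OF this] have "\<forall>\<^sub>F y in nhds (x t). a < exp t * g y" using r(2) *(1) by simp
      then obtain e1 where e1: "0 < e1" "\<And>y. dist y (x t) < e1 \<Longrightarrow> a < exp t * g y"
        by (auto simp: eventually_nhds_metric)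
      have "continuous_on {0..t} x"
        using *(5) by (intro is_solution_continuous_on[OF regular_solution_is_solution[OF *(2)]]) simp
      then have "compact (x ` {0..t})" by (intro compact_continuous_image) auto
      moreover have "x ` {0..t} \<subseteq> - D" using *(6) by blast
      ultimately obtain e2 where e2: "0 < e2" "(\<Union>y\<in>x ` {0..t}. ball y e2) \<subseteq> - D"
        using compact_subset_open_imp_ball_epsilon_subset[OF _ openE] by metis
      \<comment> \<open>Within \<open>e1\<close> the output term stays above \<open>a\<close>,
        within \<open>e2\<close> the path stays off \<open>D\<close>.\<close>
      define e where "e = min e1 e2 / 2"
      have e: "0 < e" "e < e1" "e < e2" using e1 e2 by (auto simp: e_def)
      obtain \<delta> where \<delta>: "0 < \<delta>" "\<forall>\<eta>. norm (\<eta> - x 0) < \<delta> \<longrightarrow>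
        (\<exists>z u. regular_solution F z u \<tau> \<and> z 0 = \<eta> \<and> (\<forall>t\<in>{0..\<tau>}. norm (z t - x t) \<le> e))"
        using regular_solution_stable[OF cpt ne F *(2) e(1)] by (elim exE conjE)
      have "a < V \<eta>" if "dist \<eta> \<xi> < \<delta>" for \<eta>
      proof -
        have "norm (\<eta> - x 0) < \<delta>" using that *(3) by (simp add: dist_norm)
        then obtain z u where z: "regular_solution F z u \<tau>" "z 0 = \<eta>" "\<forall>t\<in>{0..\<tau>}. norm (z t - x t) \<le> e"
          using \<delta>(2) by blast
        have zE: "z s \<in> - D" if s: "s \<in> {0..t}" for s
        proof -
          have "norm (z s - x s) \<le> e" using z(3)[rule_format, of s] s *(5) by simp
          then have "z s \<in> ball (x s) e2" using e(3) by (simp add: dist_norm norm_minus_commute)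
          then show ?thesis using e2(2) s by blast
        qed
        then have "admissible \<eta> z u \<tau> t" using z *(4,5) by (simp add: admissible_def)
        then have "exp t * g (z t) \<in> S \<eta>" unfolding S_def by blast
        moreover have "\<eta> \<in> - D" using zE[of 0] z(2) *(4) by simp
        ultimately have "exp t * g (z t) \<le> V \<eta>" by (rule V_ge)
        moreover have "norm (z t - x t) \<le> e" using z(3)[rule_format, of t] *(4,5) by simp
        then have "a < exp t * g (z t)" using e(2) by (intro e1(2)) (simp add: dist_norm)
        ultimately show ?thesis by simp
      qed
      then show ?thesis using \<delta>(1) by (auto simp: eventually_nhds_metric)
    qed
  qed
  \<comment> \<open>Prefixing the piece \<open>x\<close> to a solution admissible from
    \<open>x \<tau>\<close> gives one admissible from \<open>\<xi>\<close> whose times are later by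
    \<open>\<tau>\<close>, so the weight gains \<open>exp \<tau>\<close>. Concatenation asks for a
    time \<open>1 / 2^j\<close>.\<close>
  have decay: "V (x \<tau>) \<le> exp (- \<tau>) * V \<xi>"
    if x: "regular_solution F x w \<tau>" "x 0 = \<xi>" and \<tau>: "\<tau> = 1 / 2^j" and xE: "\<And>s. s \<in> {0..\<tau>} \<Longrightarrow> x s \<in> - D" for x w \<tau> \<xi> j
  proof (rule V_least)
    have \<tau>0: "0 < \<tau>" by (rule regular_solutionD(1)[OF x(1)])
    show "x \<tau> \<in> - D" using xE[of \<tau>] \<tau>0 by simp
    fix r assume "r \<in> S (x \<tau>)"
    then obtain y u \<sigma> s where *: "r = exp s * g (y s)" "regular_solution F y u \<sigma>" "y 0 = x \<tau>" "0 \<le> s" "s < \<sigma>"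
      "\<And>r. r \<in> {0..s} \<Longrightarrow> y r \<in> - D" by (auto simp: S_def admissible_def)
    define z where "z = (\<lambda>t. if t < \<tau> then x t else y (t - \<tau>))"
    obtain u' where z: "regular_solution F z u' (\<tau> + \<sigma>)"
      using regular_solution_concat[OF x(1) \<tau> *(2,3)] unfolding z_def by blast
    have "admissible \<xi> z u' (\<tau> + \<sigma>) (\<tau> + s)"
      unfolding admissible_def
    proof (intro conjI z ballI)
      show "z 0 = \<xi>" "0 \<le> \<tau> + s" "\<tau> + s < \<tau> + \<sigma>" using \<tau>0 x(2) *(4,5) by (auto simp: z_def)
      show "z t \<in> - D" if "t \<in> {0..\<tau> + s}" for t
        using that xE[of t] *(6)[of "t - \<tau>"] by (cases "t < \<tau>") (simp_all add: z_def)
    qed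
    then have "exp (\<tau> + s) * g (z (\<tau> + s)) \<in> S \<xi>" unfolding S_def by blast
    moreover have "z (\<tau> + s) = y s" using *(4) by (simp add: z_def)
    moreover have "\<xi> \<in> - D" using xE[of 0] x(2) \<tau>0 by simp
    ultimately have "exp (\<tau> + s) * g (y s) \<le> V \<xi>" using V_ge by metis
    then have "exp \<tau> * r \<le> V \<xi>" by (simp add: *(1) exp_add mult.assoc)
    then show "r \<le> exp (- \<tau>) * V \<xi>" by (simp add: exp_minus field_simps)
  qed
  have dec: "decays_with_rate F (- D) V (\<lambda>r. r)"
    unfolding decays_with_rate_def
  proof (intro ballI)
    fix \<xi> \<zeta> v assume \<xi>: "\<xi> \<in> - D" and \<zeta>: "\<zeta> \<in> viscosity_subdifferential V \<xi>" and v: "v \<in> F \<xi>"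
    obtain C \<tau>0 where \<tau>0: "0 < \<tau>0" and C: "0 < C" and sol: "\<forall>\<tau>. 0 < \<tau> \<longrightarrow> \<tau> \<le> \<tau>0 \<longrightarrow> (\<exists>x u. regular_solution F x u \<tau> \<and> x 0 = \<xi> \<and>
      norm (x \<tau> - \<xi> - \<tau> *\<^sub>R v) \<le> C * \<tau>^2 \<and> (\<forall>t\<in>{0..\<tau>}. norm (x t - \<xi>) \<le> C * \<tau>))"
      using regular_solution_from_velocity[OF cpt ne F v] by (elim exE conjE)
    obtain d where d: "0 < d" "ball \<xi> d \<subseteq> - D" using openE \<xi> open_contains_ball by blast
    show "\<zeta> \<bullet> v \<le> - V \<xi>"
    proof (rule field_le_epsilon)
      fix e :: real assume e: "0 < e"
      define e' where "e' = e / (2 * C)"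
      have e': "0 < e'" "e' * C = e/2" using e C by (auto simp: e'_def)
      obtain d' where d': "0 < d'" "\<And>k. norm k < d' \<Longrightarrow> - (e' * norm k) \<le> V (\<xi> + k) - V \<xi> - \<zeta> \<bullet> k"
        using \<zeta> e'(1) unfolding viscosity_subdifferential_iff by blast
      \<comment> \<open>\<open>Q\<close> collects the coefficients of \<open>\<tau>^2\<close>:
        \<open>V \<xi>\<close> from expanding \<open>exp (- \<tau>)\<close> and
        \<open>norm \<zeta> * C\<close> from the deviation from the line; the 1 makes it positive.
        The bounds in \<open>\<mu>\<close> serve, in order, existence of the solution, staying off
        \<open>D\<close>, the subgradient inequality, and these quadratic terms.\<close>
      define Q where "Q = V \<xi> + norm \<zeta> * C + 1"
      have Q: "0 < Q" using V0[of \<xi>] C by (simp add: Q_def add_nonneg_pos)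
      define \<mu> where "\<mu> = min (min \<tau>0 (d / C)) (min (d' / C) (e / (2 * Q)))"
      have "0 < \<mu>" using \<tau>0 d(1) d'(1) C e Q by (simp add: \<mu>_def)
      then obtain j where j: "(1/2)^j < \<mu>" using real_arch_pow_inv[of \<mu> "1/2"] by auto
      define \<tau> where "\<tau> = (1::real) / 2^j"
      have \<tau>: "0 < \<tau>" "\<tau> \<le> \<tau>0" "C * \<tau> < d" "C * \<tau> < d'" "Q * \<tau> \<le> e/2"
      proof -
        have "\<tau> < \<mu>" using j by (simp add: \<tau>_def power_one_over)
        then have "\<tau> < \<tau>0" "\<tau> < d / C" "\<tau> < d' / C" "\<tau> < e / (2 * Q)" by (simp_all add: \<mu>_def)
        then show "\<tau> \<le> \<tau>0" "C * \<tau> < d" "C * \<tau> < d'" "Q * \<tau> \<le> e/2"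
          using C Q by (simp_all add: pos_less_divide_eq mult.commute mult.left_commute)
        show "0 < \<tau>" by (simp add: \<tau>_def)
      qed
      obtain x u where x: "regular_solution F x u \<tau>" "x 0 = \<xi>" "norm (x \<tau> - \<xi> - \<tau> *\<^sub>R v) \<le> C * \<tau>^2"
        "\<forall>t\<in>{0..\<tau>}. norm (x t - \<xi>) \<le> C * \<tau>"
        using sol[rule_format, OF \<tau>(1,2)] by (elim exE conjE)
      define k where "k = x \<tau> - \<xi>"
      have k: "norm k \<le> C * \<tau>" "norm (k - \<tau> *\<^sub>R v) \<le> C * \<tau>^2" using x(3) x(4)[rule_format, of \<tau>] \<tau>(1) by (simp_all add: k_def)
      have "x s \<in> - D" if "s \<in> {0..\<tau>}" for s
      proof -
        have "x s \<in> ball \<xi> d" using x(4)[rule_format, OF that] \<tau>(3) by (simp add: dist_norm norm_minus_commute)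
        then show ?thesis using d(2) by blast
      qed
      then have 1: "V (\<xi> + k) \<le> exp (- \<tau>) * V \<xi>" using decay[OF x(1,2) \<tau>_def] by (simp add: k_def)
      have "exp (- \<tau>) \<le> 1 - \<tau> + \<tau>^2"
      proof -
        have "exp (- \<tau>) \<le> 1 / (1 + \<tau>)" using exp_ge_add_one_self[of \<tau>] \<tau>(1) by (simp add: exp_minus field_simps)
        also have "\<dots> \<le> 1 - \<tau> + \<tau>^2"
        proof -
          have "(1 - \<tau> + \<tau>^2) * (1 + \<tau>) = 1 + \<tau>^3" by (simp add: algebra_simps power2_eq_square power3_eq_cube)
          then show ?thesis using \<tau>(1) by (simp add: divide_le_eq)
        qed
        finally show ?thesis .
      qed
      then have 2: "exp (- \<tau>) * V \<xi> \<le> (1 - \<tau> + \<tau>^2) * V \<xi>" using V0 by (intro mult_right_mono) auto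
      have "- (e' * norm k) \<le> V (\<xi> + k) - V \<xi> - \<zeta> \<bullet> k" using k(1) \<tau>(4) by (intro d'(2)) simp
      moreover have "e' * norm k \<le> e' * (C * \<tau>)" using k(1) e' by (intro mult_left_mono) auto
      ultimately have 3: "\<zeta> \<bullet> k \<le> V (\<xi> + k) - V \<xi> + e/2 * \<tau>" using e'(2) by (simp add: mult.assoc[symmetric])
      have "\<zeta> \<bullet> (\<tau> *\<^sub>R v - k) \<le> norm \<zeta> * norm (\<tau> *\<^sub>R v - k)" by (rule norm_cauchy_schwarz)
      also have "\<dots> \<le> norm \<zeta> * (C * \<tau>^2)" using k(2) by (intro mult_left_mono) (auto simp: norm_minus_commute)
      finally have 4: "\<tau> * (\<zeta> \<bullet> v) \<le> \<zeta> \<bullet> k + norm \<zeta> * C * \<tau>^2" by (simp add: inner_diff_right mult.assoc)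
      have "\<tau> * (\<zeta> \<bullet> v) \<le> (1 - \<tau> + \<tau>^2) * V \<xi> - V \<xi> + e/2 * \<tau> + norm \<zeta> * C * \<tau>^2"
        using 1 2 3 4 by linarith
      also have "\<dots> = \<tau> * (- V \<xi> + e/2 + (Q - 1) * \<tau>)"
        by (simp add: Q_def algebra_simps power2_eq_square)
      finally have "\<zeta> \<bullet> v \<le> - V \<xi> + e/2 + (Q - 1) * \<tau>" using \<tau>(1) by simp
      also have "(Q - 1) * \<tau> \<le> Q * \<tau>" using \<tau>(1) by (intro mult_right_mono) auto
      also have "\<dots> \<le> e/2" by (rule \<tau>)
      finally show "\<zeta> \<bullet> v \<le> - V \<xi> + e" by simp
    qed
  qed
  have "continuous_positive_definite (\<lambda>r. r)" by (simp add: continuous_positive_definite_def continuous_on_id)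
  then have "lsc_RES_Lyapunov_function F h \<omega> (- D) V"
    unfolding lsc_RES_Lyapunov_function_def using V0 lsc dec p V_low V_up unfolding g_def by blast
  then show ?thesis using dec unfolding lsc_exp_decay_RES_Lyapunov_function_def by blast
qed

lemma locally_Lipschitz_imp_continuous: "locally_Lipschitz f \<Longrightarrow> continuous_on UNIV f"
  unfolding locally_Lipschitz_def continuous_on_eq_continuous_at[OF open_UNIV]
  by (metis lipschitz_on_continuous_on continuous_on_eq_continuous_at)

theorem theorem1:
  fixes F :: "real^'n \<Rightarrow> (real^'n) set"
    and h :: "real^'n \<Rightarrow> real^'p"
    and \<omega> :: "real^'n \<Rightarrow> real"
    and D E :: "(real^'n) set"
  assumes F_nonempty: "\<And>\<xi>. F \<xi> \<noteq> {}"
    and F_compact: "\<And>\<xi>. compact (F \<xi>)"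
    and F_Lipschitz: "locally_Lipschitz_set_map F"
    and F_complete: "forward_complete F"
    and h_Lipschitz: "locally_Lipschitz h"
    and \<omega>_nonneg: "\<And>\<xi>. 0 \<le> \<omega> \<xi>"
    and \<omega>_continuous: "continuous_on UNIV \<omega>"
    and \<omega>_proper: "\<And>K. compact K \<Longrightarrow> compact (\<omega> -` K)"
    and D_closed: "closed D"
    and E_eq: "E = UNIV - D"
  shows "(relatively_error_stable F h \<omega> D \<longleftrightarrow> (\<exists>V. lsc_RES_Lyapunov_function F h \<omega> E V)) \<and>
         ((\<exists>V. lsc_RES_Lyapunov_function F h \<omega> E V) \<longleftrightarrow>
          (\<exists>V. lsc_exp_decay_RES_Lyapunov_function F h \<omega> E V))"
proof -
  have E: "E = - D" using E_eq by blast
  have 12: "relatively_error_stable F h \<omega> D" if "lsc_RES_Lyapunov_function F h \<omega> E V" for V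
    using lsc_RES_Lyapunov_function_imp_relatively_error_stable[OF F_compact F_Lipschitz \<omega>_nonneg \<omega>_continuous D_closed]
      that E by blast
  have 13: "\<exists>V. lsc_exp_decay_RES_Lyapunov_function F h \<omega> E V" if "relatively_error_stable F h \<omega> D"
    using relatively_error_stable_imp_exp_decay[OF F_nonempty F_compact F_Lipschitz
        locally_Lipschitz_imp_continuous[OF h_Lipschitz] \<omega>_nonneg D_closed that] E by simp
  have 32: "lsc_RES_Lyapunov_function F h \<omega> E V" if "lsc_exp_decay_RES_Lyapunov_function F h \<omega> E V" for V
    using that by (simp add: lsc_exp_decay_RES_Lyapunov_function_def)
  show ?thesis using 12 13 32 by blast
qed

end
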